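(* Let $n = 2^{d+s+t} + 2^{d+s} + 2^d - 3$ with $d, s, t$ non-negative integers. If $d \geqslant 6$ and $s, t \geqslant 4$, then $$\dim \mathrm{Ker}\big((\widetilde{Sq}^0_* )_{(5,n)}\big) = (2^3-1)(2^4-1)(2^5-1) = 3255.$$
   Context: $P_k = \mathbb F_2[x_1,\dots,x_k]$ is the graded polynomial algebra with each $x_i$ of degree 1, a module over the mod-2 Steenrod algebra $\mathcal A$ (action of the Steenrod squares $Sq^i$ determined by the usual axioms and the Cartan formula). $\mathcal A^+$ is the augmentation ideal of $\mathcal A$, and $QP_k = P_k/\mathcal A^+P_k = \mathbb F_2\otimes_{\mathcal A}P_k$; $(QP_k)_n$ is its degree-$n$ part. Kameko's squaring operation: let $\varphi: P_k\to P_k$ be the $\mathbb F_2$-linear map with $\varphi(x) = y$ if the monomial $x$ equals $x_1x_2\cdots x_k y^2$, and $\varphi(x)=0$ otherwise. For $n$ with $n-k$ even, $\varphi$ induces a homomorphism $(\widetilde{Sq}^0_* )_{(k,n)}: (QP_k)_n \to (QP_k)_{(n-k)/2}$. *)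

theory Defs
  imports Main HOL.Vector_Spaces "HOL-Library.Z2" "HOL-Library.Function_Algebras"
begin

text \<open>Polynomials over F_2 in k variables: a monomial x_1^(e_1)...x_k^(e_k) is
  represented by its exponent list e (length k); a polynomial is its coefficient
  function (nat list => bit).  Scalar multiplication over the field bit = F_2.\<close>

definition scaleF2 :: "bit \<Rightarrow> (nat list \<Rightarrow> bit) \<Rightarrow> (nat list \<Rightarrow> bit)" where
  "scaleF2 c f = (\<lambda>x. c * f x)"

definition dimF2 :: "(nat list \<Rightarrow> bit) set \<Rightarrow> nat" where
  "dimF2 V = vector_space.dim scaleF2 V"

definition spanF2 :: "(nat list \<Rightarrow> bit) set \<Rightarrow> (nat list \<Rightarrow> bit) set" where
  "spanF2 V = module.span scaleF2 V"

definition mons :: "nat \<Rightarrow> nat \<Rightarrow> nat list set" where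
  "mons k n = {e. length e = k \<and> sum_list e = n}"

definition Pdeg :: "nat \<Rightarrow> nat \<Rightarrow> (nat list \<Rightarrow> bit) set" where
  "Pdeg k n = {f. \<forall>e. f e \<noteq> 0 \<longrightarrow> e \<in> mons k n}"

text \<open>Sq^i applied to the monomial x^e (Cartan formula together with
  Sq^c(x^a) = binom(a,c) x^(a+c) in one variable): the set of monomials occurring
  with coefficient 1; distinct splittings give distinct monomials.\<close>
definition sqmon :: "nat \<Rightarrow> nat list \<Rightarrow> nat list set" where
  "sqmon i e = {e'. length e' = length e \<and> sum_list e' = sum_list e + i \<and>
      (\<forall>j<length e. e ! j \<le> e' ! j \<and> odd ((e ! j) choose (e' ! j - e ! j)))}"

definition Sq :: "nat \<Rightarrow> (nat list \<Rightarrow> bit) \<Rightarrow> (nat list \<Rightarrow> bit)" where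
  "Sq i f = (\<lambda>m. \<Sum>e \<in> {e. length e = length m \<and> sum_list e + i = sum_list m}.
                   (if m \<in> sqmon i e then f e else 0))"

text \<open>(A^+ P_k)_n: the degree-n hit polynomials, spanned by Sq^i f with i > 0
  (A^+ is generated as an algebra by the Sq^i, i > 0).\<close>
definition hit :: "nat \<Rightarrow> nat \<Rightarrow> (nat list \<Rightarrow> bit) set" where
  "hit k n = spanF2 {Sq i f | i f d. 0 < i \<and> d + i = n \<and> f \<in> Pdeg k d}"

text \<open>Kameko's map phi: phi(x_1...x_k y^2) = y, other monomials to 0.
  Coefficient of y in phi(f) is the coefficient of x^(2y+1) in f.\<close>
definition kphi :: "nat \<Rightarrow> (nat list \<Rightarrow> bit) \<Rightarrow> (nat list \<Rightarrow> bit)" where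
  "kphi k f = (\<lambda>y. if length y = k then f (map (\<lambda>a. 2 * a + 1) y) else 0)"

text \<open>dim Ker((Sq^0_*)_(k,n)) on (QP_k)_n = (P_k)_n / (A^+P_k)_n: the kernel is the
  image in the quotient of {f in (P_k)_n. phi f hit}; its dimension is
  dim(span(K \<union> hit)) - dim(hit).\<close>
definition kameko_ker_dim :: "nat \<Rightarrow> nat \<Rightarrow> nat" where
  "kameko_ker_dim k n =
     dimF2 (spanF2 ({f \<in> Pdeg k n. kphi k f \<in> hit k ((n - k) div 2)} \<union> hit k n))
     - dimF2 (hit k n)"

end

theory Submission
  imports Defs "HOL-Library.Poly_Mapping" "HOL-Library.FuncSet" "HOL-Library.Multiset"
begin

text \<open>
  Dually, the kernel consists of linear forms \<open>L\<close> on degree \<open>n\<close> that are invariant under the total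
  square, modulo those that only see monomials with all exponents odd. Write a monomial as a word:
  \<open>X\<^bsub>I\<^sub>0\<^esub> (X\<^bsub>I\<^sub>1\<^esub> (X\<^bsub>I\<^sub>2\<^esub> \<cdots>)\<^sup>2)\<^sup>2\<close>, where \<open>I\<^sub>k\<close> collects the variables whose exponent has
  binary digit \<open>k\<close>. The least weight sequence \<open>|I\<^sub>0|, |I\<^sub>1|, \<dots>\<close> on which \<open>L\<close> can be nonzero is
  \<open>3\<^sup>d 2\<^sup>s 1\<^sup>t\<close>, and invariance yields exchange relations between adjacent letters. On five variables
  these imply that the values on words of this weight determine all values on words starting with
  three variables, and that the words of this weight are spanned, modulo the relations, by
  polynomials indexed by flags \<open>V\<^sub>1 \<subset> V\<^sub>2 \<subset> V\<^sub>3\<close> in the space of linear forms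
  \<open>F_2^5\<close>; there are \<open>31 \<cdot> 15 \<cdot> 7\<close> of these. Conversely every flag gives an invariant form, the
  coefficient of the spike with exponents \<open>2\<^bsup>d+s+t\<^esup> - 1, 2\<^bsup>d+s\<^esup> - 1, 2\<^sup>d - 1\<close> after the
  corresponding linear substitution, and these forms are dual to the flag polynomials.
\<close>

text \<open>The exchange relations are the Pluecker relations modulo 2: a flag functional
  multiplies, letter by letter, the minors of the flag in the columns named by the letter. Letters
  of one block that pairwise differ in one element commute, and AAB has the same value as BBA, so a
  word over such a star of letters matters only through its set of letters. The stars used are the
  singletons, the pairs through a pivot of the first vector, and the triples through two pivots;
  other letters are rewritten into the star by incidence relations. On a star word with letter set
  S, the functional of a flag with these pivots is 1 exactly when S lies in the corresponding
  vector, read as a subset, so the dual polynomials are superset sums, by Moebius inversion over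
  subsets. That defect is shown to vanish, or is cancelled by a correction term.\<close>

declare add_bit_eq_xor [simp del] mult_bit_eq_and [simp del]

section \<open>Polynomials over the field with two elements\<close>

type_synonym 'i pol = "('i \<Rightarrow> nat) \<Rightarrow>\<^sub>0 bit"

abbreviation lookup :: "('a \<Rightarrow>\<^sub>0 'b::zero) \<Rightarrow> 'a \<Rightarrow> 'b" where
  "lookup \<equiv> Poly_Mapping.lookup"

abbreviation keys :: "('a \<Rightarrow>\<^sub>0 'b::zero) \<Rightarrow> 'a set" where
  "keys \<equiv> Poly_Mapping.keys"

abbreviation mon :: "'a \<Rightarrow> 'a \<Rightarrow>\<^sub>0 bit" where
  "mon e \<equiv> Poly_Mapping.single e 1"

definition X :: "'i set \<Rightarrow> 'i pol" where
  "X I = mon (\<lambda>i. of_bool (i \<in> I))"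

lemma bit_add_self [simp]: "(x::bit) + x = 0"
  by (cases x) auto

lemma bit_add_eq_0_iff: "(x::bit) + y = 0 \<longleftrightarrow> x = y"
  by (cases x; cases y) auto

lemma pol_add_self [simp]: "(p :: 'a \<Rightarrow>\<^sub>0 bit) + p = 0"
  by (rule poly_mapping_eqI) (simp add: lookup_add)

lemma pol_eq_sum_mon: "(p :: 'a \<Rightarrow>\<^sub>0 bit) = (\<Sum>e\<in>keys p. mon e)"
proof (rule poly_mapping_eqI)
  fix k
  have "(\<Sum>e\<in>keys p. lookup (mon e) k) = (\<Sum>e\<in>keys p. if e = k then 1 else 0)"
    by (intro sum.cong) (auto simp: lookup_single)
  also have "\<dots> = lookup p k"
    by (auto simp: in_keys_iff)
  finally show "lookup p k = lookup (\<Sum>e\<in>keys p. mon e) k"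
    by (simp add: lookup_sum)
qed

lemma square_add_char_2:
  assumes "(1 :: 'a::comm_ring_1) + 1 = 0"
  shows "(p + q)\<^sup>2 = p\<^sup>2 + (q :: 'a)\<^sup>2"
proof -
  have "2 = (0 :: 'a)" using assms by (simp add: one_add_one)
  then show ?thesis by (simp add: power2_sum)
qed

lemma pol_square_add: "(p + q)\<^sup>2 = p\<^sup>2 + (q :: 'i pol)\<^sup>2"
  by (rule square_add_char_2) simp

lemma pol_square_sum: "(\<Sum>i\<in>A. f i)\<^sup>2 = (\<Sum>i\<in>A. (f i :: 'i pol)\<^sup>2)"
  by (induction A rule: infinite_finite_induct) (auto simp: pol_square_add)

lemma mon_mult: "mon e * mon f = mon (e + f)"
  by (simp add: mult_single)

lemma mon_square: "(mon e)\<^sup>2 = mon (e + e)"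
  by (simp add: power2_eq_square mon_mult)

subsection \<open>Additive extension and substitution\<close>

definition lin :: "('a \<Rightarrow> 'b::ab_group_add) \<Rightarrow> ('a \<Rightarrow>\<^sub>0 bit) \<Rightarrow> 'b" where
  "lin \<phi> p = (\<Sum>e\<in>keys p. \<phi> e)"

lemma lin_mon [simp]: "lin \<phi> (mon e) = \<phi> e"
  by (simp add: lin_def)

text \<open>A key common to \<open>p\<close> and \<open>q\<close> disappears from
  \<open>p + q\<close>, and its two values cancel in the target because
  \<open>x + x = 0\<close>.\<close>

lemma additive_lin:
  assumes "\<And>x::'b::ab_group_add. x + x = 0"
  shows "additive (lin \<phi> :: _ \<Rightarrow> 'b)"
proof
  fix p q :: "'a \<Rightarrow>\<^sub>0 bit"
  define F where "F = keys p \<union> keys q"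
  have fin: "finite F" by (simp add: F_def)
  have *: "lin \<phi> r = (\<Sum>e\<in>F. if lookup r e = 0 then 0 else \<phi> e)" if "keys r \<subseteq> F" for r
    unfolding lin_def using that fin
    by (intro sum.mono_neutral_cong_left) (auto simp: in_keys_iff)
  have "lin \<phi> (p + q) = (\<Sum>e\<in>F. if lookup (p + q) e = 0 then 0 else \<phi> e)"
    by (rule *) (auto simp: F_def dest: subsetD[OF keys_add])
  also have "\<dots> = (\<Sum>e\<in>F. (if lookup p e = 0 then 0 else \<phi> e) + (if lookup q e = 0 then 0 else \<phi> e))"
    using assms by (intro sum.cong) (auto simp: lookup_add)
  also have "\<dots> = lin \<phi> p + lin \<phi> q"
    by (subst (1 2) *) (auto simp: F_def sum.distrib)
  finally show "lin \<phi> (p + q) = lin \<phi> p + lin \<phi> q" .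
qed

lemma additive_pol_eqI:
  assumes "additive f" "additive g" "\<And>e. f (mon e) = g (mon e)"
  shows "f p = g p"
  by (subst (1 2) pol_eq_sum_mon) (simp add: additive.sum[OF assms(1)] additive.sum[OF assms(2)] assms(3))

definition subst :: "('i::finite \<Rightarrow> 'j pol) \<Rightarrow> 'i pol \<Rightarrow> 'j pol" where
  "subst y = lin (\<lambda>e. \<Prod>i\<in>UNIV. y i ^ e i)"

lemma additive_subst: "additive (subst y)"
  unfolding subst_def by (rule additive_lin) simp

lemmas subst_add = additive.add[OF additive_subst]
  and subst_sum = additive.sum[OF additive_subst]

lemma subst_mon: "subst y (mon e) = (\<Prod>i\<in>UNIV. y i ^ e i)"
  by (simp add: subst_def)

lemma subst_mult: "subst y (p * q) = subst y p * subst y q"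
proof -
  have "subst y (mon e * q) = subst y (mon e) * subst y q" for e q
  proof (rule additive_pol_eqI[where p = q])
    show "additive (\<lambda>q. subst y (mon e * q))"
      by standard (simp add: distrib_left subst_add)
    show "additive (\<lambda>q. subst y (mon e) * subst y q)"
      by standard (simp add: distrib_left subst_add)
  qed (simp add: mon_mult subst_mon power_add prod.distrib)
  then show ?thesis
    by (intro additive_pol_eqI[where p = p and f = "\<lambda>p. subst y (p * q)" and g = "\<lambda>p. subst y p * subst y q"])
      (auto intro!: additive.intro simp: distrib_right subst_add)
qed

lemma subst_1: "subst y 1 = 1"
  using subst_mon[of y 0] by simp

lemma subst_power: "subst y (p ^ n) = subst y p ^ n"
  by (induction n) (auto simp: subst_1 subst_mult)

lemma subst_prod: "subst y (\<Prod>i\<in>A. f i) = (\<Prod>i\<in>A. subst y (f i))"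
  by (induction A rule: infinite_finite_induct) (auto simp: subst_1 subst_mult)

lemma X_empty: "X {} = 1"
  by (simp add: X_def zero_fun_def[symmetric])

lemma X_insert: "i \<notin> I \<Longrightarrow> X (insert i I) = X {i} * X I"
  by (auto simp: X_def mon_mult intro!: arg_cong[where f = mon])

lemma X_eq_prod: "finite I \<Longrightarrow> X I = (\<Prod>i\<in>I. X {i})"
proof (induction I rule: finite_induct)
  case (insert i I)
  then show ?case by (simp add: X_insert[OF insert.hyps(2)])
qed (simp add: X_empty)

lemma var_power: "X {i} ^ n = mon (\<lambda>j. if j = i then n else 0)"
  by (induction n) (auto simp: X_def mon_mult zero_fun_def[symmetric] intro!: arg_cong[where f = mon])

lemma mon_eq_prod: "(mon e :: 'i::finite pol) = (\<Prod>i\<in>UNIV. X {i} ^ e i)"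
proof -
  have "(\<Prod>i\<in>A. X {i} ^ e i) = mon (\<lambda>i. if i \<in> A then e i else 0)" if "finite A" for A
    using that
    by (induction A rule: finite_induct)
      (auto simp: var_power mon_mult zero_fun_def[symmetric] intro!: arg_cong[where f = mon])
  from this[of UNIV] show ?thesis by simp
qed

lemma subst_var: "subst y (X {i}) = y i"
proof -
  have "subst y (X {i}) = (\<Prod>j\<in>UNIV. y j ^ of_bool (j = i))"
    by (simp add: X_def subst_mon)
  also have "\<dots> = (\<Prod>j\<in>UNIV. if j = i then y j else 1)"
    by (intro prod.cong) auto
  finally show ?thesis by simp
qed

lemma subst_X: "subst y (X I) = (\<Prod>i\<in>I. y i)"
  using X_eq_prod[of I] by (simp add: subst_prod subst_var)

lemma subst_subst: "subst y (subst z p) = subst (\<lambda>i. subst y (z i)) p"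
  by (rule additive_pol_eqI[where p = p])
    (auto intro!: additive.intro simp: subst_add subst_mon subst_prod subst_power)

lemma mon_split: "mon e = X {i. odd (e i)} * (mon (\<lambda>i. e i div 2))\<^sup>2"
proof -
  have "n = of_bool (odd n) + (n div 2 + n div 2)" for n :: nat
    by (cases "odd n") (auto elim!: oddE)
  then show ?thesis
    by (auto simp: X_def mon_square mon_mult fun_eq_iff intro!: arg_cong[where f = mon])
qed

lemma var_mult_X: "X {i} * X I = (if i \<in> I then X (I - {i}) * (X {i})\<^sup>2 else X (insert i I))"
proof (cases "i \<in> I")
  case True
  then have "X I = X {i} * X (I - {i})"
    using X_insert[of i "I - {i}"] by (simp add: insert_absorb)
  with True show ?thesis by (simp add: power2_eq_square mult_ac)
qed (simp add: X_insert[of i I])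

subsection \<open>The total Steenrod square\<close>

text \<open>The total square \<open>1 + Sq\<^sup>1 + Sq\<^sup>2 + \<cdots>\<close> is the algebra map \<open>x \<mapsto> x + x\<^sup>2\<close>.\<close>
definition St :: "'i::finite pol \<Rightarrow> 'i pol" where
  "St = subst (\<lambda>i. X {i} + (X {i})\<^sup>2)"

lemma additive_St: "additive St"
  by (simp add: St_def additive_subst)

lemmas St_add = additive.add[OF additive_St]
lemmas St_mult = subst_mult[of "\<lambda>i. X {i} + (X {i})\<^sup>2", folded St_def]
lemmas St_power = subst_power[of "\<lambda>i. X {i} + (X {i})\<^sup>2", folded St_def]
lemmas St_mon = subst_mon[of "\<lambda>i. X {i} + (X {i})\<^sup>2", folded St_def]
lemmas St_var = subst_var[of "\<lambda>i. X {i} + (X {i})\<^sup>2", folded St_def]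

lemma St_X: "St (X I) = (\<Sum>A\<in>Pow I. X (I - A) * (X A)\<^sup>2)"
proof -
  have "St (X I) = (\<Prod>i\<in>I. (X {i})\<^sup>2 + X {i})"
    by (simp add: St_def subst_X add.commute)
  also have "\<dots> = (\<Sum>A\<in>Pow I. (\<Prod>i\<in>A. (X {i})\<^sup>2) * (\<Prod>i\<in>I - A. X {i}))"
    by (rule prod_add) simp
  also have "\<dots> = (\<Sum>A\<in>Pow I. X (I - A) * (X A)\<^sup>2)"
  proof (rule sum.cong[OF refl])
    fix A
    show "(\<Prod>i\<in>A. (X {i})\<^sup>2) * (\<Prod>i\<in>I - A. X {i}) = X (I - A) * (X A)\<^sup>2"
      by (simp add: X_eq_prod[of A] X_eq_prod[of "I - A"] prod_power_distrib mult.commute)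
  qed
  finally show ?thesis .
qed

lemma of_nat_pol: "(of_nat m :: 'i pol) = of_bool (odd m)"
proof -
  have "(2 :: 'i pol) = 0" by (simp flip: one_add_one)
  then have "(of_nat (2 * k) :: 'i pol) = 0" for k by simp
  then show ?thesis by (cases "even m") (auto elim!: evenE oddE simp del: of_nat_mult)
qed

text \<open>The right-hand side is the coefficient rule of \<open>sqmon\<close> with all degrees
  taken together, which later identifies \<open>St\<close> with the operations
  \<open>Sq i\<close>.\<close>

lemma lookup_St_mon:
  "lookup (St (mon f)) f' = of_bool (\<forall>i. f i \<le> f' i \<and> odd (f i choose (f' i - f i)))"
proof -
  have bin: "(X {i} + (X {i})\<^sup>2) ^ n = (\<Sum>c\<le>n. of_bool (odd (n choose c)) * X {i} ^ (n + c))"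
    for i :: 'a and n
  proof -
    have "(X {i} + (X {i})\<^sup>2) ^ n = (\<Sum>c\<le>n. of_nat (n choose c) * ((X {i})\<^sup>2) ^ c * X {i} ^ (n - c))"
      by (subst add.commute, rule binomial_ring)
    also have "\<dots> = (\<Sum>c\<le>n. of_bool (odd (n choose c)) * X {i} ^ (n + c))"
      by (intro sum.cong refl)
        (auto simp: of_nat_pol simp flip: power_mult power_add intro!: arg_cong[where f = "power _"])
    finally show ?thesis .
  qed
  define P where "P = (\<lambda>g. \<forall>i. odd (f i choose g i))"
  \<comment> \<open>A choice \<open>g\<close> takes from each factor \<open>(x + x^2) ^ f i\<close>
    the term that raises the exponent by \<open>g i\<close>; only \<open>g = f' - f\<close> can
    produce \<open>f'\<close>.\<close>
  define G where "G = PiE (UNIV :: 'a set) (\<lambda>i. {..f i})"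
  have finG: "finite G" unfolding G_def by (intro finite_PiE) auto
  have "St (mon f) = (\<Prod>i\<in>UNIV. \<Sum>c\<in>{..f i}. of_bool (odd (f i choose c)) * X {i} ^ (f i + c))"
    by (simp add: St_mon bin)
  also have "\<dots> = (\<Sum>g\<in>G. \<Prod>i\<in>UNIV. of_bool (odd (f i choose g i)) * X {i} ^ (f i + g i))"
    unfolding G_def by (rule prod_sum_PiE) auto
  also have "\<dots> = (\<Sum>g\<in>G. of_bool (P g) * mon (\<lambda>i. f i + g i))"
  proof (rule sum.cong[OF refl])
    fix g assume "g \<in> G"
    have "(\<Prod>i\<in>UNIV. of_bool (odd (f i choose g i)) :: 'a pol) = of_bool (P g)"
      by (cases "P g") (auto simp: P_def intro!: prod_zero)
    then show "(\<Prod>i\<in>UNIV. of_bool (odd (f i choose g i)) * X {i} ^ (f i + g i)) =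
      of_bool (P g) * mon (\<lambda>i. f i + g i)"
      by (simp add: prod.distrib mon_eq_prod[of "\<lambda>i. f i + g i"])
  qed
  finally have "lookup (St (mon f)) f' = (\<Sum>g\<in>G. lookup (of_bool (P g) * mon (\<lambda>i. f i + g i)) f')"
    by (simp add: lookup_sum)
  also have "\<dots> = (\<Sum>g\<in>G. if g = (\<lambda>i. f' i - f i) then of_bool (P g \<and> (\<forall>i. f i \<le> f' i)) else 0)"
  proof (rule sum.cong[OF refl])
    fix g assume "g \<in> G"
    have "(\<lambda>i. f i + g i) = f' \<longleftrightarrow> g = (\<lambda>i. f' i - f i) \<and> (\<forall>i. f i \<le> f' i)"
      by (auto simp: fun_eq_iff) (metis diff_add_inverse, metis le_add1)
    then show "lookup (of_bool (P g) * mon (\<lambda>i. f i + g i)) f' =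
      (if g = (\<lambda>i. f' i - f i) then of_bool (P g \<and> (\<forall>i. f i \<le> f' i)) else 0)"
      by (auto simp: lookup_single when_def)
  qed
  also have "\<dots> = of_bool (P (\<lambda>i. f' i - f i) \<and> (\<forall>i. f i \<le> f' i))"
  proof (cases "(\<lambda>i. f' i - f i) \<in> G")
    case True
    then show ?thesis using finG by simp
  next
    case False
    then obtain i where "f i < f' i - f i" by (auto simp: G_def PiE_def Pi_def not_le)
    then have "\<not> P (\<lambda>i. f' i - f i)" by (auto simp: P_def intro!: exI[of _ i] simp: binomial_eq_0)
    with False finG show ?thesis by simp
  qed
  finally show ?thesis by (auto simp: P_def intro!: arg_cong[where f = of_bool])
qed

definition deg :: "('i::finite \<Rightarrow> nat) \<Rightarrow> nat" where
  "deg e = (\<Sum>i\<in>UNIV. e i)"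

lemma deg_add: "deg (\<lambda>i. e i + f i) = deg e + deg f"
  by (simp add: deg_def sum.distrib)

lemma deg_strict_mono: "(\<And>i. f i \<le> f' i) \<Longrightarrow> f \<noteq> f' \<Longrightarrow> deg f < deg f'"
  unfolding deg_def by (rule sum_strict_mono_ex1) (auto simp: fun_eq_iff le_less)

text \<open>The extreme terms: Sq^0 gives the monomial itself, and the top square gives its square,
  in degree \<open>2 * deg f\<close>.\<close>

lemma keys_St_mon:
  assumes "f' \<in> keys (St (mon f))"
  shows "f' = f \<or> deg f < deg f'" "f' = (\<lambda>i. 2 * f i) \<or> deg f' < 2 * deg f"
proof -
  have le: "f i \<le> f' i" and odd: "odd (f i choose (f' i - f i))" for i
    using assms by (auto simp: in_keys_iff lookup_St_mon)
  show "f' = f \<or> deg f < deg f'"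
    using deg_strict_mono[of f f'] le by blast
  have "f' i \<le> 2 * f i" for i
    using odd[of i] by (cases "f i < f' i - f i") (auto simp: binomial_eq_0)
  then show "f' = (\<lambda>i. 2 * f i) \<or> deg f' < 2 * deg f"
    using deg_strict_mono[of f' "\<lambda>i. 2 * f i"] deg_add[of f f] by (auto simp: mult_2)
qed

lemma self_in_keys_St_mon: "f \<in> keys (St (mon f))"
  by (simp add: in_keys_iff lookup_St_mon)

lemma double_in_keys_St_mon: "(\<lambda>i. 2 * f i) \<in> keys (St (mon f))"
  by (simp add: in_keys_iff lookup_St_mon)

subsection \<open>Functionals annihilated by the positive Steenrod squares\<close>

text \<open>Together, \<open>L \<circ> St = L\<close> and concentration in degree \<open>N\<close> say that \<open>L\<close> kills all hit
  polynomials of degree \<open>N\<close>.\<close>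
definition Ann :: "nat \<Rightarrow> ('i::finite pol \<Rightarrow> bit) \<Rightarrow> bool" where
  "Ann N L \<longleftrightarrow> additive L \<and> (\<forall>f. L (St f) = L f) \<and> (\<forall>e. deg e \<noteq> N \<longrightarrow> L (mon e) = 0)"

lemma AnnD:
  assumes "Ann N L"
  shows "additive L" "L (St f) = L f" "deg e \<noteq> N \<Longrightarrow> L (mon e) = 0"
  using assms by (auto simp: Ann_def)

lemma X_mult_square_mon: "X I * (mon f)\<^sup>2 = mon (\<lambda>i. of_bool (i \<in> I) + 2 * f i)"
  by (auto simp: X_def mon_square mon_mult fun_eq_iff intro!: arg_cong[where f = mon])

lemma deg_X_mult_square: "deg (\<lambda>i. of_bool (i \<in> I) + 2 * f i) = card I + 2 * deg f"
proof -
  have "(\<Sum>i\<in>UNIV. of_bool (i \<in> I) :: nat) = card I"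
    by (simp add: of_bool_def sum.If_cases)
  then show ?thesis by (simp add: deg_def sum.distrib sum_distrib_left)
qed

lemma additive_X_square:
  assumes "additive L"
  shows "additive (\<lambda>g. L (X I * (c * g)\<^sup>2))"
  by (rule additive.intro) (simp add: distrib_left pol_square_add additive.add[OF assms])

lemma additive_down:
  assumes "additive L"
  shows "additive (\<lambda>g. L (X I * g\<^sup>2))"
  by (rule additive.intro) (simp only: distrib_left pol_square_add additive.add[OF assms])

lemma additive_pol_eq_0I:
  assumes "additive (L :: 'i pol \<Rightarrow> bit)" "\<And>e. L (mon e) = 0"
  shows "L p = 0"
  by (rule additive_pol_eqI[OF assms(1), of "\<lambda>_. 0"]) (simp_all add: additive.intro assms(2))

lemma Ann_parity:
  assumes "Ann N L" "odd (card I + N)"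
  shows "L (X (I :: 'a::finite set) * g\<^sup>2) = 0"
proof (rule additive_pol_eq_0I[OF additive_down[OF AnnD(1)[OF assms(1)]]])
  fix f :: "'a \<Rightarrow> nat"
  have "card I + 2 * deg f \<noteq> N" using assms(2) by auto
  then show "L (X I * (mon f)\<^sup>2) = 0"
    using AnnD(3)[OF assms(1)] by (simp add: X_mult_square_mon deg_X_mult_square)
qed

lemma additive_St_mon:
  assumes "additive (L :: 'i::finite pol \<Rightarrow> bit)"
  shows "L (St (mon f)) = (\<Sum>f'\<in>keys (St (mon f)). L (mon f'))"
  by (subst (1) pol_eq_sum_mon[of "St (mon f)"]) (simp add: additive.sum[OF assms])

text \<open>A functional blind above degree \<open>deg f\<close> sees only the lowest term of the
  total square; \<open>additive_St_mon_highest\<close> is the mirror image with the top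
  term.\<close>

lemma additive_St_mon_lowest:
  assumes "additive (L :: 'i::finite pol \<Rightarrow> bit)"
    and "\<And>f'. deg f < deg f' \<Longrightarrow> L (mon f') = 0"
  shows "L (St (mon f)) = L (mon f)"
proof -
  have "L (St (mon f)) = (\<Sum>f'\<in>{f}. L (mon f'))"
    unfolding additive_St_mon[OF assms(1)]
    using keys_St_mon(1)[of _ f] self_in_keys_St_mon[of f] assms(2)
    by (intro sum.mono_neutral_right) auto
  then show ?thesis by simp
qed

lemma additive_St_mon_highest:
  assumes "additive (L :: 'i::finite pol \<Rightarrow> bit)"
    and "\<And>f'. deg f' < 2 * deg f \<Longrightarrow> L (mon f') = 0"
  shows "L (St (mon f)) = L ((mon f)\<^sup>2)"
proof -
  have "L (St (mon f)) = (\<Sum>f'\<in>{\<lambda>i. 2 * f i}. L (mon f'))"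
    unfolding additive_St_mon[OF assms(1)]
    using keys_St_mon(2)[of _ f] double_in_keys_St_mon[of f] assms(2)
    by (intro sum.mono_neutral_right) auto
  moreover have "mon (\<lambda>i. 2 * f i) = (mon f)\<^sup>2"
    by (auto simp: mon_square fun_eq_iff intro!: arg_cong[where f = mon])
  ultimately show ?thesis by simp
qed

text \<open>Squares are hit: the top square of a monomial is its square, and \<open>L\<close> does
  not see the monomial itself, which has half the degree.\<close>

lemma Ann_square:
  assumes "Ann N L" "N > 0"
  shows "L (g\<^sup>2) = 0"
proof -
  note L = AnnD(1)[OF assms(1)]
  have "additive (\<lambda>g. L (g\<^sup>2))"
    using additive_down[OF L, of "{}"] by (simp add: X_empty)
  then show ?thesis
  proof (rule additive_pol_eq_0I)
    fix f
    show "L ((mon f)\<^sup>2) = 0"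
    proof (cases "2 * deg f = N")
      case True
      then have "L (St (mon f)) = L ((mon f)\<^sup>2)"
        using AnnD(3)[OF assms(1)] by (intro additive_St_mon_highest[OF L]) auto
      moreover have "L (mon f) = 0"
        using True assms(2) by (intro AnnD(3)[OF assms(1)]) auto
      ultimately show ?thesis by (simp add: AnnD(2)[OF assms(1)])
    next
      case False
      then show ?thesis
        using AnnD(3)[OF assms(1)] X_mult_square_mon[of "{}" f] deg_X_mult_square[of "{}" f]
        by (simp add: X_empty)
    qed
  qed
qed

lemma pol_power_add: "(p + q :: 'i pol) ^ (2 ^ k) = p ^ (2 ^ k) + q ^ (2 ^ k)"
  by (induction k) (simp_all add: power_mult pol_square_add mult.commute[of 2])

lemma var_power_mult_mon: "X {i} ^ n * mon f = mon (\<lambda>j. (if j = i then n else 0) + f j)"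
  by (auto simp: var_power mon_mult fun_eq_iff intro!: arg_cong[where f = mon])

lemma deg_var_power_mult: "deg (\<lambda>j. (if j = i then n else 0) + f j) = n + deg f"
  by (simp add: deg_def sum.distrib)

text \<open>Moving the square off \<open>g\<close> turns \<open>x \<cdot> g\<^sup>2\<close> into \<open>x\<^sup>2 \<cdot> Sq g\<close>, then \<open>x\<^sup>4 \<cdot> Sq g\<close>, and so on;
  the process can only stop at a nonzero value when \<open>deg g + 1\<close> is a power of two.\<close>
lemma Ann_var_mult_square:
  assumes L: "Ann (2 * D + 1) L" and D: "\<And>k. D + 1 \<noteq> 2 ^ k"
  shows "L (X {i} * g\<^sup>2) = 0"
proof (rule additive_pol_eq_0I[OF additive_down[OF AnnD(1)[OF L]]])
  fix f
  note add = AnnD(1)[OF L]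
  have addp: "additive (\<lambda>p. L (X {i} ^ m * p))" for m
    by (rule additive.intro) (simp add: distrib_left additive.add[OF add])
  show "L (X {i} * (mon f)\<^sup>2) = 0"
  proof (cases "deg f = D")
    case False
    show ?thesis
      unfolding X_mult_square_mon
      by (rule AnnD(3)[OF L], unfold deg_X_mult_square) (use False in simp)
  next
    case True
    \<comment> \<open>\<open>L\<close> ignores \<open>X {i} ^ (2 ^ k) * mon f\<close>, whose degree
      \<open>2 ^ k + D\<close> is not \<open>2 * D + 1\<close>.\<close>
    have step: "L (X {i} ^ (2 ^ k) * St (mon f)) = L (X {i} ^ (2 ^ Suc k) * St (mon f))" for k
    proof -
      have "St (X {i} ^ (2 ^ k) * mon f) = (X {i} ^ (2 ^ k) + X {i} ^ (2 ^ Suc k)) * St (mon f)"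
        by (simp add: St_mult St_power St_var pol_power_add power_mult)
      then have "L (X {i} ^ (2 ^ k) * St (mon f)) + L (X {i} ^ (2 ^ Suc k) * St (mon f))
        = L (X {i} ^ (2 ^ k) * mon f)"
        by (metis AnnD(2)[OF L] additive.add[OF add] distrib_right)
      also have "\<dots> = 0"
        using D[of k] True AnnD(3)[OF L] by (simp add: var_power_mult_mon deg_var_power_mult)
      finally show ?thesis by (simp only: bit_add_eq_0_iff)
    qed
    have "L (X {i} * St (mon f)) = L (X {i} ^ (2 ^ k) * St (mon f))" for k
      by (induction k) (simp, metis step)
    \<comment> \<open>The exponent only has to exceed the degree \<open>2 * D + 1\<close> of
      everything that \<open>L\<close> sees.\<close>
    also have "L (X {i} ^ (2 ^ (2 * D + 1)) * St (mon f)) = 0"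
    proof -
      have "L (X {i} ^ (2 ^ (2 * D + 1)) * mon f') = 0" for f'
      proof (rule trans[OF arg_cong[OF var_power_mult_mon]], rule AnnD(3)[OF L])
        have "2 * D + 1 < (2::nat) ^ (2 * D + 1)" by (rule less_exp)
        then show "deg (\<lambda>j. (if j = i then 2 ^ (2 * D + 1) else 0) + f' j) \<noteq> 2 * D + 1"
          unfolding deg_var_power_mult by linarith
      qed
      then show ?thesis using additive_pol_eq_0I[OF addp] by blast
    qed
    finally have "L (X {i} * St (mon f)) = 0" .
    moreover have "L (X {i} * St (mon f)) = L (X {i} * (mon f)\<^sup>2)"
    proof (rule additive_St_mon_highest)
      show "additive (\<lambda>p. L (X {i} * p))" using addp[of 1] by simp
      fix f' :: "'a \<Rightarrow> nat" assume "deg f' < 2 * deg f"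
      then show "L (X {i} * mon f') = 0"
        using var_power_mult_mon[of i 1 f'] deg_var_power_mult[of i 1 f'] True AnnD(3)[OF L] by simp
    qed
    ultimately show ?thesis by simp
  qed
qed

lemma St_X_mult_square: "St (X I * g\<^sup>2) = (\<Sum>A\<in>Pow I. X (I - A) * (X A * St g)\<^sup>2)"
  by (simp add: St_mult St_power St_X sum_distrib_right power_mult_distrib mult.assoc)

text \<open>In the expansion of \<open>St (X I * g^2)\<close> every term with nonempty
  \<open>A\<close> has the smaller first letter \<open>I - A\<close> and is killed by
  \<open>low\<close>; what remains is \<open>X I * (St g)^2\<close>.\<close>

lemma Ann_down:
  assumes L: "Ann (card I + 2 * M) L"
    and low: "\<And>J g. card J < card I \<Longrightarrow> L (X J * g\<^sup>2) = 0"
  shows "Ann M (\<lambda>g. L (X I * g\<^sup>2))"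
  unfolding Ann_def
proof (intro conjI allI impI additive_down[OF AnnD(1)[OF L]])
  fix g
  have "L (X I * g\<^sup>2) = (\<Sum>A\<in>Pow I. L (X (I - A) * (X A * St g)\<^sup>2))"
    by (simp flip: AnnD(2)[OF L, of "X I * g\<^sup>2"] add: St_X_mult_square additive.sum[OF AnnD(1)[OF L]])
  also have "\<dots> = (\<Sum>A\<in>{{}}. L (X (I - A) * (X A * St g)\<^sup>2))"
  proof (rule sum.mono_neutral_right)
    show "\<forall>A\<in>Pow I - {{}}. L (X (I - A) * (X A * St g)\<^sup>2) = 0"
    proof
      fix A assume "A \<in> Pow I - {{}}"
      then have "card (I - A) < card I" by (intro psubset_card_mono) auto
      then show "L (X (I - A) * (X A * St g)\<^sup>2) = 0" by (rule low)
    qed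
  qed auto
  finally show "L (X I * (St g)\<^sup>2) = L (X I * g\<^sup>2)" by (simp add: X_empty)
next
  fix e :: "'a \<Rightarrow> nat" assume "deg e \<noteq> M"
  then show "L (X I * (mon e)\<^sup>2) = 0"
    using AnnD(3)[OF L] by (simp add: X_mult_square_mon deg_X_mult_square)
qed

subsection \<open>Weight vectors\<close>

fun wt :: "nat list \<Rightarrow> nat" where
  "wt [] = 0"
| "wt (a # \<omega>) = a + 2 * wt \<omega>"

definition blocks :: "nat \<Rightarrow> nat \<Rightarrow> nat \<Rightarrow> nat list" where
  "blocks d s t = replicate d 3 @ replicate s 2 @ replicate t 1"

lemma wt_blocks: "wt (blocks d s t) + 3 = 2 ^ (d + s + t) + 2 ^ (d + s) + 2 ^ d"
proof -
  have 1: "wt (replicate t 1) + 1 = 2 ^ t" by (induction t) auto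
  have 2: "wt (replicate s 2 @ replicate t 1) + 2 = 2 ^ (s + t) + 2 ^ s"
    using 1 by (induction s) auto
  then show ?thesis unfolding blocks_def by (induction d) auto
qed

text \<open>Closed under removing the first letter, so that inductions along words stay inside it.
  Positivity of \<open>s\<close> and \<open>t\<close> is attached to \<open>d > 0\<close> because
  letters of size 3 are where \<open>two_powers_ne_power\<close> is called upon.\<close>

definition good :: "nat list \<Rightarrow> bool" where
  "good \<omega> \<longleftrightarrow> (\<exists>d s t. \<omega> = blocks d s t \<and> (0 < d \<longrightarrow> 0 < s \<and> 0 < t))"

lemma blocks_Cons:
  assumes "a # \<omega> = blocks d s t"
  obtains (three) d' where "d = Suc d'" "a = 3" "\<omega> = blocks d' s t"
  | (two) s' where "d = 0" "s = Suc s'" "a = 2" "\<omega> = blocks 0 s' t"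
  | (one) t' where "d = 0" "s = 0" "t = Suc t'" "a = 1" "\<omega> = blocks 0 0 t'"
  using assms by (cases d; cases s; cases t) (auto simp: blocks_def)

lemma good_tl: "good (a # \<omega>) \<Longrightarrow> good \<omega>"
  unfolding good_def by (elim exE conjE, erule blocks_Cons) (auto intro!: exI)

text \<open>For \<open>d = 0\<close> the number is \<open>2 ^ s * (2 ^ t + 1)\<close>, with an odd
  factor above 1; for \<open>d > 0\<close> it is odd and larger than 1.\<close>

lemma two_powers_ne_power:
  assumes "0 < s" "0 < t" and w: "w + 3 = 2 ^ (d + s + t) + 2 ^ (d + s) + 2 ^ d"
  shows "w + 2 \<noteq> (2::nat) ^ k"
proof
  assume k: "w + 2 = 2 ^ k"
  show False
  proof (cases d)
    case 0
    then have "2 ^ k = 2 ^ s * (2 ^ t + 1 :: nat)" using k w by (simp add: power_add)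
    moreover have "s < k"
    proof (rule ccontr)
      assume "\<not> s < k"
      then have "(2::nat) ^ k \<le> 2 ^ s" by (intro power_increasing) auto
      moreover have "(2::nat) ^ s < 2 ^ s * (2 ^ t + 1)" by simp
      ultimately show False using \<open>2 ^ k = 2 ^ s * (2 ^ t + 1 :: nat)\<close> by linarith
    qed
    ultimately have "2 ^ (k - s) = (2 ^ t + 1 :: nat)"
      by (simp add: power_diff)
    moreover have "even ((2::nat) ^ (k - s))" using \<open>s < k\<close> by simp
    ultimately have "even ((2::nat) ^ t + 1)" by metis
    then show False using \<open>0 < t\<close> by simp
  next
    case (Suc d')
    then have "even (w + 3)" unfolding w by simp
    then have "odd ((2::nat) ^ k)" unfolding k[symmetric] by simp
    then have "k = 0" by (cases k) auto
    with k show False by simp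
  qed
qed

text \<open>Parity leaves only \<open>card J = a - 2\<close>. For \<open>a = 3\<close> this is a
  single variable times a square, for \<open>a = 2\<close> a pure square, and for
  \<open>a = 1\<close> nothing.\<close>

lemma good_low:
  assumes g: "good (a # \<omega>)" and L: "Ann (wt (a # \<omega>)) L" and J: "card J < a"
  shows "L (X J * g\<^sup>2) = 0"
proof -
  from g obtain d s t where eq: "a # \<omega> = blocks d s t" and pos: "0 < d \<longrightarrow> 0 < s \<and> 0 < t"
    by (auto simp: good_def)
  show ?thesis
  proof (cases "odd (card J + wt (a # \<omega>))")
    case True
    then show ?thesis by (rule Ann_parity[OF L])
  next
    case False
    from eq show ?thesis
    proof (cases rule: blocks_Cons)
      case (three d')
      then have "odd (card J)" "card J < 3" using J False by simp_all
      then have "card J = 1" by presburger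
      then obtain i where i: "J = {i}" by (rule card_1_singletonE)
      \<comment> \<open>The degree \<open>3 + 2 * wt \<omega>\<close> is \<open>2 * D + 1\<close>
        with \<open>D = wt \<omega> + 1\<close>.\<close>
      have "wt \<omega> + 1 + 1 \<noteq> 2 ^ k" for k
        using two_powers_ne_power[of s t "wt \<omega>" d'] wt_blocks[of d' s t] pos three by simp
      then show ?thesis unfolding i using L three
        by (intro Ann_var_mult_square[where D = "wt \<omega> + 1"]) (auto simp: numeral_3_eq_3)
    next
      case (two s')
      then have "even (card J)" "card J < 2" using J False by simp_all
      then have "card J = 0" by presburger
      then show ?thesis using Ann_square[OF L] two by (simp add: X_empty)
    next
      case (one t')
      then show ?thesis using J False by auto
    qed
  qed
qed

lemma good_Ann_down:
  assumes "good (a # \<omega>)" "Ann (wt (a # \<omega>)) L" "card I = a"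
  shows "Ann (wt \<omega>) (\<lambda>g. L (X I * g\<^sup>2))"
  using assms by (intro Ann_down) (auto intro: good_low)

subsection \<open>Exchange relations\<close>

text \<open>\<open>X I\<close> has one variable too many, so \<open>L\<close> kills
  \<open>X I * g^2\<close> by parity. In the expansion of its total square the term for
  \<open>A = {}\<close> dies for the same reason, and two or more elements in \<open>A\<close> leave
  too small a first letter; the singletons remain.\<close>

lemma var_exchange:
  assumes g: "good (a # \<omega>)" and L: "Ann (wt (a # \<omega>)) L" and I: "card I = Suc a"
  shows "(\<Sum>i\<in>I. L (X (I - {i}) * (X {i} * g)\<^sup>2)) = 0"
proof (rule additive_pol_eq_0I)
  note add = AnnD(1)[OF L]
  show "additive (\<lambda>g. \<Sum>i\<in>I. L (X (I - {i}) * (X {i} * g)\<^sup>2))"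
    by (rule additive.intro)
      (simp only: additive.add[OF additive_X_square[OF add]] sum.distrib)
  fix f
  have finI: "finite I" by simp
  have one: "X {i} * mon f' = mon (\<lambda>j. (if j = i then 1 else 0) + f' j)" for i :: 'a and f'
    using var_power_mult_mon[of i 1 f'] by simp
  have val: "L (X (I - {i}) * (X {i} * mon f')\<^sup>2) = 0" if "i \<in> I" "deg f' + 1 \<noteq> wt \<omega>" for i f'
    unfolding one X_mult_square_mon
    by (rule AnnD(3)[OF L], unfold deg_X_mult_square deg_var_power_mult) (use that I in simp)
  show "(\<Sum>i\<in>I. L (X (I - {i}) * (X {i} * mon f)\<^sup>2)) = 0"
  proof (cases "deg f + 1 = wt \<omega>")
    case False
    then show ?thesis using val by simp
  next
    case True
    have par: "L (X I * h\<^sup>2) = 0" for h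
      by (rule Ann_parity[OF L]) (simp add: I)
    let ?t = "\<lambda>A. L (X (I - A) * (X A * St (mon f))\<^sup>2)"
    have "0 = (\<Sum>A\<in>Pow I. ?t A)"
      using par[of "mon f"] AnnD(2)[OF L, of "X I * (mon f)\<^sup>2"]
      by (simp add: St_X_mult_square additive.sum[OF add])
    also have "\<dots> = (\<Sum>A\<in>(\<lambda>i. {i}) ` I. ?t A)"
    proof (rule sum.mono_neutral_right)
      show "\<forall>A\<in>Pow I - (\<lambda>i. {i}) ` I. ?t A = 0"
      proof
        fix A assume A: "A \<in> Pow I - (\<lambda>i. {i}) ` I"
        show "?t A = 0"
        proof (cases "A = {}")
          case True
          then show ?thesis using par by (simp add: X_empty)
        next
          case False
          have "card A \<noteq> 1" using A by (auto simp: card_1_singleton_iff)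
          moreover have "card A \<noteq> 0" using False by simp
          moreover have "card A \<le> Suc a" using A I by (metis DiffD1 PowD card_mono finI)
          moreover have "card (I - A) = Suc a - card A" using A I by (simp add: card_Diff_subset)
          ultimately have "card (I - A) < a" by linarith
          then show ?thesis by (rule good_low[OF g L])
        qed
      qed
    qed auto
    also have "\<dots> = (\<Sum>i\<in>I. ?t {i})"
      by (subst sum.reindex) (auto simp: inj_on_def)
    also have "\<dots> = (\<Sum>i\<in>I. L (X (I - {i}) * (X {i} * mon f)\<^sup>2))"
    proof (rule sum.cong[OF refl])
      fix i assume i: "i \<in> I"
      show "?t {i} = L (X (I - {i}) * (X {i} * mon f)\<^sup>2)"
        by (rule additive_St_mon_lowest[OF additive_X_square[OF add]])
          (use True val[OF i] in auto)
    qed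
    finally show ?thesis by simp
  qed
qed

lemma var_mult_X_square:
  "X {i} * (X J * h\<^sup>2) = (if i \<in> J then X (J - {i}) * (X {i} * h)\<^sup>2 else X (insert i J) * h\<^sup>2)"
proof -
  have "X {i} * (X J * h\<^sup>2) = (X {i} * X J) * h\<^sup>2" by (simp add: mult.assoc)
  then show ?thesis unfolding var_mult_X by (simp add: power_mult_distrib mult.assoc)
qed

text \<open>Multiplying the second letter by \<open>x_i\<close> enlarges it when \<open>i\<close> is
  outside \<open>J\<close>. When \<open>i\<close> is in \<open>J\<close>, the letter shrinks and
  passes \<open>x_i\<close> on, which \<open>low\<close> excludes.\<close>

lemma exchange:
  assumes "good (a # \<omega>)" "Ann (wt (a # \<omega>)) L" "card I = Suc a"
    and low: "\<And>T K h. card T = a \<Longrightarrow> Suc (card K) = card J \<Longrightarrow> L (X T * (X K * h\<^sup>2)\<^sup>2) = 0"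
  shows "(\<Sum>i\<in>I - J. L (X (I - {i}) * (X (insert i J) * h\<^sup>2)\<^sup>2)) = 0"
proof -
  have "0 = (\<Sum>i\<in>I. L (X (I - {i}) * (X {i} * (X J * h\<^sup>2))\<^sup>2))"
    using var_exchange[OF assms(1-3)] by simp
  also have "\<dots> = (\<Sum>i\<in>I - J. L (X (I - {i}) * (X {i} * (X J * h\<^sup>2))\<^sup>2))"
  proof (rule sum.mono_neutral_right)
    show "\<forall>i\<in>I - (I - J). L (X (I - {i}) * (X {i} * (X J * h\<^sup>2))\<^sup>2) = 0"
    proof
      fix i assume i: "i \<in> I - (I - J)"
      then have "card (I - {i}) = a" using assms(3) by simp
      moreover have "Suc (card (J - {i})) = card J" using i by (intro card_Suc_Diff1) auto
      ultimately show "L (X (I - {i}) * (X {i} * (X J * h\<^sup>2))\<^sup>2) = 0"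
        using i by (auto simp: var_mult_X_square intro: low)
    qed
  qed auto
  also have "\<dots> = (\<Sum>i\<in>I - J. L (X (I - {i}) * (X (insert i J) * h\<^sup>2)\<^sup>2))"
    by (intro sum.cong refl) (auto simp: var_mult_X_square)
  finally show ?thesis by simp
qed

subsection \<open>Words\<close>

fun wm :: "'i set list \<Rightarrow> 'i pol \<Rightarrow> 'i pol" where
  "wm [] g = g"
| "wm (I # ws) g = X I * (wm ws g)\<^sup>2"

lemma wm_append: "wm (u @ w) g = wm u (wm w g)"
  by (induction u) auto

lemma additive_wm:
  assumes "additive L"
  shows "additive (\<lambda>g. L (wm ws g))"
  using assms
proof (induction ws arbitrary: L)
  case (Cons I ws)
  then show ?case using Cons.IH[OF additive_down[OF Cons.prems]] by simp
qed simp

lemma Ann_wm: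
  assumes "good (map card ws @ \<omega>)" "Ann (wt (map card ws @ \<omega>)) L"
  shows "Ann (wt \<omega>) (\<lambda>g. L (wm ws g))"
  using assms
proof (induction ws arbitrary: L)
  case (Cons I ws)
  have "Ann (wt (map card ws @ \<omega>)) (\<lambda>g. L (X I * g\<^sup>2))"
    using Cons.prems by (intro good_Ann_down[of "card I"]) auto
  moreover have "good (map card ws @ \<omega>)" using Cons.prems(1) by (auto intro: good_tl)
  ultimately show ?case using Cons.IH by simp
qed simp

lemma good_append: "good (u @ \<omega>) \<Longrightarrow> good \<omega>"
  by (induction u) (auto dest: good_tl)

lemma word_exchange:
  assumes g: "good (a # b # \<omega>)" and L: "Ann (wt (a # b # \<omega>)) L"
    and I: "card I = Suc a" and J: "Suc (card J) = b"
  shows "(\<Sum>i\<in>I - J. L (wm [I - {i}, insert i J] h)) = 0"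
  unfolding wm.simps
proof (rule exchange[OF g L I])
  fix T K :: "'a set" and h assume T: "card T = a" and K: "Suc (card K) = card J"
  show "L (X T * (X K * h\<^sup>2)\<^sup>2) = 0"
    using good_low[OF good_tl[OF g] good_Ann_down[OF g L T], of K] K J by simp
qed

lemma bit_sum_pair_eq_0:
  assumes "x \<noteq> y" "(\<Sum>i\<in>{x, y}. f i :: bit) = 0"
  shows "f x = f y"
proof -
  have "(\<Sum>i\<in>{x, y}. f i) = f x + f y" using assms(1) by (subst sum.insert) auto
  then show ?thesis using assms(2) by (metis bit_add_eq_0_iff)
qed

text \<open>Two terms remain in the exchange relation for \<open>I = K \<union> {x, y}\<close> and
  \<open>J = K\<close>.\<close>

lemma word_swap:
  assumes g: "good (a # a # \<omega>)" and L: "Ann (wt (a # a # \<omega>)) L"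
    and K: "Suc (card K) = a" and xy: "x \<noteq> y" "x \<notin> K" "y \<notin> K"
  shows "L (wm [insert x K, insert y K] h) = L (wm [insert y K, insert x K] h)"
proof -
  have "card (insert x (insert y K)) = Suc a" using K xy by simp
  moreover have "insert x (insert y K) - K = {x, y}" using xy by auto
  ultimately have "(\<Sum>i\<in>{x, y}. L (wm [insert x (insert y K) - {i}, insert i K] h)) = 0"
    using word_exchange[OF g L _ K, of "insert x (insert y K)" h] by metis
  from bit_sum_pair_eq_0[OF xy(1) this]
  have "L (wm [insert x (insert y K) - {x}, insert x K] h)
      = L (wm [insert x (insert y K) - {y}, insert y K] h)" .
  moreover have "insert x (insert y K) - {x} = insert y K" "insert x (insert y K) - {y} = insert x K"
    using xy by auto
  ultimately show ?thesis by metis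
qed

text \<open>The second letter is taken one too large: \<open>x_i * X I\<close> is
  \<open>X (I - {i}) * x_i^2\<close>, so the letter \<open>I - {i}\<close> is repeated and the
  variable travels on to the third letter. There only \<open>i = x\<close> and \<open>i = y\<close>
  survive, since an element of \<open>K\<close> would shrink it.\<close>

lemma word_square:
  assumes g: "good (a # a # a # \<omega>)" and L: "Ann (wt (a # a # a # \<omega>)) L"
    and K: "Suc (card K) = a" and xy: "x \<noteq> y" "x \<notin> K" "y \<notin> K"
  shows "L (wm [insert x K, insert x K, insert y K] h) = L (wm [insert y K, insert y K, insert x K] h)"
proof -
  define I where "I = insert x (insert y K)"
  have I: "card I = Suc a" using K xy by (simp add: I_def)
  have "0 = (\<Sum>i\<in>I. L (X (I - {i}) * (X {i} * (X I * (X K * h\<^sup>2)\<^sup>2))\<^sup>2))"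
    using var_exchange[OF g L I] by simp
  also have "\<dots> = (\<Sum>i\<in>I. L (wm [I - {i}, I - {i}] (X {i} * (X K * h\<^sup>2))))"
    by (rule sum.cong[OF refl]) (simp add: var_mult_X_square)
  also have "\<dots> = (\<Sum>i\<in>{x, y}. L (wm [I - {i}, I - {i}] (X {i} * (X K * h\<^sup>2))))"
  proof (rule sum.mono_neutral_right)
    show "\<forall>i\<in>I - {x, y}. L (wm [I - {i}, I - {i}] (X {i} * (X K * h\<^sup>2))) = 0"
    proof
      fix i assume "i \<in> I - {x, y}"
      then have i: "i \<in> K" "i \<in> I" by (auto simp: I_def)
      then have "Suc (card (K - {i})) = card K" by (intro card_Suc_Diff1) auto
      then have c: "card (K - {i}) < a" using K by simp
      have "Ann (wt (a # \<omega>)) (\<lambda>g. L (wm [I - {i}, I - {i}] g))"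
        using Ann_wm[of "[I - {i}, I - {i}]" "a # \<omega>" L] g L I i by simp
      from good_low[OF good_tl[OF good_tl[OF g]] this c]
      show "L (wm [I - {i}, I - {i}] (X {i} * (X K * h\<^sup>2))) = 0"
        using i by (simp only: var_mult_X_square if_True)
    qed
  qed (auto simp: I_def)
  also have "\<dots> = (\<Sum>i\<in>{x, y}. L (wm [I - {i}, I - {i}, insert i K] h))"
    by (rule sum.cong[OF refl]) (use xy in \<open>auto simp: var_mult_X_square\<close>)
  finally have *: "0 = (\<Sum>i\<in>{x, y}. L (wm [I - {i}, I - {i}, insert i K] h))" .
  have e: "I - {x} = insert y K" "I - {y} = insert x K" using xy by (auto simp: I_def)
  from bit_sum_pair_eq_0[OF xy(1) *[symmetric]]
  have "L (wm [I - {x}, I - {x}, insert x K] h) = L (wm [I - {y}, I - {y}, insert y K] h)" .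
  then show ?thesis unfolding e by (rule sym)
qed

definition clique :: "nat \<Rightarrow> 'i set set \<Rightarrow> bool" where
  "clique a C \<longleftrightarrow> (\<forall>A\<in>C. card A = a) \<and> (\<forall>A\<in>C. \<forall>B\<in>C. A \<noteq> B \<longrightarrow> card (A \<union> B) = Suc a)"

lemma cliqueE:
  assumes "clique a (C :: 'i::finite set set)" "A \<in> C" "B \<in> C" "A \<noteq> B"
  obtains x y K where "A = insert x K" "B = insert y K" "x \<noteq> y" "x \<notin> K" "y \<notin> K" "Suc (card K) = a"
proof -
  have a: "card A = a" "card B = a" "card (A \<union> B) = Suc a"
    using assms by (auto simp: clique_def)
  have "card (A \<union> B) + card (A \<inter> B) = card A + card B"
    using card_Un_Int[of A B] by simp
  with a have K: "Suc (card (A \<inter> B)) = a" by simp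
  have "card (A - B) = 1" "card (B - A) = 1"
    using K a by (simp_all add: card_Diff_subset_Int Int_commute)
  then obtain x y where "A - B = {x}" "B - A = {y}" by (auto simp: card_1_singleton_iff)
  then show ?thesis using K by (intro that[of x "A \<inter> B" y]) auto
qed

lemma clique_swap:
  assumes "clique a C" "A \<in> C" "B \<in> C" and "good (a # a # \<omega>)" "Ann (wt (a # a # \<omega>)) L"
  shows "L (wm (A # B # ws) h) = L (wm (B # A # ws) h)"
proof (cases "A = B")
  case False
  obtain x y K where "A = insert x K" "B = insert y K" "x \<noteq> y" "x \<notin> K" "y \<notin> K" "Suc (card K) = a"
    using cliqueE[OF assms(1-3) False] by metis
  then show ?thesis using word_swap[OF assms(4,5), of K x y "wm ws h"] by simp
qed simp

lemma clique_square:
  assumes "clique a C" "A \<in> C" "B \<in> C" and "good (a # a # a # \<omega>)" "Ann (wt (a # a # a # \<omega>)) L"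
  shows "L (wm (A # A # B # ws) h) = L (wm (B # B # A # ws) h)"
proof (cases "A = B")
  case False
  obtain x y K where "A = insert x K" "B = insert y K" "x \<noteq> y" "x \<notin> K" "y \<notin> K" "Suc (card K) = a"
    using cliqueE[OF assms(1-3) False] by metis
  then show ?thesis using word_square[OF assms(4,5), of K x y "wm ws h"] by simp
qed simp

text \<open>Sorting by adjacent transpositions: the induction hypothesis brings the first letter of
  \<open>w\<close> to the second place of \<open>u\<close>, and a swap brings it to the
  front.\<close>

lemma clique_mset:
  assumes C: "clique a C" and "set u \<subseteq> C" "mset u = mset w"
    and "good (replicate (length u) a @ \<omega>)" "Ann (wt (replicate (length u) a @ \<omega>)) L"
  shows "L (wm u h) = L (wm w h)"
  using assms(2-)
proof (induction "length u" arbitrary: u w L)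
  case 0
  then show ?case by simp
next
  case (Suc n)
  from Suc.hyps(2) obtain x u' where u: "u = x # u'" and n: "length u' = n" by (cases u) auto
  from Suc.prems(2) obtain y w' where w: "w = y # w'" unfolding u by (cases w) auto
  have lw: "length w' = n" using Suc.prems(2) n unfolding u w by (metis length_Cons mset_eq_length nat.inject)
  have xC: "x \<in> C" "y \<in> C" "set w \<subseteq> C"
    using Suc.prems(1) mset_eq_setD[OF Suc.prems(2)] unfolding u w by auto
  have good: "good (a # replicate n a @ \<omega>)" and L: "Ann (wt (a # replicate n a @ \<omega>)) L"
    using Suc.prems(3,4) n unfolding u by auto
  have down: "good (replicate n a @ \<omega>)" "Ann (wt (replicate n a @ \<omega>)) (\<lambda>g. L (X A * g\<^sup>2))"
    if "A \<in> C" for A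
    using good_tl[OF good] good_Ann_down[OF good L, of A] C that by (auto simp: clique_def)
  show ?case
  proof (cases "x = y")
    case True
    then have "mset u' = mset w'" using Suc.prems(2) unfolding u w by simp
    then show ?thesis
      using Suc.hyps(1)[OF n[symmetric], of w' "\<lambda>g. L (X x * g\<^sup>2)"] down[OF xC(1)] Suc.prems(1) True n
      unfolding u w by auto
  next
    case False
    then have "y \<in># mset u'" using Suc.prems(2) unfolding u w
      by (metis insert_noteq_member mset.simps(2) union_single_eq_member add_mset_remove_trivial_eq insert_DiffM)
    then obtain M where M: "mset u' = add_mset y M" by (metis multi_member_split)
    obtain v where v: "mset v = M" using ex_mset by blast
    have msu: "mset u' = mset (y # v)" and msw: "mset (x # v) = mset w'"
      using M v Suc.prems(2) unfolding u w by auto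
    have lv: "length (x # v) = n" using msw lw by (metis mset_eq_length)
    have vC: "set (x # v) \<subseteq> C" using msw xC(3) unfolding w by (metis mset_eq_setD set_subset_Cons subset_trans)
    have "L (wm u h) = L (wm (x # y # v) h)"
      using Suc.hyps(1)[OF n[symmetric] _ msu, of "\<lambda>g. L (X x * g\<^sup>2)"] down[OF xC(1)] Suc.prems(1) n
      unfolding u by auto
    also have "\<dots> = L (wm (y # x # v) h)"
    proof (rule clique_swap[OF C xC(1,2)])
      obtain m where "n = Suc m" using lv by auto
      then show "good (a # a # replicate (n - 1) a @ \<omega>)" "Ann (wt (a # a # replicate (n - 1) a @ \<omega>)) L"
        using good L by auto
    qed
    also have "\<dots> = L (wm w h)"
      using Suc.hyps(1)[OF lv[symmetric] vC msw, of "\<lambda>g. L (X y * g\<^sup>2)"] down[OF xC(2)] lv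
      unfolding w by auto
    finally show ?thesis .
  qed
qed

lemma mset_eq_if_repeats_one:
  assumes "set u = set w" "length u = length w" "c \<in> set u"
    and "\<And>x. x \<noteq> c \<Longrightarrow> count (mset u) x \<le> 1" "\<And>x. x \<noteq> c \<Longrightarrow> count (mset w) x \<le> 1"
  shows "mset u = mset w"
proof -
  have *: "mset v = replicate_mset (length v - card (set v - {c})) c + mset_set (set v - {c})"
    if "\<And>x. x \<noteq> c \<Longrightarrow> count (mset v) x \<le> 1" for v
  proof -
    have ne: "filter_mset (\<lambda>x. x \<noteq> c) (mset v) = mset_set (set v - {c})"
    proof (rule multiset_eqI)
      fix x
      show "count (filter_mset (\<lambda>x. x \<noteq> c) (mset v)) x = count (mset_set (set v - {c})) x"
        using that[of x] by (cases "x \<in> set v") (auto simp: count_mset_0_iff le_Suc_eq)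
    qed
    have eq: "filter_mset (\<lambda>x. x = c) (mset v) = replicate_mset (count (mset v) c) c"
      by (simp add: filter_eq_replicate_mset)
    have "mset v = filter_mset (\<lambda>x. x = c) (mset v) + filter_mset (\<lambda>x. x \<noteq> c) (mset v)"
      by (rule multiset_partition)
    then have sp: "mset v = replicate_mset (count (mset v) c) c + mset_set (set v - {c})"
      unfolding ne eq .
    then have "length v = count (mset v) c + card (set v - {c})"
      by (metis size_mset size_union size_replicate_mset size_mset_set)
    then show ?thesis using sp by simp
  qed
  show ?thesis using *[of u] *[of w] assms by metis
qed

text \<open>The move from \<open>x x c\<close> to \<open>c c x\<close> converts a surplus copy of
  \<open>x\<close> into one of a fixed letter \<open>c\<close>. Once only \<open>c\<close> repeats,
  set and length determine the multiset.\<close>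

lemma clique_set:
  assumes C: "clique a C" and u: "set u \<subseteq> C" and eq: "set u = set w" "length u = length w"
    and good: "good (replicate (length u) a @ \<omega>)" and L: "Ann (wt (replicate (length u) a @ \<omega>)) L"
  shows "L (wm u h) = L (wm w h)"
proof (cases u)
  case Nil
  then show ?thesis using eq by simp
next
  case (Cons c u')
  have red: "\<exists>u'. set u' = set u \<and> length u' = length u \<and> L (wm u' h) = L (wm v h) \<and>
      (\<forall>x. x \<noteq> c \<longrightarrow> count (mset u') x \<le> 1)"
    if "set v = set u" "length v = length u" for v
    using that
  proof (induction "length (filter (\<lambda>x. x \<noteq> c) v)" arbitrary: v rule: less_induct)
    case less
    show ?case
    proof (cases "\<forall>x. x \<noteq> c \<longrightarrow> count (mset v) x \<le> 1")
      case True
      with less.prems show ?thesis by blast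
    next
      case False
      then obtain x where x: "x \<noteq> c" "count (mset v) x \<ge> 2" by force
      have cv: "c \<in># mset v" using less.prems Cons by auto
      have "{#x, x, c#} \<subseteq># mset v"
      proof (rule mset_subset_eqI)
        fix z show "count {#x, x, c#} z \<le> count (mset v) z"
          using x cv by (auto simp: Suc_le_eq)
      qed
      then obtain M where M: "mset v = {#x, x, c#} + M" by (metis subset_mset.add_diff_inverse)
      obtain v' where v': "mset v' = M" using ex_mset by blast
      let ?v1 = "x # x # c # v'" and ?v2 = "c # c # x # v'"
      have m1: "mset v = mset ?v1" using M v' by simp
      have l: "length v = Suc (Suc (Suc (length v')))" using m1 by (metis length_Cons size_mset)
      have s: "set v = set ?v1" using m1 by (rule mset_eq_setD)
      have xc: "x \<in> C" "c \<in> C" using s less.prems(1) u by auto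
      have e1: "L (wm v h) = L (wm ?v1 h)"
        using less.prems u good L by (intro clique_mset[OF C _ m1]) auto
      have "replicate (length u) a = a # a # a # replicate (length v') a"
        using l less.prems(2) by simp
      then have e2: "L (wm ?v1 h) = L (wm ?v2 h)"
        using good L by (intro clique_square[OF C xc]) auto
      have "length (filter (\<lambda>y. y \<noteq> c) v) = length (filter (\<lambda>y. y \<noteq> c) ?v1)"
        using m1 by (metis mset_filter size_mset)
      then have "length (filter (\<lambda>y. y \<noteq> c) ?v2) < length (filter (\<lambda>y. y \<noteq> c) v)"
        using x by simp
      moreover have "set ?v2 = set u" "length ?v2 = length u" using s l less.prems by auto
      ultimately show ?thesis using less.hyps[of ?v2] e1 e2 by metis
    qed
  qed
  obtain u1 where u1: "set u1 = set u" "length u1 = length u" "L (wm u1 h) = L (wm u h)"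
      "\<forall>x. x \<noteq> c \<longrightarrow> count (mset u1) x \<le> 1"
    using red[of u] by blast
  obtain w1 where w1: "set w1 = set u" "length w1 = length u" "L (wm w1 h) = L (wm w h)"
      "\<forall>x. x \<noteq> c \<longrightarrow> count (mset w1) x \<le> 1"
    using red[of w] eq by metis
  have "mset u1 = mset w1"
    using u1 w1 Cons by (intro mset_eq_if_repeats_one[of _ _ c]) auto
  then have "L (wm u1 h) = L (wm w1 h)"
    using u1 u good L by (intro clique_mset[OF C]) auto
  then show ?thesis using u1 w1 by simp
qed

text \<open>A standard spelling of \<open>S\<close> in \<open>n\<close> places; for letters from a
  clique the choice is immaterial by \<open>clique_set\<close>.\<close>

definition wd :: "nat \<Rightarrow> 'a set \<Rightarrow> 'a list" where
  "wd n S = (SOME xs. set xs = S \<and> length xs = n)"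

lemma wd:
  assumes "finite S" "S \<noteq> {}" "card S \<le> n"
  shows "set (wd n S) = S" "length (wd n S) = n"
proof -
  obtain ys where ys: "set ys = S" "distinct ys" using finite_distinct_list[OF assms(1)] by blast
  then have "ys \<noteq> []" "length ys = card S" using assms(2) by (auto simp: distinct_card)
  then have "set (replicate (n - card S) (hd ys) @ ys) = S"
      "length (replicate (n - card S) (hd ys) @ ys) = n"
    using ys assms(3) by (auto simp: set_replicate_conv_if)
  then have "\<exists>xs. set xs = S \<and> length xs = n" by blast
  from someI_ex[OF this] show "set (wd n S) = S" "length (wd n S) = n" by (auto simp: wd_def)
qed

subsection \<open>Consequences of the exchange relations on five letters\<close>

text \<open>In the lemmas below, \<open>vanish_3_2_4\<close> and the like list the cardinalities of consecutive letters.\<close>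
definition exch :: "nat \<Rightarrow> nat \<Rightarrow> ('i set \<Rightarrow> 'i set \<Rightarrow> bit) \<Rightarrow> bool" where
  "exch a b \<Psi> \<longleftrightarrow> (\<forall>I J. card I = Suc a \<longrightarrow> Suc (card J) = b \<longrightarrow>
     (\<Sum>i\<in>I - J. \<Psi> (I - {i}) (insert i J)) = 0)"

text \<open>\<open>I - J\<close> is a single point here, so the relation has one term; it has two in
  \<open>exch_2\<close> and three in \<open>exch_3\<close>.\<close>

lemma exch_1:
  assumes e: "exch a b (\<Psi> :: 'i::finite set \<Rightarrow> _)" and "card B = a" "Suc (card J) = b" "B \<subseteq> J" "x \<notin> J"
  shows "\<Psi> B (insert x J) = 0"
proof -
  have *: "insert x B - J = {x}" "insert x B - {x} = B" using assms by auto
  have "card (insert x B) = Suc a" using assms by (subst card_insert_disjoint) auto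
  then have "(\<Sum>i\<in>insert x B - J. \<Psi> (insert x B - {i}) (insert i J)) = 0"
    using e assms(3) unfolding exch_def by blast
  then show ?thesis unfolding *(1) by (simp add: *(2))
qed

lemma exch_2:
  assumes e: "exch a b (\<Psi> :: 'i::finite set \<Rightarrow> _)" and "Suc (card B) = a" "Suc (card J) = b" "B \<subseteq> J"
    and "x \<noteq> y" "x \<notin> J" "y \<notin> J"
  shows "\<Psi> (insert y B) (insert x J) = \<Psi> (insert x B) (insert y J)"
proof -
  let ?I = "insert x (insert y B)"
  have *: "?I - J = {x, y}" "?I - {x} = insert y B" "?I - {y} = insert x B" using assms by auto
  have "x \<notin> B" "y \<notin> B" using assms by auto
  then have "card ?I = Suc a" using assms by simp
  then have "(\<Sum>i\<in>?I - J. \<Psi> (?I - {i}) (insert i J)) = 0"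
    using e assms(3) unfolding exch_def by blast
  then have "(\<Sum>i\<in>{x, y}. \<Psi> (?I - {i}) (insert i J)) = 0" unfolding *(1) .
  from bit_sum_pair_eq_0[OF \<open>x \<noteq> y\<close> this] show ?thesis unfolding *(2,3) .
qed

lemma exch_3:
  assumes e: "exch a b (\<Psi> :: 'i::finite set \<Rightarrow> _)" and "Suc (Suc (card B)) = a" "Suc (card J) = b" "B \<subseteq> J"
    and "x \<noteq> y" "y \<noteq> z" "x \<noteq> z" "x \<notin> J" "y \<notin> J" "z \<notin> J"
  shows "\<Psi> (insert y (insert z B)) (insert x J) + \<Psi> (insert x (insert z B)) (insert y J)
    + \<Psi> (insert x (insert y B)) (insert z J) = 0"
proof -
  let ?I = "insert x (insert y (insert z B))"
  have *: "?I - J = {x, y, z}" "?I - {x} = insert y (insert z B)" "?I - {y} = insert x (insert z B)"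
    "?I - {z} = insert x (insert y B)" using assms by auto
  have "x \<notin> B" "y \<notin> B" "z \<notin> B" using assms by auto
  then have "card ?I = Suc a" using assms by simp
  then have "(\<Sum>i\<in>?I - J. \<Psi> (?I - {i}) (insert i J)) = 0"
    using e assms(3) unfolding exch_def by blast
  then have 0: "(\<Sum>i\<in>{x, y, z}. \<Psi> (?I - {i}) (insert i J)) = 0" unfolding *(1) .
  have "(\<Sum>i\<in>{x, y, z}. f i) = f x + f y + f z" for f :: "'i \<Rightarrow> bit"
    using assms(5-7) by (simp only: sum.insert finite.intros insert_iff empty_iff sum.empty simp_thms add.assoc add_0_right)
  from trans[OF this[symmetric] 0] show ?thesis unfolding *(2-4) .
qed

lemma bit_three_zero: "(p::bit) + q + r = 0 \<Longrightarrow> q = 0 \<Longrightarrow> r = 0 \<Longrightarrow> p = 0"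
  by simp

lemma bit_three_eq: "(p::bit) + q + r = 0 \<Longrightarrow> q = 0 \<Longrightarrow> p = r"
  by (cases p; cases r) auto

lemma univ_5:
  assumes "distinct [a, b, c, d, e]" "card (UNIV :: 'i::finite set) = 5"
  shows "(UNIV :: 'i::finite set) = {a, b, c, d, e}"
proof -
  have "card {a, b, c, d, e} = 5" using assms(1) by simp
  then show ?thesis using assms(2) by (metis card_subset_eq finite subset_UNIV)
qed

lemma ex_notin:
  assumes "card (UNIV :: 'i::finite set) = 5" "length xs < 5"
  shows "\<exists>x :: 'i. x \<notin> set xs"
proof (rule ccontr)
  assume "\<nexists>x. x \<notin> set xs"
  then have "set xs = UNIV" by auto
  then show False using assms card_length[of xs] by simp
qed

lemma pair_cases:
  assumes U: "distinct [a, b, c, d, e]" "card (UNIV :: 'i::finite set) = 5" and S: "card (S :: 'i::finite set) = 2"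
  shows "S = {a, b} \<or> S = {a, c} \<or> S = {a, d} \<or> S = {a, e} \<or> S = {b, c} \<or> S = {b, d} \<or> S = {b, e}
    \<or> S = {c, d} \<or> S = {c, e} \<or> S = {d, e}"
proof -
  have "S = {a, b, c, d, e} \<inter> S" using univ_5[OF U] by auto
  then show ?thesis
    using S U(1)
    by (cases "a \<in> S"; cases "b \<in> S"; cases "c \<in> S"; cases "d \<in> S"; cases "e \<in> S") auto
qed

lemma triple_cases:
  assumes U: "distinct [a, b, c, d, e]" "card (UNIV :: 'i::finite set) = 5" and S: "card (S :: 'i::finite set) = 3"
  shows "S = {a, b, c} \<or> S = {a, b, d} \<or> S = {a, b, e} \<or> S = {a, c, d} \<or> S = {a, c, e} \<or> S = {a, d, e}
    \<or> S = {b, c, d} \<or> S = {b, c, e} \<or> S = {b, d, e} \<or> S = {c, d, e}"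
proof -
  have "S = {a, b, c, d, e} \<inter> S" using univ_5[OF U] by auto
  then show ?thesis
    using S U(1)
    by (cases "a \<in> S"; cases "b \<in> S"; cases "c \<in> S"; cases "d \<in> S"; cases "e \<in> S") auto
qed

lemma quad_eq:
  assumes U: "distinct [a, b, c, d, e]" "card (UNIV :: 'i::finite set) = 5" and S: "card (S :: 'i::finite set) = 4" "e \<notin> S"
  shows "S = {a, b, c, d}"
proof -
  have "S \<subseteq> {a, b, c, d}" using univ_5[OF U] S(2) by auto
  moreover have "card {a, b, c, d} = 4" using U(1) by simp
  ultimately show ?thesis using S(1) by (metis card_subset_eq finite)
qed

lemma quad_missing:
  assumes "card (UNIV :: 'i::finite set) = 5" "card (S :: 'i::finite set) = 4"
  obtains k where "k \<notin> S"
  using assms by (metis UNIV_I numeral_eq_iff semiring_norm(88) subsetI top.extremum_uniqueI)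

lemma name_rest_2:
  assumes "card (UNIV :: 'i::finite set) = 5" "(a::'i::finite) \<noteq> b"
  obtains c d e where "distinct [a, b, c, d, e]"
proof -
  obtain c where c: "c \<notin> {a, b}" using ex_notin[OF assms(1), of "[a, b]"] by auto
  obtain d where d: "d \<notin> {a, b, c}" using ex_notin[OF assms(1), of "[a, b, c]"] by auto
  obtain e where "e \<notin> {a, b, c, d}" using ex_notin[OF assms(1), of "[a, b, c, d]"] by auto
  then show ?thesis using c d assms(2) by (intro that[of c d e]) auto
qed

text \<open>The relation between \<open>B\<close> and \<open>K\<close> kills
  \<open>B \<subseteq> K\<close>; otherwise the point missing from \<open>K\<close> lies in
  \<open>B\<close> and can be traded for a point outside \<open>B\<close>. The relation between
  \<open>A\<close> and \<open>B\<close> then disposes of the ten positions of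
  \<open>A\<close>.\<close>

lemma vanish_3_3_4:
  assumes five: "card (UNIV :: 'i::finite set) = 5"
    and e1: "\<And>K. exch 3 3 (\<lambda>A B. \<Phi> A B (K :: 'i::finite set))" and e2: "\<And>A. exch 3 4 (\<Phi> A)"
    and card: "card A = 3" "card B = 3" "card K = 4"
  shows "\<Phi> A B K = 0"
proof -
  have f0: "\<Phi> A {a, b, c} {a, b, c, d} = 0" if "distinct [a, b, c, d]" for A a b c d
    using exch_1[OF e2[of A], of "{a, b, c}" "{a, b, c}" d] that by (auto simp: insert_commute)
  have f1: "\<Phi> A {a, b, c} {a, b, d, e} = \<Phi> A {a, b, d} {a, b, c, e}" if "distinct [a, b, c, d, e]" for A a b c d e
    using exch_2[OF e2[of A], of "{a, b}" "{a, b, e}" d c] that by (auto simp: insert_commute)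
  have sw: "\<Phi> {a, b, c} {a, b, d} K = \<Phi> {a, b, d} {a, b, c} K" if "distinct [a, b, c, d]" for K a b c d
    using exch_2[OF e1[of K], of "{a, b}" "{a, b}" d c] that by (auto simp: insert_commute)
  have th: "\<Phi> {p, y, z} {p, q, x} K + \<Phi> {p, x, z} {p, q, y} K + \<Phi> {p, x, y} {p, q, z} K = 0"
    if "distinct [p, q, x, y, z]" for K p q x y z
    using exch_3[OF e1[of K], of "{p}" "{p, q}" x y z] that by (simp only: insert_commute) auto
  have z1: "\<Phi> {a, b, c} {a, b, d} {a, b, c, e} = 0" if "distinct [a, b, c, d, e]" for a b c d e
    using sw[of a b c d "{a, b, c, e}"] f0[of a b c e "{a, b, d}"] that by auto
  have z2: "\<Phi> {a, c, d} {a, b, e} {a, b, c, d} = 0" if "distinct [a, b, c, d, e]" for a b c d e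
  proof (rule bit_three_zero)
    show "\<Phi> {a, c, d} {a, b, e} {a, b, c, d} + \<Phi> {a, e, d} {a, b, c} {a, b, c, d}
        + \<Phi> {a, e, c} {a, b, d} {a, b, c, d} = 0"
      using th[of a b e c d "{a, b, c, d}"] that by auto
    show "\<Phi> {a, e, d} {a, b, c} {a, b, c, d} = 0" using f0[of a b c d] that by auto
    show "\<Phi> {a, e, c} {a, b, d} {a, b, c, d} = 0"
      using f0[of a b d c] that by (auto simp: insert_commute)
  qed
  \<comment> \<open>For fixed \<open>a\<close>, \<open>G\<close> is symmetric in its last three
    arguments and hence a function of the first alone. The three relations used sum it over the
    triples containing \<open>b\<close>; added up they leave just the value at \<open>b\<close>,
    which is therefore 0.\<close>
  have z3: "\<Phi> {c, d, e} {a, b, e} {a, b, c, d} = 0" if D: "distinct [a, b, c, d, e]" for a b c d e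
  proof -
    define G where "G = (\<lambda>b c d e. \<Phi> {c, d, e} {a, b, e} {a, b, c, d})"
    have s1: "G b c d e = G b d c e" for b c d e by (simp add: G_def insert_commute)
    have s2: "G b c d e = G b e d c" if "distinct [a, b, c, d, e]" for b c d e
      using f1[of a b e c d "{c, d, e}"] that by (auto simp: G_def insert_commute)
    have r: "G b c d e + G c b d e + G d b c e = 0" if "distinct [a, b, c, d, e]" for b c d e
    proof -
      have "\<Phi> {e, c, d} {e, a, b} {a, b, c, d} + \<Phi> {e, b, d} {e, a, c} {a, b, c, d}
        + \<Phi> {e, b, c} {e, a, d} {a, b, c, d} = 0"
        using th[of e a b c d "{a, b, c, d}"] that by auto
      moreover have "{e, c, d} = {c, d, e}" "{e, b, d} = {b, d, e}" "{e, b, c} = {b, c, e}"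
        "{e, a, b} = {a, b, e}" "{e, a, c} = {a, c, e}" "{e, a, d} = {a, d, e}"
        "{a, b, c, d} = {a, c, b, d}" "{a, b, c, d} = {a, d, b, c}" by auto
      ultimately show ?thesis unfolding G_def by metis
    qed
    have e1: "G b c d e + G c b d e + G d b c e = 0" using r D by auto
    have e2: "G b d e c + G d b e c + G e b d c = 0" using r[of b d e c] D by auto
    have e3: "G b e c d + G e b c d + G c b e d = 0" using r[of b e c d] D by auto
    have "G b d e c = G b c d e" using s1[of b d e c] s2[of b e d c] D by auto
    moreover have "G b e c d = G b c d e" using s2[of b e c d] s1[of b d c e] D by auto
    moreover have "G d b e c = G d b c e" using s1[of d b e c] s2[of d e b c] s1[of d c b e] D by auto
    moreover have "G c b e d = G c b d e" using s1[of c b e d] s2[of c e b d] s1[of c d b e] D by auto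
    moreover have "G e b d c = G e b c d" using s1[of e b d c] s2[of e d b c] s1[of e c b d] D by auto
    ultimately have "G b c d e = 0" using e1 e2 e3
      by (cases "G b c d e"; cases "G c b d e"; cases "G d b c e"; cases "G e b c d") auto
    then show ?thesis by (simp add: G_def)
  qed
  obtain k where k: "k \<notin> K" using quad_missing[OF five card(3)] by blast
  show ?thesis
  proof (cases "k \<in> B")
    case False
    obtain x y z where B: "B = {x, y, z}" "distinct [x, y, z]"
      using card(2) by (auto simp: card_3_iff)
    obtain w where w: "w \<notin> {x, y, z, k}" using ex_notin[OF five, of "[x, y, z, k]"] by auto
    then have "K = {x, y, z, w}" using B False k card(3) by (intro quad_eq[OF _ five, of x y z w k]) auto
    then show ?thesis using f0[of x y z w A] B w by auto
  next
    case True
    then have "card (B - {k}) = 2" using card(2) by simp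
    then obtain a b where ab: "B - {k} = {a, b}" "a \<noteq> b" by (auto simp: card_2_iff)
    then have B: "B = {a, b, k}" and kab: "k \<noteq> a" "k \<noteq> b" using True by auto
    obtain c where c: "c \<notin> {a, b, k}" using ex_notin[OF five, of "[a, b, k]"] by auto
    obtain d where d: "d \<notin> {a, b, k, c}" using ex_notin[OF five, of "[a, b, k, c]"] by auto
    have D: "distinct [a, b, c, d, k]" using ab kab c d by auto
    have K: "K = {a, b, c, d}" by (rule quad_eq[OF D five card(3) k])
    \<comment> \<open>Moving the missing point from \<open>k\<close> to \<open>c\<close> or
      \<open>d\<close> reduces positions of \<open>A\<close> that contain \<open>k\<close> to
      configurations already treated.\<close>
    have mv1: "\<Phi> A {a, b, k} {a, b, c, d} = \<Phi> A {a, b, c} {a, b, d, k}"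
      using f1[of a b k c d A] D by (auto simp: insert_commute)
    have mv2: "\<Phi> A {a, b, k} {a, b, c, d} = \<Phi> A {a, b, d} {a, b, c, k}"
      using f1[of a b k d c A] D by (auto simp: insert_commute)
    from triple_cases[OF D five card(1)] show ?thesis
    proof (elim disjE)
      assume "A = {a, b, c}" then show ?thesis using z1[of a b c k d] D B K by (auto simp: insert_commute)
    next
      assume "A = {a, b, d}" then show ?thesis using z1[of a b d k c] D B K by (auto simp: insert_commute)
    next
      assume "A = {a, b, k}" then show ?thesis using z1[of a b k c d] mv1 D B K by (auto simp: insert_commute)
    next
      assume "A = {a, c, d}" then show ?thesis using z2[of a b c d k] D B K by (auto simp: insert_commute)
    next
      assume "A = {a, c, k}" then show ?thesis using z2[of a b c k d] mv2 D B K by (auto simp: insert_commute)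
    next
      assume "A = {a, d, k}" then show ?thesis using z2[of a b d k c] mv1 D B K by (auto simp: insert_commute)
    next
      assume "A = {b, c, d}" then show ?thesis using z2[of b a c d k] D B K by (auto simp: insert_commute)
    next
      assume "A = {b, c, k}" then show ?thesis using z2[of b a c k d] mv2 D B K by (auto simp: insert_commute)
    next
      assume "A = {b, d, k}" then show ?thesis using z2[of b a d k c] mv1 D B K by (auto simp: insert_commute)
    next
      assume "A = {c, d, k}" then show ?thesis using z3[of a b c d k] D B K by (auto simp: insert_commute)
    qed
  qed
qed

lemma card_compl_finite: "card (- (A :: 'i::finite set)) = card (UNIV :: 'i set) - card A"
  by (simp add: Compl_eq_Diff_UNIV card_Diff_subset)

lemma compl_eq_singleton:
  assumes "card (UNIV :: 'i::finite set) = 5" "card (K :: 'i::finite set) = 4"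
  obtains k where "K = - {k}"
proof -
  have "card (- K) = 1" using assms by (simp add: card_compl_finite)
  then obtain k where "- K = {k}" by (rule card_1_singletonE)
  then have "K = - {k}" by auto
  then show ?thesis by (rule that)
qed

section \<open>A letter of size four after a letter of size two\<close>

lemma vanish_2_4:
  assumes five: "card (UNIV :: 'i::finite set) = 5" and e: "exch 2 4 (\<Psi> :: 'i::finite set \<Rightarrow> _)"
    and "card B = 2" "k \<notin> B"
  shows "\<Psi> B (- {k}) = 0"
proof -
  obtain p q where B: "B = {p, q}" "p \<noteq> q" using assms(3) by (auto simp: card_2_iff)
  obtain x where x: "x \<notin> {p, q, k}" using ex_notin[OF five, of "[p, q, k]"] by auto
  have "card {x, k} = 2" using x by auto
  then have "Suc (card (- {x, k})) = 4" by (simp add: card_compl_finite five)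
  from exch_1[OF e assms(3) this] x B assms(4) have "\<Psi> B (insert x (- {x, k})) = 0" by auto
  moreover have "insert x (- {x, k}) = - {k}" using x by auto
  ultimately show ?thesis by simp
qed

text \<open>A two-term exchange with \<open>J = - {x, y}\<close>. The value left over by
  \<open>vanish_2_4\<close> thus depends on \<open>p\<close> alone, and the point missing from the
  last letter can be chosen to suit.\<close>

lemma shift_2_4:
  assumes five: "card (UNIV :: 'i::finite set) = 5" and e: "exch 2 4 (\<Psi> :: 'i::finite set \<Rightarrow> _)"
    and "p \<noteq> x" "p \<noteq> y"
  shows "\<Psi> {p, x} (- {x}) = \<Psi> {p, y} (- {y})"
proof (cases "x = y")
  case False
  then have "Suc (card (- {x, y})) = 4" by (simp add: card_compl_finite five)
  from exch_2[OF e _ this, of "{p}" x y] False assms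
  have "\<Psi> (insert y {p}) (insert x (- {x, y})) = \<Psi> (insert x {p}) (insert y (- {x, y}))" by auto
  moreover have "insert x (- {x, y}) = - {y}" "insert y (- {x, y}) = - {x}" using False by auto
  ultimately show ?thesis by (simp add: insert_commute)
qed simp

text \<open>Move the point missing from \<open>K\<close> to some \<open>x\<close> outside
  \<open>A\<close> and different from \<open>p\<close>. In the exchange over
  \<open>insert x A\<close> every other term has a pair avoiding \<open>x\<close> and dies by
  \<open>vanish_2_4\<close>.\<close>

lemma vanish_3_2_4:
  assumes five: "card (UNIV :: 'i::finite set) = 5"
    and e1: "\<And>K. exch 3 2 (\<lambda>A B. \<Phi> A B (K :: 'i::finite set))" and e2: "\<And>A. exch 2 4 (\<Phi> A)"
    and card: "card A = 3" "card B = 2" "card K = 4"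
  shows "\<Phi> A B K = 0"
proof -
  obtain k where K: "K = - {k}" using compl_eq_singleton[OF five card(3)] .
  have z: "\<Phi> A {j, x} (- {x}) = 0" if x: "x \<notin> A" "j \<noteq> x" for j x
  proof -
    have "(\<Sum>i\<in>insert x A - {j}. \<Phi> (insert x A - {i}) {i, j} (- {x})) = 0"
      using e1[of "- {x}"] x card(1) unfolding exch_def
      by (elim allE[of _ "insert x A"] allE[of _ "{j}"]) simp
    moreover have "(\<Sum>i\<in>insert x A - {j}. \<Phi> (insert x A - {i}) {i, j} (- {x}))
      = (\<Sum>i\<in>{x}. \<Phi> (insert x A - {i}) {i, j} (- {x}))"
    proof (rule sum.mono_neutral_right)
      show "\<forall>i\<in>insert x A - {j} - {x}. \<Phi> (insert x A - {i}) {i, j} (- {x}) = 0"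
        using x by (intro ballI vanish_2_4[OF five e2]) auto
    qed (use x in auto)
    ultimately show ?thesis using x by (simp add: insert_commute)
  qed
  show ?thesis
  proof (cases "k \<in> B")
    case False
    then show ?thesis unfolding K by (intro vanish_2_4[OF five e2] card(2))
  next
    case True
    obtain p where B: "B = {p, k}" "p \<noteq> k"
      using card(2) True by (auto simp: card_2_iff insert_commute)
    obtain a b c where A: "A = {a, b, c}" using card(1) by (auto simp: card_3_iff)
    obtain x where "x \<notin> {a, b, c, p}" using ex_notin[OF five, of "[a, b, c, p]"] by auto
    then show ?thesis
      using shift_2_4[OF five e2[of A], of p k x] z[of x p] A B K by auto
  qed
qed

text \<open>Again the missing point is moved to some \<open>x\<close> outside \<open>A\<close> and
  different from \<open>p\<close>. An exchange of the pairs, with two terms if \<open>p\<close> is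
  in \<open>A\<close> and three otherwise, then takes \<open>x\<close> out of the second
  pair.\<close>

lemma vanish_2_2_4:
  assumes five: "card (UNIV :: 'i::finite set) = 5"
    and e1: "\<And>K. exch 2 2 (\<lambda>A B. \<Phi> A B (K :: 'i::finite set))" and e2: "\<And>A. exch 2 4 (\<Phi> A)"
    and card: "card A = 2" "card B = 2" "card K = 4"
  shows "\<Phi> A B K = 0"
proof -
  obtain k where K: "K = - {k}" using compl_eq_singleton[OF five card(3)] .
  show ?thesis
  proof (cases "k \<in> B")
    case False
    then show ?thesis unfolding K by (intro vanish_2_4[OF five e2] card(2))
  next
    case True
    obtain p where B: "B = {p, k}" "p \<noteq> k"
      using card(2) True by (auto simp: card_2_iff insert_commute)
    obtain a b where A: "A = {a, b}" "a \<noteq> b" using card(1) by (auto simp: card_2_iff)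
    obtain x where x: "x \<notin> {a, b, p}" using ex_notin[OF five, of "[a, b, p]"] by auto
    have 1: "\<Phi> A B K = \<Phi> A {p, x} (- {x})"
      using shift_2_4[OF five e2[of A], of p k x] x B K by auto
    have z: "\<Phi> A' {p, q} (- {x}) = 0" if "q \<noteq> p" "q \<noteq> x" for A' q
      using vanish_2_4[OF five e2[of A'], of "{p, q}" x] x that by auto
    have sw: "\<Phi> {p, q} {p, x} (- {x}) = 0" if "q \<noteq> p" "q \<noteq> x" for q
      using exch_2[OF e1[of "- {x}"], of "{p}" "{p}" x q] z[OF that, of "{p, x}"] x that
      by (auto simp: insert_commute)
    show ?thesis
    proof (cases "p \<in> A")
      case True
      then obtain q where "A = {p, q}" "q \<noteq> p" "q \<noteq> x" using A x by (auto simp: insert_commute)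
      then show ?thesis using 1 sw by simp
    next
      case False
      have "\<Phi> {a, b} {x, p} (- {x}) + \<Phi> {x, b} {a, p} (- {x}) + \<Phi> {x, a} {b, p} (- {x}) = 0"
        using exch_3[OF e1[of "- {x}"], of "{}" "{p}" x a b] A False x by auto
      then have "\<Phi> {a, b} {x, p} (- {x}) = 0"
        by (rule bit_three_zero)
          (use z[of a "{x, b}"] z[of b "{x, a}"] False A x in \<open>auto simp: insert_commute\<close>)
      then show ?thesis using 1 A by (simp add: insert_commute)
    qed
  qed
qed

section \<open>A letter of size three after letters of size one or two\<close>

lemma vanish_1_3:
  assumes five: "card (UNIV :: 'i::finite set) = 5" and e: "exch 1 3 (\<Psi> :: 'i::finite set \<Rightarrow> _)"
    and "card K = 3" "c \<in> K"
  shows "\<Psi> {c} K = 0"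
proof -
  have "card (K - {c}) = 2" using assms(3,4) by simp
  then obtain x where x: "x \<in> K" "x \<noteq> c" by (auto simp: card_2_iff)
  then have "Suc (card (K - {x})) = 3" using assms(3) by simp
  from exch_1[OF e _ this, of "{c}" x] x assms(4) show ?thesis by (auto simp: insert_absorb)
qed

lemma shift_1_3:
  assumes five: "card (UNIV :: 'i::finite set) = 5" and e: "exch 1 3 (\<Psi> :: 'i::finite set \<Rightarrow> _)"
    and "c \<noteq> m" "c' \<noteq> m"
  shows "\<Psi> {c} (- {m, c}) = \<Psi> {c'} (- {m, c'})"
proof (cases "c = c'")
  case False
  then have "Suc (card (- {m, c, c'})) = 3" using assms(3,4) by (simp add: card_compl_finite five)
  from exch_2[OF e _ this, of "{}" c' c] False
  have "\<Psi> {c} (insert c' (- {m, c, c'})) = \<Psi> {c'} (insert c (- {m, c, c'}))" by auto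
  moreover have "insert c' (- {m, c, c'}) = - {m, c}" "insert c (- {m, c, c'}) = - {m, c'}"
    using False assms by auto
  ultimately show ?thesis by simp
qed simp

lemma compl_insert_cases:
  assumes five: "card (UNIV :: 'i::finite set) = 5" and "card (K :: 'i::finite set) = 3" "c \<notin> K"
  obtains m where "m \<noteq> c" "K = - {m, c}"
proof -
  have "card (- insert c K) = 1" using assms by (simp add: card_compl_finite)
  then obtain m where m: "- insert c K = {m}" by (rule card_1_singletonE)
  then have "m \<noteq> c" "K = - {m, c}" using assms(3) by auto
  then show ?thesis by (rule that)
qed

text \<open>Shift \<open>c\<close> to a point \<open>x\<close> other than \<open>b\<close> and
  \<open>m\<close> and swap the singletons: the last one is now \<open>b\<close>, which lies in
  \<open>- {m, x}\<close>.\<close>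

lemma vanish_1_1_3:
  assumes five: "card (UNIV :: 'i::finite set) = 5"
    and e1: "\<And>K. exch 1 1 (\<lambda>A B. \<Phi> A B (K :: 'i::finite set))" and e2: "\<And>A. exch 1 3 (\<Phi> A)"
    and "b \<noteq> m" "c \<noteq> m"
  shows "\<Phi> {b} {c} (- {m, c}) = 0"
proof -
  obtain x where x: "x \<notin> {b, m}" using ex_notin[OF five, of "[b, m]"] by auto
  have "\<Phi> {b} {c} (- {m, c}) = \<Phi> {b} {x} (- {m, x})"
    using x assms by (intro shift_1_3[OF five e2]) auto
  also have "\<dots> = \<Phi> {x} {b} (- {m, x})"
    using exch_2[OF e1[of "- {m, x}"], of "{}" "{}" x b] x by auto
  also have "\<dots> = 0"
    using x assms by (intro vanish_1_3[OF five e2]) (auto simp: card_compl_finite five)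
  finally show ?thesis .
qed

lemma swap_1_1:
  assumes "exch 1 1 (\<Psi> :: 'i::finite set \<Rightarrow> _)"
  shows "\<Psi> {x} {y} = \<Psi> {y} {x}"
proof (cases "x = y")
  case False
  then show ?thesis using exch_2[OF assms, of "{}" "{}" y x] by auto
qed simp

text \<open>The case \<open>b = m\<close> escapes \<open>vanish_1_1_3\<close> and is where the third
  singleton enters: two swaps exchange the roles of \<open>m\<close> and a new point
  \<open>x\<close>, chosen different from \<open>a\<close> as well.\<close>

lemma vanish_1_1_1_3:
  assumes five: "card (UNIV :: 'i::finite set) = 5"
    and e0: "\<And>C K. exch 1 1 (\<lambda>A B. \<Phi> A B C (K :: 'i::finite set))"
    and e1: "\<And>A K. exch 1 1 (\<lambda>B C. \<Phi> A B C K)" and e2: "\<And>A B. exch 1 3 (\<Phi> A B)"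
    and card: "card A = 1" "card B = 1" "card C = 1" "card K = 3"
  shows "\<Phi> A B C K = 0"
proof -
  obtain a b c where abc: "A = {a}" "B = {b}" "C = {c}" using card by (auto simp: card_1_singleton_iff)
  show ?thesis
  proof (cases "c \<in> K")
    case True
    then show ?thesis unfolding abc by (intro vanish_1_3[OF five e2] card)
  next
    case False
    obtain m where m: "m \<noteq> c" "K = - {m, c}" using compl_insert_cases[OF five card(4) False] .
    show ?thesis
    proof (cases "b = m")
      case False
      then show ?thesis unfolding abc m
        using m by (intro vanish_1_1_3[where \<Phi> = "\<Phi> {a}", OF five e1 e2]) auto
    next
      case True
      obtain x where x: "x \<notin> {a, m}" using ex_notin[OF five, of "[a, m]"] by auto
      have "\<Phi> A B C K = \<Phi> {a} {m} {x} (- {m, x})"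
        unfolding abc m True using x m by (intro shift_1_3[OF five e2]) auto
      also have "\<dots> = \<Phi> {a} {x} {m} (- {m, x})" by (rule swap_1_1[OF e1])
      also have "\<dots> = \<Phi> {x} {a} {m} (- {m, x})" by (rule swap_1_1[OF e0])
      also have "\<dots> = 0"
        using vanish_1_1_3[where \<Phi> = "\<Phi> {x}", OF five e1 e2, of a x m] x by (auto simp: insert_commute)
      finally show ?thesis .
    qed
  qed
qed

text \<open>The swap of the first two letters is replaced by the exchange over
  \<open>insert x A\<close>, in which only the term of \<open>x\<close> is not covered by
  \<open>vanish_1_1_3\<close>.\<close>

lemma vanish_2_1_1_3:
  assumes five: "card (UNIV :: 'i::finite set) = 5"
    and e0: "\<And>C K. exch 2 1 (\<lambda>A B. \<Phi> A B C (K :: 'i::finite set))"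
    and e1: "\<And>A K. exch 1 1 (\<lambda>B C. \<Phi> A B C K)" and e2: "\<And>A B. exch 1 3 (\<Phi> A B)"
    and card: "card A = 2" "card B = 1" "card C = 1" "card K = 3"
  shows "\<Phi> A B C K = 0"
proof -
  obtain b c where abc: "B = {b}" "C = {c}" using card by (auto simp: card_1_singleton_iff)
  show ?thesis
  proof (cases "c \<in> K")
    case True
    then show ?thesis unfolding abc by (intro vanish_1_3[OF five e2] card)
  next
    case False
    obtain m where m: "m \<noteq> c" "K = - {m, c}" using compl_insert_cases[OF five card(4) False] .
    show ?thesis
    proof (cases "b = m")
      case False
      then show ?thesis unfolding abc m
        using m by (intro vanish_1_1_3[where \<Phi> = "\<Phi> A", OF five e1 e2]) auto
    next
      case True
      obtain p q where A: "A = {p, q}" using card(1) by (auto simp: card_2_iff)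
      obtain x where x: "x \<notin> {p, q, m}" using ex_notin[OF five, of "[p, q, m]"] by auto
      have "\<Phi> A B C K = \<Phi> A {m} {x} (- {m, x})"
        unfolding abc m True using x m by (intro shift_1_3[OF five e2]) auto
      also have "\<dots> = \<Phi> A {x} {m} (- {m, x})" by (rule swap_1_1[OF e1])
      also have "\<dots> = 0"
      proof -
        have "(\<Sum>i\<in>insert x A. \<Phi> (insert x A - {i}) {i} {m} (- {m, x})) = 0"
          using e0[of "{m}" "- {m, x}"] x card(1) A unfolding exch_def
          by (elim allE[of _ "insert x A"] allE[of _ "{}"]) auto
        moreover have "(\<Sum>i\<in>insert x A. \<Phi> (insert x A - {i}) {i} {m} (- {m, x}))
          = (\<Sum>i\<in>{x}. \<Phi> (insert x A - {i}) {i} {m} (- {m, x}))"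
        proof (rule sum.mono_neutral_right)
          have "\<Phi> A' {i} {m} (- {m, x}) = 0" if "i \<noteq> x" for A' i
            using vanish_1_1_3[where \<Phi> = "\<Phi> A'", OF five e1 e2, of i x m] x that by (auto simp: insert_commute)
          then show "\<forall>i\<in>insert x A - {x}. \<Phi> (insert x A - {i}) {i} {m} (- {m, x}) = 0" by auto
        qed auto
        ultimately show ?thesis using x A by simp
      qed
      finally show ?thesis .
    qed
  qed
qed

text \<open>The case to treat is that of a point \<open>m\<close> missed by both \<open>C\<close>
  and \<open>K\<close>. If \<open>m\<close> is not in \<open>B\<close>, exchanging \<open>B\<close>
  and \<open>C\<close> suffices; otherwise its role is first passed to a point outside
  \<open>A\<close> by \<open>sh\<close>, and then \<open>A\<close> and \<open>B\<close> are
  exchanged.\<close>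

lemma vanish_2_2_1_3:
  assumes five: "card (UNIV :: 'i::finite set) = 5"
    and e0: "\<And>C K. exch 2 2 (\<lambda>A B. \<Phi> A B C (K :: 'i::finite set))"
    and e1: "\<And>A K. exch 2 1 (\<lambda>B C. \<Phi> A B C K)" and e2: "\<And>A B. exch 1 3 (\<Phi> A B)"
    and card: "card A = 2" "card B = 2" "card C = 1" "card K = 3"
  shows "\<Phi> A B C K = 0"
proof -
  have z0: "\<Phi> A B {c} K = 0" if "c \<in> K" "card K = 3" for A B c K
    using that by (intro vanish_1_3[OF five e2])
  have cK: "card (- {m, c}) = 3" if "m \<noteq> c" for m c :: 'i using that by (simp add: card_compl_finite five)
  have z1: "\<Phi> A B {c} (- {m, c}) = 0" if B2: "card B = 2" and that: "m \<notin> B" "c \<noteq> m" for A B c m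
  proof -
    obtain p q where B: "B = {p, q}" "p \<noteq> q" using B2 by (auto simp: card_2_iff)
    obtain x where x: "x \<notin> {p, q, m}" using ex_notin[OF five, of "[p, q, m]"] by auto
    have "\<Phi> A {p, q} {x} (- {m, x}) + \<Phi> A {x, q} {p} (- {m, x}) + \<Phi> A {x, p} {q} (- {m, x}) = 0"
      using exch_3[OF e1[of A "- {m, x}"], of "{}" "{}" x p q] x B by auto
    then have "\<Phi> A {p, q} {x} (- {m, x}) = 0"
      by (rule bit_three_zero) (rule z0, use x B that cK[of m x] in auto)+
    then show ?thesis using shift_1_3[OF five e2, of c m x] x that B by auto
  qed
  have sh: "\<Phi> A {k, m} {l} (- {m, l}) = \<Phi> A {k, l} {m} (- {l, m})"
    if "distinct [k, m, l]" for A k l m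
  proof -
    have "\<Phi> A {k, l} {m} (- {m, l}) + \<Phi> A {m, l} {k} (- {m, l}) + \<Phi> A {m, k} {l} (- {m, l}) = 0"
      using exch_3[OF e1[of A "- {m, l}"], of "{}" "{}" m k l] that by auto
    moreover have "\<Phi> A {m, l} {k} (- {m, l}) = 0" using that cK[of m l] by (intro z0) auto
    ultimately have "\<Phi> A {k, l} {m} (- {m, l}) = \<Phi> A {m, k} {l} (- {m, l})" by (rule bit_three_eq)
    then show ?thesis by (simp add: insert_commute)
  qed
  obtain c where C: "C = {c}" using card by (auto simp: card_1_singleton_iff)
  obtain a b where A: "A = {a, b}" "a \<noteq> b" using card(1) by (auto simp: card_2_iff)
  show ?thesis
  proof (cases "c \<in> K")
    case True
    then show ?thesis unfolding C by (intro z0 card)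
  next
    case False
    obtain m where m: "m \<noteq> c" "K = - {m, c}" using compl_insert_cases[OF five card(4) False] .
    show ?thesis
    proof (cases "m \<in> B")
      case False
      then show ?thesis unfolding C m using m by (intro z1 card) auto
    next
      case True
      obtain k where B: "B = {k, m}" "k \<noteq> m"
        using card(2) True by (auto simp: card_2_iff insert_commute)
      obtain l where l: "l \<notin> {a, b, k}" using ex_notin[OF five, of "[a, b, k]"] by auto
      obtain c' where c': "c' \<notin> {l}" using ex_notin[OF five, of "[l]"] by auto
      have 1: "\<Phi> A B C K = \<Phi> A {k, l} {c'} (- {l, c'})"
      proof (cases "l = m")
        case True
        show ?thesis unfolding B C m True[symmetric] using True c' m by (intro shift_1_3[OF five e2]) auto
      next
        case False
        have "\<Phi> A B C K = \<Phi> A {k, m} {l} (- {m, l})"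
          unfolding B C m using False m by (intro shift_1_3[OF five e2]) auto
        also have "\<dots> = \<Phi> A {k, l} {m} (- {l, m})" using False B l by (intro sh) auto
        also have "\<dots> = \<Phi> A {k, l} {c'} (- {l, c'})"
          using False c' by (intro shift_1_3[OF five e2]) auto
        finally show ?thesis .
      qed
      have z: "\<Phi> A' {k, q} {c'} (- {l, c'}) = 0" if "q \<noteq> k" "q \<noteq> l" for A' q
        using that l c' by (intro z1) auto
      have sw: "\<Phi> {k, q} {k, l} {c'} (- {l, c'}) = 0" if "q \<noteq> k" "q \<noteq> l" for q
        using exch_2[OF e0[of "{c'}" "- {l, c'}"], of "{k}" "{k}" l q] z[OF that, of "{k, l}"] l that
        by (auto simp: insert_commute)
      show ?thesis
      proof (cases "k \<in> A")
        case True
        then obtain q where "A = {k, q}" "q \<noteq> k" "q \<noteq> l" using A l by (auto simp: insert_commute)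
        then show ?thesis using 1 sw by simp
      next
        case False
        have "\<Phi> {a, b} {l, k} {c'} (- {l, c'}) + \<Phi> {l, b} {a, k} {c'} (- {l, c'})
          + \<Phi> {l, a} {b, k} {c'} (- {l, c'}) = 0"
          using exch_3[OF e0[of "{c'}" "- {l, c'}"], of "{}" "{k}" l a b] A False l by auto
        then have "\<Phi> {a, b} {l, k} {c'} (- {l, c'}) = 0"
          by (rule bit_three_zero)
            (use z[of a "{l, b}"] z[of b "{l, a}"] False A l in \<open>auto simp: insert_commute\<close>)
        then show ?thesis using 1 A by (simp add: insert_commute)
      qed
    qed
  qed
qed

text \<open>Configurations are sorted by the size of \<open>C \<inter> K\<close>: two common points
  die at once, while one or none lead to two families of values, \<open>k\<close> and
  \<open>h\<close>, whose symmetry leaves few positions of \<open>A\<close> to check.\<close>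

lemma vanish_2_2_2_3:
  assumes five: "card (UNIV :: 'i::finite set) = 5"
    and e0: "\<And>C K. exch 2 2 (\<lambda>A B. \<Phi> A B C (K :: 'i::finite set))"
    and e1: "\<And>A K. exch 2 2 (\<lambda>B C. \<Phi> A B C K)" and e2: "\<And>A B. exch 2 3 (\<Phi> A B)"
    and card: "card A = 2" "card B = 2" "card C = 2" "card K = 3"
  shows "\<Phi> A B C K = 0"
proof -
  have z0: "\<Phi> A B {p, q} {p, q, x} = 0" if "distinct [p, q, x]" for A B p q x
    using exch_1[OF e2[of A B], of "{p, q}" "{p, q}" x] that by (auto simp: insert_commute)
  have z1: "\<Phi> A B {a, x} {a, y, z} = \<Phi> A B {a, y} {a, x, z}" if "distinct [a, x, y, z]" for A B a x y z
    using exch_2[OF e2[of A B], of "{a}" "{a, z}" y x] that by (auto simp: insert_commute)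
  have z2: "\<Phi> A B {y, z} {x, q, r} + \<Phi> A B {x, z} {y, q, r} + \<Phi> A B {x, y} {z, q, r} = 0"
    if "distinct [x, y, z, q, r]" for A B x y z q r
    using exch_3[OF e2[of A B], of "{}" "{q, r}" x y z] that by auto
  have sBC: "\<Phi> A {a, b} {a, c} K = \<Phi> A {a, c} {a, b} K" if "distinct [a, b, c]" for A K a b c
    using exch_2[OF e1[of A K], of "{a}" "{a}" c b] that by (auto simp: insert_commute)
  have tBC: "\<Phi> A {y, z} {x, q} K + \<Phi> A {x, z} {y, q} K + \<Phi> A {x, y} {z, q} K = 0"
    if "distinct [x, y, z, q]" for A K x y z q
    using exch_3[OF e1[of A K], of "{}" "{q}" x y z] that by auto
  have sAB: "\<Phi> {a, b} {a, c} C K = \<Phi> {a, c} {a, b} C K" if "distinct [a, b, c]" for C K a b c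
    using exch_2[OF e0[of C K], of "{a}" "{a}" c b] that by (auto simp: insert_commute)
  have tAB: "\<Phi> {y, z} {x, q} C K + \<Phi> {x, z} {y, q} C K + \<Phi> {x, y} {z, q} C K = 0"
    if "distinct [x, y, z, q]" for C K x y z q
    using exch_3[OF e0[of C K], of "{}" "{q}" x y z] that by auto
  have y1: "\<Phi> A {a, x} {a, y} {a, x, z} = 0" if "distinct [a, x, y, z]" for A a x y z
    using sBC[of a x y A "{a, x, z}"] z0[of a x z A "{a, y}"] that by auto
  have y2: "\<Phi> A {x, y} {a, z} {a, x, y} = 0" if "distinct [a, x, y, z]" for A a x y z
  proof -
    have "\<Phi> A {x, y} {z, a} {a, x, y} = 0"
      by (rule bit_three_zero[OF tBC[of z x y a A "{a, x, y}"]])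
        (use that z0[of a x y A "{z, y}"] z0[of a y x A "{z, x}"] in \<open>auto simp: insert_commute\<close>)
    then show ?thesis by (simp add: insert_commute)
  qed
  \<comment> \<open>The value turns out to depend only on the partition of the five points into
    \<open>{a, x}\<close> and \<open>{b, y, z}\<close>: \<open>k1\<close> and \<open>k2\<close>
    permute the latter, \<open>ks\<close> swaps the former.\<close>
  define k where "k = (\<lambda>A a x b y z. \<Phi> A {x, b} {a, y} {a, x, z})"
  have k1: "k A a x b y z = k A a x y b z" if "distinct [a, x, b, y, z]" for A a x b y z
  proof -
    have "\<Phi> A {x, b} {y, a} {a, x, z} = \<Phi> A {y, x} {b, a} {a, x, z}"
      by (rule bit_three_eq[OF tBC[of y x b a A "{a, x, z}"]])
        (use that z0[of a x z A "{y, b}"] in \<open>auto simp: insert_commute\<close>)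
    then show ?thesis by (simp add: k_def insert_commute)
  qed
  have k2: "k A a x b y z = k A a x b z y" if "distinct [a, x, b, y, z]" for A a x b y z
    using z1[of a y z x A "{x, b}"] that by (auto simp: k_def insert_commute)
  have s4: "k A a x b y z + k A x a b y z + \<Phi> A {a, x} {b, y} {a, x, z} = 0"
    if "distinct [a, x, b, y, z]" for A a x b y z
    using tBC[of a x b y A "{a, x, z}"] that by (auto simp: k_def insert_commute)
  \<comment> \<open>With \<open>B = {a, x}\<close>, let \<open>C\<close> run over the three pairs in
    \<open>{b, y, z}\<close>. By symmetry each value equals the same sum of two
    \<open>k\<close>-values, and \<open>z2\<close> says that the three add up to 0; so each is 0 and
    the two \<open>k\<close>-values agree.\<close>
  have y3: "\<Phi> A {a, x} {b, y} {a, x, z} = 0" and ks: "k A a x b y z = k A x a b y z"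
    if D: "distinct [a, x, b, y, z]" for A a x b y z
  proof -
    have "\<Phi> A {a, x} {y, z} {b, a, x} + \<Phi> A {a, x} {b, z} {y, a, x} + \<Phi> A {a, x} {b, y} {z, a, x} = 0"
      using z2[of b y z a x A "{a, x}"] D by auto
    then have t: "\<Phi> A {a, x} {z, y} {a, x, b} + \<Phi> A {a, x} {b, z} {a, x, y} + \<Phi> A {a, x} {b, y} {a, x, z} = 0"
      by (simp add: insert_commute)
    have e: "k A a x b z y = k A a x b y z" "k A x a b z y = k A x a b y z"
      using k2[of a x b y z] k2[of x a b y z] D by auto
    have e': "k A a x z y b = k A a x b y z" "k A x a z y b = k A x a b y z"
      using k2[of a x b y z A] k1[of a x b z y A] k2[of a x z b y A]
        k2[of x a b y z A] k1[of x a b z y A] k2[of x a z b y A] D by auto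
    have 1: "k A a x b y z + k A x a b y z + \<Phi> A {a, x} {b, y} {a, x, z} = 0"
      by (rule s4[OF D])
    have 2: "k A a x b y z + k A x a b y z + \<Phi> A {a, x} {b, z} {a, x, y} = 0"
      using s4[of a x b z y A, unfolded e] D by auto
    have 3: "k A a x b y z + k A x a b y z + \<Phi> A {a, x} {z, y} {a, x, b} = 0"
      using s4[of a x z y b A, unfolded e'] D by auto
    have "t1 = 0 \<and> p = q" if "p + q + t1 = 0" "p + q + t2 = 0" "p + q + t3 = 0" "t3 + t2 + t1 = 0"
      for p q t1 t2 t3 :: bit
      using that by (cases p; cases q; cases t1; cases t2; cases t3) auto
    from this[OF 1 2 3 t] show "\<Phi> A {a, x} {b, y} {a, x, z} = 0" "k A a x b y z = k A x a b y z"
      by auto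
  qed
  have y4: "\<Phi> A {x, a} {x, b} {a, y, z} = k A a x b y z" if "distinct [a, x, b, y, z]" for A a x b y z
    using sBC[of x a b A "{a, y, z}"] z1[of a x y z A "{x, b}"] that by (auto simp: k_def insert_commute)
  have kz1: "k {a, c} a e b c z = 0" if "distinct [a, e, b, c, z]" for a e b c z
  proof -
    have "k {a, c} a e b c z = \<Phi> {a, c} {a, e} {e, b} {a, c, z}"
      using y4[of a e b c z "{a, c}"] that by (auto simp: insert_commute)
    also have "\<dots> = \<Phi> {a, e} {a, c} {e, b} {a, c, z}"
      using that by (intro sAB) auto
    also have "\<dots> = 0" using that by (intro y3) auto
    finally show ?thesis .
  qed
  have kz2: "k {a, e} a e b c z = 0" if "distinct [a, e, b, c, z]" for a e b c z
    using sAB[of e a b "{a, c}" "{a, e, z}"] y1[of a e c z "{e, b}"] that by (auto simp: k_def insert_commute)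
  have kz3: "k {b, y} a e z b y = 0" if "distinct [a, e, z, b, y]" for a e z b y
  proof -
    have "\<Phi> {b, y} {e, a} {e, z} {a, b, y} = 0"
      by (rule bit_three_zero[OF tAB[of e b y a "{e, z}" "{a, b, y}"]])
        (use that y3[of a b e z y "{e, y}"] y3[of a y e z b "{e, b}"] in \<open>auto simp: insert_commute\<close>)
    then show ?thesis using y4[of a e z b y "{b, y}"] that by auto
  qed
  \<comment> \<open>Up to the symmetry of \<open>k\<close>, \<open>A\<close> is
    \<open>{a, e}\<close>, or meets both parts, or lies in the part of three points.\<close>
  have kz: "k A a e b y z = 0" if D: "distinct [a, e, b, y, z]" and A: "card A = 2" for A a e b y z
  proof -
    have p1: "k A a e b y z = k A a e y b z" "k A a e b y z = k A a e b z y"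
        "k A a e b y z = k A a e z b y"
      using k1[of a e b y z A] k2[of a e b y z A] k1[of a e b z y A] D by auto
    have p2: "k A a e b y z = k A e a b y z" "k A a e b y z = k A e a y b z" "k A a e b y z = k A e a b z y"
      using ks[of a e b y z A] k1[of e a b y z A] k2[of e a b y z A] D by auto
    from pair_cases[OF D five A] show ?thesis
    proof (elim disjE)
      assume "A = {a, e}" then show ?thesis using kz2[of a e b y z] D by auto
    next
      assume "A = {a, b}" then show ?thesis using p1(1) kz1[of a e y b z] D by auto
    next
      assume "A = {a, y}" then show ?thesis using kz1[of a e b y z] D by auto
    next
      assume "A = {a, z}" then show ?thesis using p1(2) kz1[of a e b z y] D by auto
    next
      assume "A = {e, b}" then show ?thesis using p2(2) kz1[of e a y b z] D by auto
    next
      assume "A = {e, y}" then show ?thesis using p2(1) kz1[of e a b y z] D by auto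
    next
      assume "A = {e, z}" then show ?thesis using p2(3) kz1[of e a b z y] D by auto
    next
      assume "A = {b, y}" then show ?thesis using p1(3) kz3[of a e z b y] D by auto
    next
      assume "A = {b, z}" then show ?thesis using p1(1) kz3[of a e y b z] D by auto
    next
      assume "A = {y, z}" then show ?thesis using kz3[of a e b y z] D by auto
    qed
  qed
  \<comment> \<open>All three sets share \<open>a\<close>; the value is symmetric in the other four
    points, so it only matters whether \<open>A\<close> contains \<open>a\<close>.\<close>
  define h where "h = (\<lambda>A a b x y z. \<Phi> A {a, b} {a, x} {a, y, z})"
  have h1: "h A a b x y z = h A a x b y z" if "distinct [a, b, x, y, z]" for A a b x y z
    using sBC[of a b x A "{a, y, z}"] that by (auto simp: h_def)
  have h2: "h A a b x y z = h A a b y x z" if "distinct [a, b, x, y, z]" for A a b x y z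
    using z1[of a x y z A "{a, b}"] that by (auto simp: h_def)
  have h3: "h A a b x y z = h A a b x z y" for A a b x y z
    by (simp add: h_def insert_commute)
  have hz1: "h {a, y} a b x y z = 0" if "distinct [a, b, x, y, z]" for a b x y z
    using sAB[of a y b "{a, x}" "{a, y, z}"] y1[of a y x z "{a, b}"] that by (auto simp: h_def)
  have hz2: "h {x, y} a b x y z = 0" if D: "distinct [a, b, x, y, z]" for a b x y z
  proof -
    have "\<Phi> {x, y} {a, b} {a, x} {a, y, z} = 0"
    proof (rule bit_three_zero[OF tAB[of a x y b "{a, x}" "{a, y, z}"]])
      have "\<Phi> {a, y} {x, b} {a, x} {a, y, z} = k {a, y} a x b y z"
        using z1[of a x y z "{a, y}" "{x, b}"] D by (auto simp: k_def)
      then show "\<Phi> {a, y} {x, b} {a, x} {a, y, z} = 0" using kz[of a x b y z "{a, y}"] D by auto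
      have "\<Phi> {a, x} {y, b} {a, x} {a, y, z} = k {a, x} a y b x z"
        by (simp add: k_def)
      then show "\<Phi> {a, x} {y, b} {a, x} {a, y, z} = 0" using kz[of a y b x z "{a, x}"] D by auto
    qed (use D in auto)
    then show ?thesis by (simp add: h_def)
  qed
  have hz: "h A a b x y z = 0" if D: "distinct [a, b, x, y, z]" and A: "card A = 2" for A a b x y z
  proof -
    note hh = h3[of A a b x y z] h2[of a b x y z A] h3[of A a b y x z] h1[of a b y x z A]
      h1[of a b x y z A] h3[of A a x b y z] h2[of a x b y z A]
    from pair_cases[OF D five A] show ?thesis
    proof (elim disjE)
      assume "A = {a, b}" then show ?thesis using hh hz1[of a x y b z] D by auto
    next
      assume "A = {a, x}" then show ?thesis using hh hz1[of a b y x z] D by auto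
    next
      assume "A = {a, y}" then show ?thesis using hz1[of a b x y z] D by auto
    next
      assume "A = {a, z}" then show ?thesis using hh hz1[of a b x z y] D by auto
    next
      assume "A = {b, x}" then show ?thesis using hh hz2[of a y b x z] D by auto
    next
      assume "A = {b, y}" then show ?thesis using hh hz2[of a x b y z] D by auto
    next
      assume "A = {b, z}" then show ?thesis using hh hz2[of a x b z y] D by auto
    next
      assume "A = {x, y}" then show ?thesis using hz2[of a b x y z] D by auto
    next
      assume "A = {x, z}" then show ?thesis using hh hz2[of a b x z y] D by auto
    next
      assume "A = {y, z}" then show ?thesis using hh hz2[of a b y z x] D by auto
    qed
  qed
  have meet: "\<Phi> A B {a, x} {a, y, z} = 0" if D: "distinct [a, b, x, y, z]" for a b x y z
  proof -
    have c: "\<Phi> A B {a, x} {a, y, z} = \<Phi> A B {a, y} {a, x, z}" "\<Phi> A B {a, x} {a, y, z} = \<Phi> A B {a, z} {a, x, y}"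
      using z1[of a x y z A B] z1[of a x z y A B] D by (auto simp: insert_commute)
    from pair_cases[OF D five card(2)] show ?thesis
    proof (elim disjE)
      assume "B = {a, b}" then show ?thesis using hz[OF D card(1)] by (simp add: h_def)
    next
      assume "B = {a, x}" then show ?thesis using c(1) y1[of a x y z A] D by auto
    next
      assume "B = {a, y}" then show ?thesis using y1[of a y x z A] D by auto
    next
      assume "B = {a, z}" then show ?thesis using y1[of a z x y A] D by (auto simp: insert_commute)
    next
      assume "B = {b, x}" then show ?thesis
        using c(1) kz[of a x b y z, OF _ card(1)] D by (auto simp: k_def insert_commute)
    next
      assume "B = {b, y}" then show ?thesis
        using kz[of a y b x z, OF _ card(1)] D by (auto simp: k_def insert_commute)
    next
      assume "B = {b, z}" then show ?thesis
        using kz[of a z b x y, OF _ card(1)] D by (auto simp: k_def insert_commute)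
    next
      assume "B = {x, y}" then show ?thesis using c(2) y2[of a x y z A] D by auto
    next
      assume "B = {x, z}" then show ?thesis using c(1) y2[of a x z y A] D by auto
    next
      assume "B = {y, z}" then show ?thesis using y2[of a y z x A] D by auto
    qed
  qed
  have y40: "\<Phi> A {x, a} {x, b} {a, y, z} = 0" if "distinct [a, x, b, y, z]" for a x b y z
    using y4[OF that, of A] kz[OF that card(1)] by simp
  have disj: "\<Phi> A B {b, y} {a, x, z} = 0" if D: "distinct [a, x, b, y, z]" for a x b y z
  proof -
    from pair_cases[OF D five card(2)] show ?thesis
    proof (elim disjE)
      assume "B = {a, x}" then show ?thesis using y3[OF D, of A] by simp
    next
      assume "B = {a, b}" then show ?thesis using y40[of a b y x z] D by (auto simp: insert_commute)
    next
      assume "B = {a, y}" then show ?thesis using y40[of a y b x z] D by (auto simp: insert_commute)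
    next
      assume "B = {a, z}" then show ?thesis using y3[of a z b y x A] D by (auto simp: insert_commute)
    next
      assume "B = {x, b}" then show ?thesis using y40[of x b y a z] D by (auto simp: insert_commute)
    next
      assume "B = {x, y}" then show ?thesis using y40[of x y b a z] D by (auto simp: insert_commute)
    next
      assume "B = {x, z}" then show ?thesis using y3[of x z b y a A] D by (auto simp: insert_commute)
    next
      assume B: "B = {b, y}"
      have "\<Phi> A {b, y} {b, y} {a, x, z} + \<Phi> A {b, y} {y, a} {b, x, z} + \<Phi> A {b, y} {b, a} {y, x, z} = 0"
        using z2[of b y a x z A "{b, y}"] D by (auto simp: ac_simps)
      then have "\<Phi> A {b, y} {b, y} {a, x, z} = 0"
        by (rule bit_three_zero)
          (use y40[of b y a x z] y40[of y b a x z] D in \<open>auto simp: insert_commute\<close>)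
      then show ?thesis unfolding B .
    next
      assume "B = {b, z}" then show ?thesis using y40[of z b y a x] D by (auto simp: insert_commute)
    next
      assume "B = {y, z}" then show ?thesis using y40[of z y b a x] D by (auto simp: insert_commute)
    qed
  qed
  obtain p q where C: "C = {p, q}" "p \<noteq> q" using card(3) by (auto simp: card_2_iff)
  obtain r s t where rst: "distinct [p, q, r, s, t]" using name_rest_2[OF five C(2)] .
  have m: "\<Phi> A B {p, q} {p, u, v} = 0" "\<Phi> A B {p, q} {q, u, v} = 0" if "distinct [p, q, u, v, w]" for u v w
    using meet[of p w q u v] meet[of q w p u v] that by (auto simp: insert_commute)
  from triple_cases[OF rst five card(4)] show ?thesis
  proof (elim disjE)
    assume "K = {p, q, r}" then show ?thesis using z0[of p q r] C rst by auto
  next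
    assume "K = {p, q, s}" then show ?thesis using z0[of p q s] C rst by auto
  next
    assume "K = {p, q, t}" then show ?thesis using z0[of p q t] C rst by auto
  next
    assume "K = {p, r, s}" then show ?thesis using m(1)[of r s t] C rst by auto
  next
    assume "K = {p, r, t}" then show ?thesis using m(1)[of r t s] C rst by auto
  next
    assume "K = {p, s, t}" then show ?thesis using m(1)[of s t r] C rst by auto
  next
    assume "K = {q, r, s}" then show ?thesis using m(2)[of r s t] C rst by auto
  next
    assume "K = {q, r, t}" then show ?thesis using m(2)[of r t s] C rst by auto
  next
    assume "K = {q, s, t}" then show ?thesis using m(2)[of s t r] C rst by auto
  next
    assume "K = {r, s, t}" then show ?thesis using disj[of r s p q t] C rst by auto
  qed
qed

subsection \<open>Monomials of larger weight\<close>

lemma exch_cong: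
  assumes "\<And>A B. card A = a \<Longrightarrow> card B = b \<Longrightarrow> \<Psi> A B = \<Psi>' A (B :: 'i::finite set)" "exch a b \<Psi>"
  shows "exch a b \<Psi>'"
  unfolding exch_def
proof (intro allI impI)
  fix I J :: "'i set" assume IJ: "card I = Suc a" "Suc (card J) = b"
  have "(\<Sum>i\<in>I - J. \<Psi>' (I - {i}) (insert i J)) = (\<Sum>i\<in>I - J. \<Psi> (I - {i}) (insert i J))"
    by (rule sum.cong[OF refl], rule assms(1)[symmetric]) (use IJ in auto)
  then show "(\<Sum>i\<in>I - J. \<Psi>' (I - {i}) (insert i J)) = 0"
    using assms(2) IJ by (simp add: exch_def)
qed

lemma exch_0: "exch a b (\<lambda>A B. 0)"
  by (simp add: exch_def)

lemma exch_word:
  assumes "good (a # b # \<omega>)" "Ann (wt (a # b # \<omega>)) L"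
  shows "exch a b (\<lambda>A B. L (wm [A, B] h))"
  unfolding exch_def using word_exchange[OF assms] by blast

text \<open>In the applications the last letter is larger than its weight, so the terms with
  \<open>i\<close> in \<open>J\<close> are not covered by \<open>good_low\<close>; they have a last
  letter of size \<open>c - 2\<close>.\<close>

lemma exch_last:
  assumes "good (a # \<omega>)" "Ann (wt (a # \<omega>)) L"
    and "\<And>T K h. card T = a \<Longrightarrow> card K + 2 = c \<Longrightarrow> L (wm [T] (X K * h\<^sup>2)) = 0"
  shows "exch a c (\<lambda>A K. L (wm [A] (X K * h\<^sup>2)))"
  unfolding exch_def wm.simps
proof (intro allI impI)
  fix I J :: "'a set" assume "card I = Suc a" and J: "Suc (card J) = c"
  then show "(\<Sum>i\<in>I - J. L (X (I - {i}) * (X (insert i J) * h\<^sup>2)\<^sup>2)) = 0"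
    using assms(3) by (intro exchange[OF assms(1,2)]) auto
qed

lemma higher_2:
  assumes five: "card (UNIV :: 'i::finite set) = 5"
    and g: "good (a1 # a2 # 2 # \<omega>)" and L: "Ann (wt (a1 # a2 # 2 # \<omega>)) (L :: 'i pol \<Rightarrow> bit)"
    and H: "\<And>A B T h. card A = a1 \<Longrightarrow> card B = a2 \<Longrightarrow> card T = 2 \<Longrightarrow> L (wm [A, B] (X T * h\<^sup>2)) = 0"
    and a: "(a1, a2) \<in> {(3, 3), (3, 2), (2, 2)}"
    and card: "card A = a1" "card B = a2" "card K = 4"
  shows "L (wm [A, B] (X K * h\<^sup>2)) = 0"
proof -
  \<comment> \<open>\<open>e2\<close> must hold for every \<open>A\<close>; the value 0 makes it
    trivial for a first letter of the wrong size, about which nothing is known.\<close>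
  define \<Phi> where "\<Phi> = (\<lambda>A B K. if card A = a1 then L (wm [A, B] (X K * h\<^sup>2)) else 0)"
  have e1: "exch a1 a2 (\<lambda>A B. \<Phi> A B K)" for K
    by (rule exch_cong[OF _ exch_word[OF g L, of "X K * h\<^sup>2"]]) (simp add: \<Phi>_def)
  have e2: "exch a2 4 (\<Phi> A)" for A
  proof (cases "card A = a1")
    case True
    have "exch a2 4 (\<lambda>B K. L (X A * (wm [B] (X K * h\<^sup>2))\<^sup>2))"
      by (rule exch_last[OF good_tl[OF g] good_Ann_down[OF g L True]]) (use H True in auto)
    then show ?thesis by (rule exch_cong[rotated]) (simp add: \<Phi>_def True)
  qed (simp add: \<Phi>_def exch_0)
  have "\<Phi> A B K = 0"
  proof -
    from a consider (33) "a1 = 3" "a2 = 3" | (32) "a1 = 3" "a2 = 2" | (22) "a1 = 2" "a2 = 2" by auto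
    then show ?thesis
    proof cases
      case 33
      show ?thesis by (rule vanish_3_3_4[OF five e1[unfolded 33] e2[unfolded 33] card[unfolded 33]])
    next
      case 32
      show ?thesis by (rule vanish_3_2_4[OF five e1[unfolded 32] e2[unfolded 32] card[unfolded 32]])
    next
      case 22
      show ?thesis by (rule vanish_2_2_4[OF five e1[unfolded 22] e2[unfolded 22] card[unfolded 22]])
    qed
  qed
  then show ?thesis using card by (simp add: \<Phi>_def)
qed

lemma higher_1:
  assumes five: "card (UNIV :: 'i::finite set) = 5"
    and g: "good (a1 # a2 # a3 # 1 # \<omega>)" and L: "Ann (wt (a1 # a2 # a3 # 1 # \<omega>)) (L :: 'i pol \<Rightarrow> bit)"
    and H: "\<And>A B C T h. card A = a1 \<Longrightarrow> card B = a2 \<Longrightarrow> card C = a3 \<Longrightarrow> card T = 1 \<Longrightarrow>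
      L (wm [A, B, C] (X T * h\<^sup>2)) = 0"
    and a: "(a1, a2, a3) \<in> {(2, 2, 2), (2, 2, 1), (2, 1, 1), (1, 1, 1)}"
    and card: "card A = a1" "card B = a2" "card C = a3" "card K = 3"
  shows "L (wm [A, B, C] (X K * h\<^sup>2)) = 0"
proof -
  define \<Phi> where "\<Phi> = (\<lambda>A B C K. if card A = a1 \<and> card B = a2 then L (wm [A, B, C] (X K * h\<^sup>2)) else 0)"
  note g' = good_tl[OF g] and L' = good_Ann_down[OF g L]
  have e0: "exch a1 a2 (\<lambda>A B. \<Phi> A B C K)" for C K
    by (rule exch_cong[OF _ exch_word[OF g L, of "wm [C] (X K * h\<^sup>2)"]]) (simp add: \<Phi>_def)
  have e1: "exch a2 a3 (\<lambda>B C. \<Phi> A B C K)" for A K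
  proof (cases "card A = a1")
    case True
    show ?thesis
      by (rule exch_cong[OF _ exch_word[OF g' L'[OF True], of "X K * h\<^sup>2"]]) (simp add: \<Phi>_def True)
  qed (simp add: \<Phi>_def exch_0)
  have e2: "exch a3 3 (\<Phi> A B)" for A B
  proof (cases "card A = a1 \<and> card B = a2")
    case True
    have "exch a3 3 (\<lambda>C K. L (X A * (X B * (wm [C] (X K * h\<^sup>2))\<^sup>2)\<^sup>2))"
      by (rule exch_last[OF good_tl[OF g'] good_Ann_down[OF g' L']]) (use H True in auto)
    then show ?thesis by (rule exch_cong[rotated]) (simp add: \<Phi>_def True)
  next
    case False
    then show ?thesis by (auto simp: \<Phi>_def exch_0)
  qed
  have "\<Phi> A B C K = 0"
  proof -
    from a consider (222) "a1 = 2" "a2 = 2" "a3 = 2" | (221) "a1 = 2" "a2 = 2" "a3 = 1"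
      | (211) "a1 = 2" "a2 = 1" "a3 = 1" | (111) "a1 = 1" "a2 = 1" "a3 = 1" by auto
    then show ?thesis
    proof cases
      case 222
      show ?thesis by (rule vanish_2_2_2_3[OF five e0[unfolded 222] e1[unfolded 222] e2[unfolded 222] card[unfolded 222]])
    next
      case 221
      show ?thesis by (rule vanish_2_2_1_3[OF five e0[unfolded 221] e1[unfolded 221] e2[unfolded 221] card[unfolded 221]])
    next
      case 211
      show ?thesis by (rule vanish_2_1_1_3[OF five e0[unfolded 211] e1[unfolded 211] e2[unfolded 211] card[unfolded 211]])
    next
      case 111
      show ?thesis by (rule vanish_1_1_1_3[OF five e0[unfolded 111] e1[unfolded 111] e2[unfolded 111] card[unfolded 111]])
    qed
  qed
  then show ?thesis using card by (simp add: \<Phi>_def)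
qed

text \<open>One term remains in the exchange with \<open>J = - {x}\<close> for a point
  \<open>x\<close> outside \<open>A\<close>.\<close>

lemma higher_full:
  assumes five: "card (UNIV :: 'i::finite set) = 5"
    and g: "good (a # b # \<omega>)" and L: "Ann (wt (a # b # \<omega>)) (L :: 'i pol \<Rightarrow> bit)"
    and H: "\<And>A T h. card A = a \<Longrightarrow> card T = 3 \<Longrightarrow> L (wm [A] (X T * h\<^sup>2)) = 0"
    and A: "card A = a" "a < 5"
  shows "L (wm [A] (X UNIV * h\<^sup>2)) = 0"
proof -
  have e: "exch a 5 (\<lambda>A K. L (wm [A] (X K * h\<^sup>2)))"
    by (rule exch_last[OF g L]) (use H in auto)
  obtain x where "x \<notin> A" using A five by (metis UNIV_I less_irrefl subsetI top.extremum_uniqueI)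
  then have "L (wm [A] (X (insert x (- {x})) * h\<^sup>2)) = 0"
    using exch_1[OF e A(1), of "- {x}" x] five by (auto simp: card_compl_finite)
  moreover have "insert x (- {x}) = UNIV" by auto
  ultimately show ?thesis by simp
qed

lemma nth_blocks:
  "k < d + s + t \<Longrightarrow> blocks d s t ! k = (if k < d then 3 else if k < d + s then 2 else 1)"
  by (auto simp: blocks_def nth_append)

lemma length_blocks: "length (blocks d s t) = d + s + t"
  by (simp add: blocks_def)

lemma split_before:
  assumes "m \<le> j" "j < length \<omega>"
  shows "\<omega> = take (j - m) \<omega> @ map ((!) \<omega>) [j - m..<j] @ \<omega> ! j # drop (Suc j) \<omega>"
proof -
  have "\<omega> = take j \<omega> @ \<omega> ! j # drop (Suc j) \<omega>" using assms(2) by (rule id_take_nth_drop)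
  moreover have "take j \<omega> = take (j - m) \<omega> @ map ((!) \<omega>) [j - m..<j]"
    using assms by (intro nth_equalityI) (auto simp: nth_append)
  ultimately show ?thesis by simp
qed

lemma good_blocks: "0 < s \<Longrightarrow> 0 < t \<Longrightarrow> good (blocks d s t)"
  unfolding good_def by blast

text \<open>Downward induction on the prefix length \<open>j\<close>. A next letter that is too
  small or of the wrong parity is killed, one of the right size falls under the induction
  hypothesis, and larger ones are excluded by means of up to three preceding letters, whence the
  bounds on \<open>d\<close> and \<open>s\<close>. The induction stops at \<open>j = 1\<close>: a
  first letter with all five variables has nothing before it, and these monomials are what Kameko's
  map retains.\<close>

lemma min_words_determine:
  assumes five: "card (UNIV :: 'i::finite set) = 5"
    and d: "2 \<le> d" and s: "3 \<le> s" and t: "1 \<le> t"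
    and L: "Ann (wt (blocks d s t)) (L :: 'i pol \<Rightarrow> bit)"
    and min: "\<And>ws. map card ws = blocks d s t \<Longrightarrow> L (wm ws 1) = 0"
    and "1 \<le> j" "j \<le> d + s + t" "map card ws = take j (blocks d s t)"
  shows "L (wm ws g) = 0"
  using assms(8,7,9)
proof (induction arbitrary: ws g rule: inc_induct)
  case base
  define \<omega> where "\<omega> = blocks d s t"
  have good: "good \<omega>" using s t good_blocks[of s t d] by (simp add: \<omega>_def)
  have "map card ws = \<omega>" using base by (simp add: \<omega>_def length_blocks)
  then have A: "Ann (wt []) (\<lambda>g. L (wm ws g))"
    using good L by (intro Ann_wm) (auto simp: \<omega>_def)
  show ?case
  proof (rule additive_pol_eq_0I[OF AnnD(1)[OF A]])
    fix e :: "'i \<Rightarrow> nat"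
    show "L (wm ws (mon e)) = 0"
    proof (cases "deg e = 0")
      case True
      then have "e = 0" by (auto simp: deg_def fun_eq_iff)
      then show ?thesis using min \<open>map card ws = \<omega>\<close> by (simp add: \<omega>_def)
    next
      case False
      then show ?thesis using AnnD(3)[OF A] by simp
    qed
  qed
next
  case (step j)
  define \<omega> where "\<omega> = blocks d s t"
  have good: "good \<omega>" using s t good_blocks[of s t d] by (simp add: \<omega>_def)
  have L: "Ann (wt \<omega>) L" using L by (simp add: \<omega>_def)
  have len: "length \<omega> = d + s + t" by (simp add: \<omega>_def length_blocks)
  have j: "j < length \<omega>" "1 \<le> j" using step len by auto
  have nth: "\<omega> ! k = (if k < d then 3 else if k < d + s then 2 else 1)" if "k < length \<omega>" for k
    using nth_blocks[of k d s t] that len by (simp add: \<omega>_def)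
  define b where "b = \<omega> ! j"
  have bn: "b = (if j < d then 3 else if j < d + s then 2 else 1)"
    unfolding b_def by (rule nth[OF j(1)])
  have sp1: "\<omega> = take j \<omega> @ b # drop (Suc j) \<omega>"
    unfolding b_def by (rule id_take_nth_drop[OF j(1)])
  have Lws: "good (b # drop (Suc j) \<omega>)" "Ann (wt (b # drop (Suc j) \<omega>)) (\<lambda>g. L (wm ws g))"
    if "map card ws = take j \<omega>" for ws
    using that good L sp1 good_append[of "take j \<omega>" "b # drop (Suc j) \<omega>"]
      Ann_wm[of ws "b # drop (Suc j) \<omega>" L] by metis+
  have H: "L (wm ws (X T * h\<^sup>2)) = 0" if ws: "map card ws = take j \<omega>" and T: "card T = b" for ws T h
  proof -
    have "map card (ws @ [T]) = take (Suc j) \<omega>"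
      using ws T j by (simp add: b_def take_Suc_conv_app_nth)
    then have "L (wm (ws @ [T]) h) = 0" using step.IH \<omega>_def by simp
    then show ?thesis by (simp add: wm_append)
  qed
  have ws: "map card ws = take j \<omega>" using step.prems \<omega>_def by simp
  have split: "\<exists>us vs. ws = us @ vs \<and> map card us = take (j - m) \<omega> \<and> map card vs = map ((!) \<omega>) [j - m..<j]"
    if "m \<le> j" for m
  proof -
    have "take j \<omega> = take (j - m) \<omega> @ map ((!) \<omega>) [j - m..<j]"
      using that j by (intro nth_equalityI) (auto simp: nth_append)
    then show ?thesis using ws by (metis map_eq_append_conv)
  qed
  have Lus: "good (map ((!) \<omega>) [j - m..<j] @ b # drop (Suc j) \<omega>)"
      "Ann (wt (map ((!) \<omega>) [j - m..<j] @ b # drop (Suc j) \<omega>)) (\<lambda>g. L (wm us g))"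
    if "m \<le> j" "map card us = take (j - m) \<omega>" for m us
  proof -
    have "\<omega> = map card us @ (map ((!) \<omega>) [j - m..<j] @ b # drop (Suc j) \<omega>)"
      using split_before[OF that(1) j(1)] that(2) by (simp add: b_def)
    then show "good (map ((!) \<omega>) [j - m..<j] @ b # drop (Suc j) \<omega>)"
      "Ann (wt (map ((!) \<omega>) [j - m..<j] @ b # drop (Suc j) \<omega>)) (\<lambda>g. L (wm us g))"
      using good L good_append[of "map card us"] Ann_wm[of us _ L] by metis+
  qed
  have Hus: "L (wm us (wm vs (X T * h\<^sup>2))) = 0"
    if "m \<le> j" "map card us = take (j - m) \<omega>" "map card vs = map ((!) \<omega>) [j - m..<j]" "card T = b" for m us vs T h
  proof -
    have "take j \<omega> = take (j - m) \<omega> @ map ((!) \<omega>) [j - m..<j]"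
      using that j by (intro nth_equalityI) (auto simp: nth_append)
    then show ?thesis using H[of "us @ vs" T h] that by (simp add: wm_append)
  qed
  have upt1: "[j - 1..<j] = [j - 1]" using j by (cases j) auto
  have upt2: "[j - 2..<j] = [j - 2, j - 1]" if j2: "2 \<le> j"
  proof -
    obtain i where "j = 2 + i" using j2 le_Suc_ex by blast
    then have "j = Suc (Suc i)" by simp
    then show ?thesis by simp
  qed
  have upt3: "[j - 3..<j] = [j - 3, j - 2, j - 1]" if j3: "3 \<le> j"
  proof -
    obtain i where "j = 3 + i" using j3 le_Suc_ex by blast
    then have "j = Suc (Suc (Suc i))" by simp
    then show ?thesis by simp
  qed
  \<comment> \<open>Size 3 is also wanted for size 5, as input to \<open>higher_full\<close>; for
    \<open>b = 3\<close> it is the induction hypothesis.\<close>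
  have three3: "L (wm ws (X K * h\<^sup>2)) = 0" if K: "card K = 3" and b: "b = 3 \<or> b = 1" and wsj: "map card ws = take j \<omega>" for K h ws
  proof (cases "b = 3")
    case True
    then show ?thesis using K by (intro H[OF wsj]) simp
  next
    case False
    then have b1: "b = 1" using b by simp
    have "b \<noteq> 1" if "j < d + s" using bn that by (cases "j < d") auto
    with b1 have jds: "d + s \<le> j" using not_less by blast
    then have j3: "3 \<le> j" using s by linarith
    have "take j \<omega> = take (j - 3) \<omega> @ map ((!) \<omega>) [j - 3..<j]"
      using j3 j by (intro nth_equalityI) (auto simp: nth_append)
    then obtain us A B C where eq: "ws = us @ [A, B, C]" "map card us = take (j - 3) \<omega>"
        "card A = \<omega> ! (j - 3)" "card B = \<omega> ! (j - 2)" "card C = \<omega> ! (j - 1)"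
      using wsj unfolding upt3[OF j3] by (auto simp: map_eq_append_conv map_eq_Cons_conv)
    have "L (wm us (wm [A, B, C] (X K * h\<^sup>2))) = 0"
    proof (rule higher_1[OF five])
      show "good (\<omega> ! (j - 3) # \<omega> ! (j - 2) # \<omega> ! (j - 1) # 1 # drop (Suc j) \<omega>)"
        "Ann (wt (\<omega> ! (j - 3) # \<omega> ! (j - 2) # \<omega> ! (j - 1) # 1 # drop (Suc j) \<omega>)) (\<lambda>g. L (wm us g))"
        using Lus[OF j3 eq(2)] unfolding upt3[OF j3] b1 by auto
      show "(\<omega> ! (j - 3), \<omega> ! (j - 2), \<omega> ! (j - 1)) \<in> {(2, 2, 2), (2, 2, 1), (2, 1, 1), (1, 1, 1)}"
        using nth[of "j - 3"] nth[of "j - 2"] nth[of "j - 1"] j jds s by auto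
      show "L (wm us (wm [A, B, C] (X T * h\<^sup>2))) = 0"
        if "card A = \<omega> ! (j - 3)" "card B = \<omega> ! (j - 2)" "card C = \<omega> ! (j - 1)" "card T = 1" for A B C T h
        using Hus[OF j3 eq(2), of "[A, B, C]" T h] that unfolding upt3[OF j3] b1 by simp
    qed (use eq K in auto)
    then show ?thesis unfolding eq(1) by (simp add: wm_append)
  qed
  show ?case
  proof (rule additive_pol_eq_0I[OF AnnD(1)[OF Lws(2)[OF ws]]])
    fix e :: "'i \<Rightarrow> nat"
    define K h where "K = {i. odd (e i)}" and "h = mon (\<lambda>i. e i div 2)"
    have e: "mon e = X K * h\<^sup>2" unfolding K_def h_def by (rule mon_split)
    have K5: "card K \<le> 5" using five card_mono[of UNIV K] by auto
    have b3: "b = 3 \<or> b = 2 \<or> b = 1" using bn by simp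
    show "L (wm ws (mon e)) = 0"
    proof (cases "card K < b \<or> card K = b \<or> odd (card K + wt (b # drop (Suc j) \<omega>))")
      case True
      then show ?thesis unfolding e
        using good_low[OF Lws[OF ws]] H[OF ws] Ann_parity[OF Lws(2)[OF ws]] by blast
    next
      case False
      then have gt: "b < card K" and par: "even (card K + b)" by auto
      then have "b = 2 \<and> card K = 4 \<or> b = 1 \<and> card K = 3 \<or> (b = 1 \<or> b = 3) \<and> card K = 5"
        using b3 K5 by presburger
      then consider (four) "b = 2" "card K = 4" | (three) "b = 1" "card K = 3" | (full) "b = 1 \<or> b = 3" "card K = 5"
        by blast
      then show ?thesis
      proof cases
        case four
        have "b = 3" if "j < d" using bn that by auto
        moreover have "b = 1" if "\<not> j < d + s" using bn that by auto
        ultimately have jd: "d \<le> j" "j < d + s" using four by (metis not_less numeral_eq_iff num.distinct num.inject, force)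
        then have j2: "2 \<le> j" using d by linarith
        obtain us A B where eq: "ws = us @ [A, B]" "map card us = take (j - 2) \<omega>"
            "card A = \<omega> ! (j - 2)" "card B = \<omega> ! (j - 1)"
          using split[OF j2] unfolding upt2[OF j2] by (auto simp: map_eq_Cons_conv)
        have "L (wm us (wm [A, B] (X K * h\<^sup>2))) = 0"
        proof (rule higher_2[OF five])
          show "good (\<omega> ! (j - 2) # \<omega> ! (j - 1) # 2 # drop (Suc j) \<omega>)"
            "Ann (wt (\<omega> ! (j - 2) # \<omega> ! (j - 1) # 2 # drop (Suc j) \<omega>)) (\<lambda>g. L (wm us g))"
            using Lus[OF j2 eq(2)] unfolding upt2[OF j2] four by auto
          show "(\<omega> ! (j - 2), \<omega> ! (j - 1)) \<in> {(3, 3), (3, 2), (2, 2)}"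
            using nth[of "j - 2"] nth[of "j - 1"] j jd d by auto
          show "L (wm us (wm [A, B] (X T * h\<^sup>2))) = 0"
            if "card A = \<omega> ! (j - 2)" "card B = \<omega> ! (j - 1)" "card T = 2" for A B T h
            using Hus[OF j2 eq(2), of "[A, B]" T h] that unfolding upt2[OF j2] four by simp
        qed (use eq four in auto)
        then show ?thesis unfolding e eq(1) by (simp add: wm_append)
      next
        case three
        then show ?thesis unfolding e using ws by (intro three3) auto
      next
        case full
        obtain us A where eq: "ws = us @ [A]" "map card us = take (j - 1) \<omega>" "card A = \<omega> ! (j - 1)"
          using split[OF j(2)] unfolding upt1 by (auto simp: map_eq_Cons_conv)
        have KU: "K = UNIV" using full(2) five by (metis card_subset_eq finite subset_UNIV)
        have "L (wm us (wm [A] (X UNIV * h\<^sup>2))) = 0"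
        proof (rule higher_full[OF five])
          show "good (\<omega> ! (j - 1) # b # drop (Suc j) \<omega>)"
            "Ann (wt (\<omega> ! (j - 1) # b # drop (Suc j) \<omega>)) (\<lambda>g. L (wm us g))"
            using Lus[OF j(2) eq(2)] unfolding upt1 by auto
          have "take j \<omega> = take (j - 1) \<omega> @ [\<omega> ! (j - 1)]"
            using j take_Suc_conv_app_nth[of "j - 1" \<omega>] by simp
          then show "L (wm us (wm [A] (X T * h\<^sup>2))) = 0" if "card A = \<omega> ! (j - 1)" "card T = 3" for A T h
            using three3[of T "us @ [A]" h] that full(1) eq(2) by (auto simp: wm_append)
          show "\<omega> ! (j - 1) < 5" using nth[of "j - 1"] j by auto
        qed (rule eq(3))
        then show ?thesis unfolding e eq(1) KU by (simp add: wm_append)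
      qed
    qed
  qed
qed

subsection \<open>Sums over supersets\<close>

definition ups :: "'a set \<Rightarrow> 'a set \<Rightarrow> 'a set set" where
  "ups \<Omega> v = {S. v \<subseteq> S \<and> S \<subseteq> \<Omega>}"

text \<open>If \<open>x\<close> is not in \<open>v\<close>, the sets \<open>R\<close> and
  \<open>insert x R\<close> pair off and each value occurs twice.\<close>

lemma sum_ups_insert:
  fixes A :: "'i::finite set \<Rightarrow> bit"
  assumes "x \<in> \<Omega>"
  shows "(\<Sum>R\<in>ups \<Omega> v. A (insert x R)) = of_bool (x \<in> v) * (\<Sum>S\<in>ups \<Omega> v. A S)"
proof (cases "x \<in> v")
  case True
  then show ?thesis
    by (auto simp: ups_def insert_absorb subset_iff intro!: sum.cong arg_cong[where f = A])
next
  case False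
  define T where "T = {R \<in> ups \<Omega> v. x \<notin> R}"
  have "ups \<Omega> v = T \<union> insert x ` T"
  proof (intro equalityI subsetI)
    fix R assume R: "R \<in> ups \<Omega> v"
    show "R \<in> T \<union> insert x ` T"
    proof (cases "x \<in> R")
      case True
      then have "R = insert x (R - {x})" "R - {x} \<in> T"
        using R \<open>x \<notin> v\<close> by (auto simp: T_def ups_def)
      then show ?thesis by blast
    qed (use R in \<open>auto simp: T_def\<close>)
  qed (use assms in \<open>auto simp: T_def ups_def\<close>)
  moreover have "T \<inter> insert x ` T = {}" by (auto simp: T_def)
  moreover have "inj_on (insert x) T" by (auto simp: T_def inj_on_def)
  ultimately have "(\<Sum>R\<in>ups \<Omega> v. A (insert x R)) = (\<Sum>R\<in>T. A (insert x R)) + (\<Sum>R\<in>T. A (insert x R))"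
    by (simp add: sum.union_disjoint sum.reindex)
  then show ?thesis using False by simp
qed

text \<open>Moebius inversion, from \<open>\<Omega>\<close> downwards; a nonempty set has only
  nonempty supersets, so the empty set never enters.\<close>

lemma ups_sum_eq_0_imp:
  fixes A :: "'i::finite set \<Rightarrow> bit"
  assumes "\<And>v. v \<noteq> {} \<Longrightarrow> v \<subseteq> \<Omega> \<Longrightarrow> (\<Sum>S\<in>ups \<Omega> v. A S) = 0" and "S \<noteq> {}" "S \<subseteq> \<Omega>"
  shows "A S = 0"
  using assms(2,3)
proof (induction "card (\<Omega> - S)" arbitrary: S rule: less_induct)
  case less
  have "0 = (\<Sum>S'\<in>ups \<Omega> S. A S')" using assms(1)[of S] less.prems by simp
  also have "\<dots> = A S + (\<Sum>S'\<in>ups \<Omega> S - {S}. A S')"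
    using less.prems by (intro sum.remove) (auto simp: ups_def)
  also have "(\<Sum>S'\<in>ups \<Omega> S - {S}. A S') = 0"
  proof (rule sum.neutral, rule ballI)
    fix S' assume S': "S' \<in> ups \<Omega> S - {S}"
    then have "card (\<Omega> - S') < card (\<Omega> - S)"
      by (intro psubset_card_mono) (auto simp: ups_def)
    then show "A S' = 0" using less S' by (auto simp: ups_def)
  qed
  finally show ?case by simp
qed

subsection \<open>Words over a star of letters\<close>

lemma wd_insert:
  fixes f :: "'i::finite \<Rightarrow> 'i set"
  assumes "clique c (f ` \<Omega>)" "good (replicate n c @ \<omega>)" "Ann (wt (replicate n c @ \<omega>)) M"
    and "R \<subseteq> \<Omega>" "x \<in> \<Omega>" "R \<noteq> {}" "card R < n"
  shows "M (wm (f x # map f (wd (n - 1) R)) h) = M (wm (map f (wd n (insert x R))) h)"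
proof -
  have 1: "set (wd (n - 1) R) = R" "length (wd (n - 1) R) = n - 1"
    using wd[of R "n - 1"] assms by auto
  have "card (insert x R) \<le> n" using assms(7) by (simp add: card_insert_if)
  then have 2: "set (wd n (insert x R)) = insert x R" "length (wd n (insert x R)) = n"
    using wd[of "insert x R" n] by auto
  show ?thesis
    using 1 2 assms by (intro clique_set[OF assms(1)]) (auto simp: Suc_diff_1)
qed

lemma wd_set:
  fixes f :: "'i::finite \<Rightarrow> 'i set"
  assumes "clique c (f ` \<Omega>)" "good (replicate (length u) c @ \<omega>)" "Ann (wt (replicate (length u) c @ \<omega>)) M"
    and "set u \<subseteq> \<Omega>" "u \<noteq> []"
  shows "M (wm (map f u) h) = M (wm (map f (wd (length u) (set u))) h)"
proof -
  have "set (wd (length u) (set u)) = set u" "length (wd (length u) (set u)) = length u"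
    using wd[of "set u" "length u"] assms(5) by (auto simp: card_length)
  then show ?thesis using assms by (intro clique_set[OF assms(1)]) auto
qed

lemma clique_singletons: "clique 1 ((\<lambda>a. {a}) ` (UNIV :: 'i::finite set))"
  by (auto simp: clique_def)

lemma clique_star: "clique 2 ((\<lambda>a. {i, a}) ` (- {i} :: 'i::finite set))"
  by (auto simp: clique_def card_insert_if)

lemma clique_star2: "i \<noteq> i' \<Longrightarrow> clique 3 ((\<lambda>a. {i, i', a}) ` (- {i, i'} :: 'i::finite set))"
  by (auto simp: clique_def card_insert_if)

subsection \<open>Separating the line\<close>

text \<open>Up to the omitted term, this superset sum is dual to the vector \<open>v\<close> by
  \<open>sum_ups_subset\<close>. The full set has five letters and cannot be spelled when
  \<open>t = 4\<close>.\<close>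

definition hp :: "nat \<Rightarrow> 'i::finite set \<Rightarrow> 'i pol" where
  "hp t v = (\<Sum>S\<in>ups UNIV v - {UNIV}. wm (map (\<lambda>a. {a}) (wd t S)) 1)"

definition mm :: "'i set \<Rightarrow> 'i" where
  "mm J = (SOME m. m \<notin> J)"

text \<open>The word on all five letters is left out of \<open>hp\<close>. The relations force its value to be that of
  \<open>hp t {m}\<close> for any \<open>m\<close> outside the preceding letter, whence the correction term.\<close>
definition tp :: "nat \<Rightarrow> 'i::finite set list \<Rightarrow> 'i set \<Rightarrow> 'i pol" where
  "tp t w v = wm w (hp t v + hp t {mm (last w)})"

lemma mm:
  assumes "J \<noteq> UNIV"
  shows "mm J \<notin> J"
  unfolding mm_def by (rule someI_ex) (use assms in auto)

context
  fixes t :: nat and L :: "'i::finite pol \<Rightarrow> bit"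
  assumes five: "card (UNIV :: 'i::finite set) = 5" and t: "4 \<le> t"
    and L: "Ann (wt (2 # replicate t 1)) L"
begin

abbreviation A1 :: "'i set \<Rightarrow> 'i set \<Rightarrow> bit" where
  "A1 J S \<equiv> if S = UNIV then 0 else L (wm (J # map (\<lambda>a. {a}) (wd t S)) 1)"

lemma good_21: "good (2 # replicate t 1)"
  unfolding good_def by (rule exI[of _ 0], rule exI[of _ 1], rule exI[of _ t]) (simp add: blocks_def)

lemma sum_A1: "(\<Sum>S\<in>ups UNIV v. A1 J S) = L (wm [J] (hp t v))"
proof -
  have "L (wm [J] (hp t v)) = (\<Sum>S\<in>ups UNIV v - {UNIV}. L (wm [J] (wm (map (\<lambda>a. {a}) (wd t S)) 1)))"
    unfolding hp_def by (rule additive.sum[OF additive_wm[OF AnnD(1)[OF L]]])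
  also have "\<dots> = (\<Sum>S\<in>ups UNIV v - {UNIV}. A1 J S)" by (rule sum.cong) auto
  also have "\<dots> = (\<Sum>S\<in>ups UNIV v. A1 J S)"
    by (rule sum.mono_neutral_left) auto
  finally show ?thesis by simp
qed

lemma A1_insert:
  assumes "card J = 2" "R \<noteq> {}" "card R \<le> 3"
  shows "L (wm (J # {x} # map (\<lambda>a. {a}) (wd (t - 1) R)) 1) = A1 J (insert x R)"
proof -
  have down: "good (replicate t 1 @ [])" "Ann (wt (replicate t 1 @ [])) (\<lambda>g. L (X J * g\<^sup>2))"
    using good_tl[OF good_21] good_Ann_down[OF good_21 L assms(1)] by auto
  have "card (insert x R) \<le> 4" using assms(3) by (simp add: card_insert_if)
  then have "insert x R \<noteq> UNIV" using five by auto
  then show ?thesis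
    using wd_insert[OF clique_singletons down, of R x 1] assms t by simp
qed

text \<open>A pair is exchanged with a single letter that is followed by a spelling of
  \<open>R\<close> in \<open>t - 1\<close> places; hence at most three elements in
  \<open>R\<close>.\<close>

lemma incidence_21:
  assumes "card I = 3" "R \<noteq> {}" "card R \<le> 3"
  shows "(\<Sum>i\<in>I. A1 (I - {i}) (insert i R)) = 0"
proof -
  have eq: "2 # replicate t 1 = 2 # 1 # replicate (t - 1) 1"
    using t by (cases t) auto
  have "(\<Sum>i\<in>I - {}. L (wm [I - {i}, insert i {}] (wm (map (\<lambda>a. {a}) (wd (t - 1) R)) 1))) = 0"
    by (rule word_exchange[OF good_21[unfolded eq] L[unfolded eq]]) (use assms in auto)
  then have "(\<Sum>i\<in>I. L (wm ((I - {i}) # {i} # map (\<lambda>a. {a}) (wd (t - 1) R)) 1)) = 0"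
    by simp
  moreover have "(\<Sum>i\<in>I. L (wm ((I - {i}) # {i} # map (\<lambda>a. {a}) (wd (t - 1) R)) 1))
    = (\<Sum>i\<in>I. A1 (I - {i}) (insert i R))"
    by (rule sum.cong[OF refl], rule A1_insert) (use assms in auto)
  ultimately show ?thesis by metis
qed

text \<open>The defect of \<open>incidence_21\<close> at the four-element set missing
  \<open>m\<close>, which \<open>t - 1\<close> places cannot spell when
  \<open>t = 4\<close>.\<close>

definition g21 :: "'i set \<Rightarrow> 'i \<Rightarrow> bit" where
  "g21 I m = (\<Sum>i\<in>I. A1 (I - {i}) (insert i (- {m})))"

text \<open>Sum \<open>incidence_21\<close> over the supersets \<open>R\<close> of \<open>v\<close>:
  up to three elements contribute 0, the full set contributes 0 by the convention in
  \<open>A1\<close>, and four elements contribute the defects.\<close>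

lemma hat_sum:
  assumes I: "card I = 3" and v: "v \<noteq> {}"
  shows "(\<Sum>i\<in>I. of_bool (i \<in> v) * L (wm [I - {i}] (hp t v))) = (\<Sum>m\<in>- v. g21 I m)"
proof -
  define E where "E = (\<lambda>R. \<Sum>i\<in>I. A1 (I - {i}) (insert i R))"
  have "(\<Sum>R\<in>ups UNIV v. E R) = (\<Sum>i\<in>I. \<Sum>R\<in>ups UNIV v. A1 (I - {i}) (insert i R))"
    unfolding E_def by (rule sum.swap)
  also have "\<dots> = (\<Sum>i\<in>I. of_bool (i \<in> v) * L (wm [I - {i}] (hp t v)))"
    by (rule sum.cong[OF refl], unfold sum_A1[symmetric], rule sum_ups_insert) simp
  finally have 1: "(\<Sum>R\<in>ups UNIV v. E R) = (\<Sum>i\<in>I. of_bool (i \<in> v) * L (wm [I - {i}] (hp t v)))" .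
  have "(\<Sum>R\<in>ups UNIV v. E R) = (\<Sum>R\<in>(\<lambda>m. - {m}) ` (- v). E R)"
  proof (rule sum.mono_neutral_right)
    show "(\<lambda>m. - {m}) ` (- v) \<subseteq> ups UNIV v" by (auto simp: ups_def)
    show "\<forall>R\<in>ups UNIV v - (\<lambda>m. - {m}) ` (- v). E R = 0"
    proof
      fix R assume R: "R \<in> ups UNIV v - (\<lambda>m. - {m}) ` (- v)"
      then have vR: "v \<subseteq> R" by (auto simp: ups_def)
      show "E R = 0"
      proof (cases "card R \<le> 3")
        case True
        then show ?thesis unfolding E_def using v vR by (intro incidence_21[OF I]) auto
      next
        case False
        have "card R \<noteq> 4"
        proof
          assume "card R = 4"
          then obtain m where "R = - {m}" using compl_eq_singleton[OF five] by blast
          with R vR show False by auto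
        qed
        moreover have "card R \<le> 5" using five card_mono[of UNIV R] by auto
        ultimately have "card R = card (UNIV :: 'i set)" using False five by linarith
        then have "R = UNIV" by (metis card_subset_eq finite subset_UNIV)
        then show ?thesis by (simp add: E_def)
      qed
    qed
  qed simp
  also have "\<dots> = (\<Sum>m\<in>- v. E (- {m}))"
    by (subst sum.reindex) (auto simp: inj_on_def)
  finally have "(\<Sum>R\<in>ups UNIV v. E R) = (\<Sum>m\<in>- v. g21 I m)" by (simp only: E_def g21_def)
  then show ?thesis unfolding 1 .
qed

text \<open>Once the values are corrected by the defects, this is the incidence relation between a
  vector and the 2x2 minors of a plane containing it. Testing \<open>hat_sum\<close> on nonempty
  sets disjoint from \<open>{i, j, k}\<close> shows that the defects outside
  \<open>{i, j, k}\<close> vanish and the other three add up to 0.\<close>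

lemma hat_relation:
  assumes D: "distinct [i, j, k]" and v: "v \<noteq> {}"
  shows "of_bool (i \<in> v) * (L (wm [{j, k}] (hp t v)) + g21 {i, j, k} i)
    + of_bool (j \<in> v) * (L (wm [{i, k}] (hp t v)) + g21 {i, j, k} j)
    + of_bool (k \<in> v) * (L (wm [{i, j}] (hp t v)) + g21 {i, j, k} k) = 0"
proof -
  let ?I = "{i, j, k}" let ?g = "g21 ?I" let ?h = "\<lambda>J. L (wm [J] (hp t v))"
  obtain l where l: "l \<notin> {i, j, k}" using ex_notin[OF five, of "[i, j, k]"] by auto
  obtain l' where l': "l' \<notin> {i, j, k, l}" using ex_notin[OF five, of "[i, j, k, l]"] by auto
  have D5: "distinct [i, j, k, l, l']" using D l l' by auto
  have U: "UNIV = {i, j, k, l, l'}" by (rule univ_5[OF D5 five])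
  have I: "card ?I = 3" using D by simp
  have diff: "?I - {i} = {j, k}" "?I - {j} = {i, k}" "?I - {k} = {i, j}" using D by auto
  have sum3: "(\<Sum>x\<in>?I. F x) = F i + (F j + F k)" for F :: "'i \<Rightarrow> bit" using D by simp
  have gs: "(\<Sum>m\<in>- w. ?g m) = 0" if "w \<noteq> {}" "w \<subseteq> {l, l'}" for w
  proof -
    have "(\<Sum>x\<in>?I. of_bool (x \<in> w) * L (wm [?I - {x}] (hp t w))) = 0"
      using that D5 by (intro sum.neutral) auto
    then show ?thesis using hat_sum[OF I that(1)] by simp
  qed
  have c: "- {l} = {i, j, k, l'}" "- {l'} = {i, j, k, l}" "- {l, l'} = {i, j, k}"
    using U D5 by auto
  have "?g i + (?g j + (?g k + ?g l')) = 0" "?g i + (?g j + (?g k + ?g l)) = 0" "?g i + (?g j + ?g k) = 0"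
    using gs[of "{l}"] gs[of "{l'}"] gs[of "{l, l'}"] D5 unfolding c by auto
  then have g: "?g l = 0" "?g l' = 0" "?g i + (?g j + ?g k) = 0"
    by (cases "?g i"; cases "?g j"; cases "?g k"; cases "?g l"; cases "?g l'"; simp)+
  have "(\<Sum>m\<in>- v. ?g m) = (\<Sum>m\<in>UNIV. if m \<in> v then 0 else ?g m)"
    by (rule sum.mono_neutral_cong_left) auto
  also have "\<dots> = of_bool (i \<notin> v) * ?g i + (of_bool (j \<notin> v) * ?g j + of_bool (k \<notin> v) * ?g k)"
    unfolding U using D5 g by auto
  finally have "of_bool (i \<in> v) * ?h {j, k} + (of_bool (j \<in> v) * ?h {i, k} + of_bool (k \<in> v) * ?h {i, j})
    = of_bool (i \<notin> v) * ?g i + (of_bool (j \<notin> v) * ?g j + of_bool (k \<notin> v) * ?g k)"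
    using hat_sum[OF I v] unfolding sum3 diff by simp
  moreover have "of_bool a * (p + x) + of_bool b * (q + y) + of_bool c * (r + z) = 0"
    if "of_bool a * p + (of_bool b * q + of_bool c * r)
      = of_bool (\<not> a) * x + (of_bool (\<not> b) * y + of_bool (\<not> c) * z)" "x + (y + z) = 0"
    for a b c and p q r x y z :: bit
    using that by (cases a; cases b; cases c; cases p; cases q; cases r; cases x; cases y; cases z) auto
  ultimately show ?thesis using g(3) by blast
qed

text \<open>Each value equals a defect \<open>g21 {i, j, k} i\<close> with \<open>i\<close> in the
  set; the set \<open>{i, i'}\<close> with \<open>i\<close> in \<open>v\<close> and
  \<open>i'\<close> in \<open>v'\<close> connects the two.\<close>

lemma hat_const:
  assumes J: "card J = 2" and "v \<noteq> {}" "v' \<noteq> {}" "v \<inter> J = {}" "v' \<inter> J = {}"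
  shows "L (wm [J] (hp t v)) = L (wm [J] (hp t v'))"
proof -
  obtain j k where jk: "J = {j, k}" "j \<noteq> k" using J by (auto simp: card_2_iff)
  have *: "L (wm [J] (hp t w)) = g21 {i, j, k} i" if "i \<in> w" "w \<inter> J = {}" for i w
  proof -
    have "distinct [i, j, k]" "j \<notin> w" "k \<notin> w" "w \<noteq> {}" using that jk by auto
    then show ?thesis using hat_relation[of i j k w] that jk by (auto simp: bit_add_eq_0_iff)
  qed
  obtain i i' where "i \<in> v" "i' \<in> v'" using assms by auto
  then have "{i, i'} \<inter> J = {}" using assms by auto
  then show ?thesis
    using *[OF \<open>i \<in> v\<close> assms(4)] *[OF \<open>i' \<in> v'\<close> assms(5)] *[of i "{i, i'}"] *[of i' "{i, i'}"] by simp
qed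

text \<open>By \<open>hat_const\<close> the terms \<open>hp t {m}\<close> evaluate to exactly the
  defects in \<open>hat_relation\<close>, so adding them, as \<open>tp\<close> does, absorbs the
  defects.\<close>

lemma hat_incidence:
  assumes D: "distinct [i, j, k]" and v: "i \<in> v"
    and m: "m1 \<notin> {j, k}" "m2 \<notin> {i, k}" "m3 \<notin> {i, j}"
  shows "L (wm [{j, k}] (hp t v + hp t {m1})) = of_bool (j \<in> v) * L (wm [{i, k}] (hp t v + hp t {m2}))
    + of_bool (k \<in> v) * L (wm [{i, j}] (hp t v + hp t {m3}))"
proof -
  have g: "L (wm [{y, z}] (hp t {m})) = g21 {x, y, z} x" if "distinct [x, y, z]" "m \<notin> {y, z}" for x y z m
  proof -
    have "L (wm [{y, z}] (hp t {m})) = L (wm [{y, z}] (hp t {x}))"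
      using that by (intro hat_const) auto
    also have "\<dots> = g21 {x, y, z} x"
      using hat_relation[of x y z "{x}"] that by (auto simp: bit_add_eq_0_iff)
    finally show ?thesis .
  qed
  have "L (wm [{j, k}] (hp t {m1})) = g21 {i, j, k} i" using D m by (intro g) auto
  moreover have "L (wm [{i, k}] (hp t {m2})) = g21 {i, j, k} j"
    using g[of j i k m2] D m by (auto simp: insert_commute)
  moreover have "L (wm [{i, j}] (hp t {m3})) = g21 {i, j, k} k"
    using g[of k i j m3] D m by (auto simp: insert_commute)
  moreover have "L (wm [J] (p + q)) = L (wm [J] p) + L (wm [J] q)" for J p q
    by (rule additive.add[OF additive_wm[OF AnnD(1)[OF L]]])
  moreover have "p + x = of_bool b * (q + y) + of_bool c * (r + z)"
    if "of_bool (i \<in> v) * (p + x) + of_bool b * (q + y) + of_bool c * (r + z) = 0"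
    for b c and p q r x y z :: bit
    using that v by (cases b; cases c; cases p; cases q; cases r; cases x; cases y; cases z) auto
  moreover have "v \<noteq> {}" using v by auto
  ultimately show ?thesis
    using hat_relation[OF D, of v] by presburger
qed

end

subsection \<open>Separating the plane\<close>

lemma good_2s1t: "good (replicate s 2 @ replicate t 1)"
  unfolding good_def by (rule exI[of _ 0], rule exI[of _ s], rule exI[of _ t]) (simp add: blocks_def)

lemma map_card_replicate: "(\<forall>A\<in>set w. card A = a) \<Longrightarrow> map card w = replicate (length w) a"
  by (induction w) auto

context
  fixes s t :: nat and L :: "'i::finite pol \<Rightarrow> bit"
  assumes five: "card (UNIV :: 'i::finite set) = 5" and t: "4 \<le> t"
    and L: "Ann (wt (replicate s 2 @ replicate t 1)) L"
begin

lemma Ann_prefix: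
  assumes "\<forall>A\<in>set w. card A = 2" "length w + n = s"
  shows "Ann (wt (replicate n 2 @ replicate t 1)) (\<lambda>g. L (wm w g))"
proof -
  have "replicate s 2 @ replicate t 1 = map card w @ (replicate n 2 @ replicate t (1::nat))"
    using assms map_card_replicate[of w 2] by (simp flip: replicate_add append_assoc)
  then show ?thesis using Ann_wm[of w "replicate n 2 @ replicate t 1" L] L good_2s1t[of s t] by metis
qed

text \<open>Frees the correction term from the choice in \<open>mm\<close>; words with different
  last letters can then share one \<open>m\<close>.\<close>

lemma tp_eq:
  assumes w: "\<forall>A\<in>set w. card A = 2" "length w = s" "w \<noteq> []" and m: "m \<notin> last w"
  shows "L (tp t w v) = L (wm w (hp t v + hp t {m}))"
proof -
  obtain w0 J where w0: "w = w0 @ [J]" using w(3) by (metis rev_exhaust)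
  then have J: "card J = 2" "m \<notin> J" using w m by auto
  have "J \<noteq> UNIV" using J five by auto
  have Lq: "Ann (wt (2 # replicate t 1)) (\<lambda>g. L (wm w0 g))"
    using Ann_prefix[of w0 1] w w0 by auto
  have add: "L (wm w (p + q)) = L (wm w p) + L (wm w q)" for p q
    by (rule additive.add[OF additive_wm[OF AnnD(1)[OF L]]])
  have "L (wm w0 (wm [J] (hp t {mm J}))) = L (wm w0 (wm [J] (hp t {m})))"
    using J mm[OF \<open>J \<noteq> UNIV\<close>] by (intro hat_const[OF five t Lq]) auto
  then have "L (wm w (hp t {mm J})) = L (wm w (hp t {m}))" by (simp add: w0 wm_append)
  then show ?thesis unfolding tp_def add by (simp add: w0)
qed

lemma tp_last:
  assumes w: "\<forall>A\<in>set w. card A = 2" "Suc (length w) = s" and D: "distinct [i, j, k]" and v: "i \<in> v"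
  shows "L (tp t (w @ [{j, k}]) v) = of_bool (j \<in> v) * L (tp t (w @ [{i, k}]) v)
    + of_bool (k \<in> v) * L (tp t (w @ [{i, j}]) v)"
proof -
  have Lq: "Ann (wt (2 # replicate t 1)) (\<lambda>g. L (wm w g))"
    using Ann_prefix[of w 1] w by auto
  have "{j, k} \<noteq> UNIV" "{i, k} \<noteq> UNIV" "{i, j} \<noteq> UNIV"
    using five D by (metis card_2_iff numeral_eq_iff num.distinct(5) num.distinct(3) semiring_norm(88,89) distinct_length_2_or_more)+
  note m = this[THEN mm]
  show ?thesis
    using hat_incidence[OF five t Lq D v m] by (simp add: tp_def wm_append)
qed

text \<open>The words in an exchange relation may differ in their last letter, but these letters lie
  in one set \<open>S\<close> of at most four points, so a single correction term serves them
  all.\<close>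

lemma common_missing:
  assumes w2: "\<forall>A\<in>set w2. card A = 2" and "card S \<le> 4"
  obtains m :: 'i where "\<And>A B. B \<subseteq> S \<Longrightarrow> m \<notin> last (w1 @ [A, B] @ w2)"
proof (cases "w2 = []")
  case True
  have "S \<noteq> UNIV" using assms(2) five by auto
  then obtain m where "m \<notin> S" by auto
  then show ?thesis using True by (intro that[of m]) auto
next
  case False
  then have "card (last w2) = 2" using w2 by auto
  then have "last w2 \<noteq> UNIV" using five by auto
  then obtain m where "m \<notin> last w2" by auto
  then show ?thesis using False by (intro that[of m]) auto
qed

lemma tp_swap:
  assumes w: "\<forall>A\<in>set w1. card A = 2" "\<forall>A\<in>set w2. card A = 2" "length w1 + 2 + length w2 = s"
    and D: "distinct [i, j, k]"
  shows "L (tp t (w1 @ [{i, j}, {i, k}] @ w2) v) = L (tp t (w1 @ [{i, k}, {i, j}] @ w2) v)"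
proof -
  have "card {i, j, k} \<le> 4" using D by simp
  from common_missing[OF w(2) this] obtain m where
    m: "\<And>A B. B \<subseteq> {i, j, k} \<Longrightarrow> m \<notin> last (w1 @ [A, B] @ w2)" by metis
  let ?h = "wm w2 (hp t v + hp t {m})"
  have Ann: "Ann (wt (2 # 2 # replicate (length w2) 2 @ replicate t 1)) (\<lambda>g. L (wm w1 g))"
    using Ann_prefix[of w1 "Suc (Suc (length w2))"] w by auto
  have good: "good (2 # 2 # replicate (length w2) 2 @ replicate t 1)"
    using good_2s1t[of "Suc (Suc (length w2))" t] by simp
  have "L (wm w1 (wm [{i, j}, {i, k}] ?h)) = L (wm w1 (wm [{i, k}, {i, j}] ?h))"
    using word_swap[OF good Ann, of "{i}" j k ?h] D by (auto simp: insert_commute)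
  then show ?thesis
    using w D by (subst (1 2) tp_eq[where m = m]) (auto simp: wm_append m[of "{i, k}", simplified] m[of "{i, j}", simplified])
qed

text \<open>The quadratic Pluecker relation for 2x2 minors.\<close>

lemma tp_three:
  assumes w: "\<forall>A\<in>set w1. card A = 2" "\<forall>A\<in>set w2. card A = 2" "length w1 + 2 + length w2 = s"
    and D: "distinct [i, j, k, l]"
  shows "L (tp t (w1 @ [{j, k}, {i, l}] @ w2) v) + L (tp t (w1 @ [{i, k}, {j, l}] @ w2) v)
    + L (tp t (w1 @ [{i, j}, {k, l}] @ w2) v) = 0"
proof -
  have "card {i, j, k, l} \<le> 4" using D by simp
  from common_missing[OF w(2) this] obtain m where
    m: "\<And>A B. B \<subseteq> {i, j, k, l} \<Longrightarrow> m \<notin> last (w1 @ [A, B] @ w2)" by metis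
  let ?h = "wm w2 (hp t v + hp t {m})"
  have Ann: "Ann (wt (2 # 2 # replicate (length w2) 2 @ replicate t 1)) (\<lambda>g. L (wm w1 g))"
    using Ann_prefix[of w1 "Suc (Suc (length w2))"] w by auto
  have good: "good (2 # 2 # replicate (length w2) 2 @ replicate t 1)"
    using good_2s1t[of "Suc (Suc (length w2))" t] by simp
  have "L (wm w1 (wm [{j, k}, {i, l}] ?h)) + L (wm w1 (wm [{i, k}, {j, l}] ?h)) + L (wm w1 (wm [{i, j}, {k, l}] ?h)) = 0"
    using exch_3[OF exch_word[OF good Ann, of ?h], of "{}" "{l}" i j k] D by auto
  then show ?thesis
    using w D
    by (subst (1 2 3) tp_eq[where m = m])
      (auto simp: wm_append m[of "{i, l}", simplified] m[of "{j, l}", simplified] m[of "{k, l}", simplified])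
qed

text \<open>\<open>tp_last\<close> is carried to the left past the star letters. If \<open>l\<close>
  is neither \<open>j\<close> nor \<open>k\<close>, \<open>tp_three\<close> moves the letter outside
  the star one place to the right, where the induction hypothesis applies; the two mixed terms agree
  by \<open>tp_swap\<close> and cancel.\<close>

lemma tp_star_move:
  assumes "\<forall>A\<in>set w. card A = 2" "length w + 1 + length us = s" "i \<notin> set us"
    and D: "distinct [i, j, k]" and v: "i \<in> v"
  shows "L (tp t (w @ [{j, k}] @ map (\<lambda>a. {i, a}) us) v)
    = of_bool (j \<in> v) * L (tp t (w @ [{i, k}] @ map (\<lambda>a. {i, a}) us) v)
    + of_bool (k \<in> v) * L (tp t (w @ [{i, j}] @ map (\<lambda>a. {i, a}) us) v)"
  using assms(1-3) D
proof (induction us arbitrary: w j k)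
  case Nil
  then show ?case using tp_last[of w i j k v] v by simp
next
  case (Cons l us)
  let ?f = "\<lambda>a. {i, a}" let ?u = "map ?f us"
  have il: "i \<noteq> l" and us2: "\<forall>A\<in>set ?u. card A = 2" using Cons.prems by (auto simp: card_insert_if)
  have len: "length w + 2 + length ?u = s" using Cons.prems by simp
  note w = Cons.prems(1)
  have IH: "L (tp t (w @ [A, {x, y}] @ ?u) v)
    = of_bool (x \<in> v) * L (tp t (w @ [A, {i, y}] @ ?u) v) + of_bool (y \<in> v) * L (tp t (w @ [A, {i, x}] @ ?u) v)"
    if "card A = 2" "distinct [i, x, y]" for A x y
    using Cons.IH[of "w @ [A]" x y] Cons.prems that by simp
  have sw: "L (tp t (w @ [{i, x}, {i, y}] @ ?u) v) = L (tp t (w @ [{i, y}, {i, x}] @ ?u) v)"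
    if "i \<noteq> x" "i \<noteq> y" for x y
    using tp_swap[OF w us2 len, of i x y v] that by (cases "x = y") auto
  \<comment> \<open>Letters sharing \<open>l\<close> may be swapped, which also moves the one
    outside the star to the right.\<close>
  have adj: "L (tp t (w @ [{x, l}, {i, l}] @ ?u) v)
    = of_bool (x \<in> v) * L (tp t (w @ [{i, l}, {i, l}] @ ?u) v) + of_bool (l \<in> v) * L (tp t (w @ [{i, x}, {i, l}] @ ?u) v)"
    if "distinct [i, x, l]" for x
  proof -
    have "L (tp t (w @ [{x, l}, {i, l}] @ ?u) v) = L (tp t (w @ [{i, l}, {x, l}] @ ?u) v)"
      using tp_swap[OF w us2 len, of l x i v] that by (auto simp: insert_commute)
    also have "\<dots> = of_bool (x \<in> v) * L (tp t (w @ [{i, l}, {i, l}] @ ?u) v)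
        + of_bool (l \<in> v) * L (tp t (w @ [{i, l}, {i, x}] @ ?u) v)"
      using il that by (intro IH) auto
    finally show ?thesis using sw[of l x] il that by auto
  qed
  consider "l = k" | "l = j" | "l \<noteq> j" "l \<noteq> k" by blast
  then have "L (tp t (w @ [{j, k}, {i, l}] @ ?u) v)
    = of_bool (j \<in> v) * L (tp t (w @ [{i, k}, {i, l}] @ ?u) v) + of_bool (k \<in> v) * L (tp t (w @ [{i, j}, {i, l}] @ ?u) v)"
  proof cases
    case 1
    then show ?thesis using adj[of j] Cons.prems(4) by simp
  next
    case 2
    then show ?thesis using adj[of k] Cons.prems(4) by (auto simp: insert_commute add.commute)
  next
    case 3
    then have D4: "distinct [i, j, k, l]" using il Cons.prems(4) by auto
    have "L (tp t (w @ [{i, k}, {j, l}] @ ?u) v)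
      = of_bool (j \<in> v) * L (tp t (w @ [{i, k}, {i, l}] @ ?u) v) + of_bool (l \<in> v) * L (tp t (w @ [{i, k}, {i, j}] @ ?u) v)"
      using D4 by (intro IH) auto
    moreover have "L (tp t (w @ [{i, j}, {k, l}] @ ?u) v)
      = of_bool (k \<in> v) * L (tp t (w @ [{i, j}, {i, l}] @ ?u) v) + of_bool (l \<in> v) * L (tp t (w @ [{i, k}, {i, j}] @ ?u) v)"
      using IH[of "{i, j}" k l] sw[of j k] D4 by auto
    moreover have "a = p + r" if "a + b + c = 0" "b = p + q" "c = r + q" for a b c p q r :: bit
      using that by (cases a; cases p; cases q; cases r) auto
    ultimately show ?thesis using tp_three[OF w us2 len D4, of v] by blast
  qed
  then show ?case by simp
qed

text \<open>Letters are turned into star letters from right to left, so that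
  \<open>tp_star_move\<close> always finds a star word behind the letter at hand.\<close>

lemma tp_all:
  assumes v: "i \<in> v"
    and star: "\<And>us. length us = s \<Longrightarrow> i \<notin> set us \<Longrightarrow> L (tp t (map (\<lambda>a. {i, a}) us) v) = 0"
    and w: "\<forall>A\<in>set w. card A = 2" "length w = s"
  shows "L (tp t w v) = 0"
proof -
  have "L (tp t (w @ map (\<lambda>a. {i, a}) us) v) = 0"
    if "\<forall>A\<in>set w. card A = 2" "length w + length us = s" "i \<notin> set us" for w us
    using that
  proof (induction w arbitrary: us rule: rev_induct)
    case Nil
    then show ?case using star by simp
  next
    case (snoc J w)
    have IH: "L (tp t (w @ [{i, a}] @ map (\<lambda>a. {i, a}) us) v) = 0" if "a \<noteq> i" for a
      using snoc.IH[of "a # us"] snoc.prems that by auto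
    obtain j k where J: "J = {j, k}" "j \<noteq> k" using snoc.prems(1) by (auto simp: card_2_iff)
    consider "j = i" | "k = i" | "distinct [i, j, k]" using J by auto
    then show ?case
    proof cases
      case 1
      then show ?thesis using IH[of k] J by simp
    next
      case 2
      then show ?thesis using IH[of j] J by (simp add: insert_commute)
    next
      case 3
      then show ?thesis
        using tp_star_move[of w us i j k v] snoc.prems IH[of j] IH[of k] v J by auto
    qed
  qed
  from this[of w "[]"] show ?thesis using w by simp
qed

text \<open>With one \<open>m\<close> outside both last letters the correction term becomes a common
  tail, and \<open>clique_set\<close> applies.\<close>

lemma tp_star_set:
  assumes "set us = set us'" "length us = s" "length us' = s" "i \<notin> set us" "us \<noteq> []"
  shows "L (tp t (map (\<lambda>a. {i, a}) us) v) = L (tp t (map (\<lambda>a. {i, a}) us') v)"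
proof -
  let ?f = "\<lambda>a. {i, a}"
  have ne: "us' \<noteq> []" using assms by auto
  obtain m where m: "m \<notin> {i, last us, last us'}" using ex_notin[OF five, of "[i, last us, last us']"] by auto
  have l: "last (map ?f us) = {i, last us}" "last (map ?f us') = {i, last us'}"
    using assms(5) ne by (auto simp: last_map)
  have c2: "\<forall>A\<in>set (map ?f us). card A = 2" "\<forall>A\<in>set (map ?f us'). card A = 2"
    using assms(1,4) by (auto simp: card_insert_if)
  have "L (wm (map ?f us) (hp t v + hp t {m})) = L (wm (map ?f us') (hp t v + hp t {m}))"
    using assms L good_2s1t[of s t] by (intro clique_set[OF clique_star[of i]]) auto
  then show ?thesis
    using tp_eq[OF c2(1), of m v] tp_eq[OF c2(2), of m v] assms(2,3,5) ne m l by auto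
qed

end

text \<open>\<open>z\<close> represents a second vector modulo \<open>v\<close>, normalised to
  vanish at the pivot \<open>i\<close>; hence the sets range over the complement of
  \<open>i\<close>.\<close>

definition up :: "nat \<Rightarrow> nat \<Rightarrow> 'i::finite \<Rightarrow> 'i set \<Rightarrow> 'i set \<Rightarrow> 'i pol" where
  "up s t i z v = (\<Sum>S\<in>ups (- {i}) z. tp t (map (\<lambda>a. {i, a}) (wd s S)) v)"

text \<open>The 2x2 minor of \<open>v\<close> and \<open>z\<close> in the columns \<open>a\<close>
  and \<open>j\<close>.\<close>

definition qv :: "'i set \<Rightarrow> 'i set \<Rightarrow> 'i \<Rightarrow> 'i \<Rightarrow> bit" where
  "qv v z a j = of_bool (a \<in> v) * of_bool (j \<in> z) + of_bool (j \<in> v) * of_bool (a \<in> z)"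

lemma card_compl_le_4:
  assumes "card (UNIV :: 'i::finite set) = 5" "S \<subseteq> - {i :: 'i::finite}"
  shows "card S \<le> 4" "S \<noteq> - {i} \<Longrightarrow> card S \<le> 3"
proof -
  have c: "card (- {i}) = 4" using assms(1) by (simp add: card_compl_finite)
  then show "card S \<le> 4" using assms(2) by (metis card_mono finite)
  show "card S \<le> 3" if "S \<noteq> - {i}"
  proof -
    have "S \<subset> - {i}" using assms(2) that by blast
    from psubset_card_mono[OF finite this] show ?thesis using c by simp
  qed
qed

context
  fixes s t :: nat and L :: "'i::finite pol \<Rightarrow> bit" and i :: 'i and v :: "'i set"
  assumes five: "card (UNIV :: 'i::finite set) = 5" and s: "4 \<le> s" and t: "4 \<le> t"
    and L: "Ann (wt (3 # replicate s 2 @ replicate t 1)) L" and i: "i \<in> v"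
begin

abbreviation U3 :: "'i set \<Rightarrow> 'i set \<Rightarrow> bit" where
  "U3 T z \<equiv> L (wm [T] (up s t i z v))"

definition D3 :: "'i set \<Rightarrow> 'i set \<Rightarrow> bit" where
  "D3 T S = L (wm [T] (tp t (map (\<lambda>a. {i, a}) (wd s S)) v))"

lemma good_32: "good (3 # replicate s 2 @ replicate t 1)"
  unfolding good_def
  by (rule exI[of _ 1], rule exI[of _ s], rule exI[of _ t]) (use s t in \<open>simp add: blocks_def\<close>)

lemma sum_D3: "(\<Sum>S\<in>ups (- {i}) z. D3 T S) = U3 T z"
  unfolding D3_def up_def by (rule additive.sum[OF additive_wm[OF AnnD(1)[OF L]], symmetric])

lemma Ann_T: "card T = 3 \<Longrightarrow> Ann (wt (replicate s 2 @ replicate t 1)) (\<lambda>g. L (wm [T] g))"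
  using good_Ann_down[OF good_32 L, of T] by simp

lemma D3_insert:
  assumes T: "card T = 3" and R: "R \<noteq> {}" "R \<subseteq> - {i}" "card R \<le> 3" and x: "x \<noteq> i"
  shows "L (wm [T] (tp t ({i, x} # map (\<lambda>a. {i, a}) (wd (s - 1) R)) v)) = D3 T (insert x R)"
proof -
  have 1: "set (wd (s - 1) R) = R" "length (wd (s - 1) R) = s - 1"
    using wd[of R "s - 1"] R s by auto
  have "card (insert x R) \<le> s" using R(3) s by (simp add: card_insert_if)
  then have 2: "set (wd s (insert x R)) = insert x R" "length (wd s (insert x R)) = s"
    using wd[of "insert x R" s] by auto
  show ?thesis
    using tp_star_set[OF five t Ann_T[OF T], of "x # wd (s - 1) R" "wd s (insert x R)" i v] 1 2 R x s
    by (auto simp: D3_def)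
qed

text \<open>The value 0 at \<open>x = i\<close> stands for a minor with column \<open>i\<close>
  repeated; it makes the expansion in \<open>D3_pair\<close> uniform in \<open>a\<close> and
  \<open>j\<close>.\<close>

definition D3' :: "'i set \<Rightarrow> 'i \<Rightarrow> 'i set \<Rightarrow> bit" where
  "D3' T x R = (if x = i then 0 else D3 T (insert x R))"

lemma D3_pair:
  assumes T: "card T = 3" and R: "R \<noteq> {}" "R \<subseteq> - {i}" "card R \<le> 3" and aj: "a \<noteq> j"
  shows "L (wm [T] (tp t ({a, j} # map (\<lambda>a. {i, a}) (wd (s - 1) R)) v))
    = of_bool (a \<in> v) * D3' T j R + of_bool (j \<in> v) * D3' T a R"
proof -
  have 1: "set (wd (s - 1) R) = R" "length (wd (s - 1) R) = s - 1"
    using wd[of R "s - 1"] R s by auto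
  note D = D3_insert[OF T R]
  consider "a = i" | "j = i" | "distinct [i, a, j]" using aj by auto
  then show ?thesis
  proof cases
    case 1
    then show ?thesis using D[of j] aj i by (auto simp: D3'_def)
  next
    case 2
    then show ?thesis using D[of a] aj i by (auto simp: D3'_def insert_commute)
  next
    case 3
    then show ?thesis
      using tp_star_move[OF five t Ann_T[OF T], of "[]" "wd (s - 1) R" i a j v] D[of a] D[of j] 1 R s i
      by (auto simp: D3'_def)
  qed
qed

lemma sum_D3':
  assumes "i \<notin> z"
  shows "(\<Sum>R\<in>ups (- {i}) z. D3' T x R) = of_bool (x \<in> z) * U3 T z"
proof (cases "x = i")
  case True
  then show ?thesis using assms by (simp add: D3'_def)
next
  case False
  then show ?thesis using sum_ups_insert[of x "- {i}" "D3 T" z] by (simp add: D3'_def sum_D3)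
qed

definition F3 :: "'i set \<Rightarrow> 'i \<Rightarrow> 'i set \<Rightarrow> bit" where
  "F3 I j R = (\<Sum>a\<in>I - {j}. of_bool (a \<in> v) * D3' (I - {a}) j R + of_bool (j \<in> v) * D3' (I - {a}) a R)"

lemma F3_eq_0:
  assumes I: "card I = 4" and R: "R \<noteq> {}" "R \<subseteq> - {i}" "R \<noteq> - {i}"
  shows "F3 I j R = 0"
proof -
  have R3: "card R \<le> 3" using card_compl_le_4[OF five R(2)] R(3) by auto
  have wdR: "set (wd (s - 1) R) = R" "length (wd (s - 1) R) = s - 1"
    using wd[of R "s - 1"] R R3 s by auto
  have ne: "wd (s - 1) R \<noteq> []" using wdR(1) R(1) set_empty by metis
  let ?w = "map (\<lambda>a. {i, a}) (wd (s - 1) R)"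
  \<comment> \<open>The tail is nonempty, so all words in the sum end alike and have the same
    correction term.\<close>
  let ?h = "wm ?w (hp t v + hp t {mm (last ?w)})"
  have eq: "3 # replicate s 2 @ replicate t 1 = 3 # 2 # replicate (s - 1) 2 @ replicate t 1"
    using s by (cases s) auto
  have *: "(\<Sum>a\<in>I - {j}. L (wm [I - {a}, insert a {j}] ?h)) = 0"
    by (rule word_exchange[OF good_32[unfolded eq] L[unfolded eq]]) (use I in auto)
  have "L (wm [I - {a}, insert a {j}] ?h)
      = of_bool (a \<in> v) * D3' (I - {a}) j R + of_bool (j \<in> v) * D3' (I - {a}) a R" if "a \<in> I - {j}" for a
  proof -
    have "L (wm [I - {a}, insert a {j}] ?h) = L (wm [I - {a}] (tp t ({a, j} # ?w) v))"
      using ne by (simp add: tp_def)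
    also have "\<dots> = of_bool (a \<in> v) * D3' (I - {a}) j R + of_bool (j \<in> v) * D3' (I - {a}) a R"
      using that I R R3 by (intro D3_pair) auto
    finally show ?thesis .
  qed
  then have "(\<Sum>a\<in>I - {j}. L (wm [I - {a}, insert a {j}] ?h)) = F3 I j R"
    unfolding F3_def by (rule sum.cong[OF refl])
  with * show ?thesis by simp
qed

text \<open>Only the full set \<open>- {i}\<close> survives the sum over \<open>R\<close>, so the
  right-hand side does not mention \<open>z\<close> and can be computed from any convenient
  \<open>z\<close>.\<close>

lemma incidence_const:
  assumes I: "card I = 4" and z: "z \<noteq> {}" "i \<notin> z"
  shows "(\<Sum>a\<in>I - {j}. qv v z a j * U3 (I - {a}) z) = F3 I j (- {i})"
proof -
  have "(\<Sum>R\<in>ups (- {i}) z. F3 I j R) = (\<Sum>R\<in>{- {i}}. F3 I j R)"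
  proof (rule sum.mono_neutral_right)
    show "{- {i}} \<subseteq> ups (- {i}) z" using z by (auto simp: ups_def)
    show "\<forall>R\<in>ups (- {i}) z - {- {i}}. F3 I j R = 0"
      using z by (intro ballI F3_eq_0[OF I]) (auto simp: ups_def)
  qed simp
  moreover have "(\<Sum>R\<in>ups (- {i}) z. F3 I j R) = (\<Sum>a\<in>I - {j}. qv v z a j * U3 (I - {a}) z)"
  proof -
    have "(\<Sum>R\<in>ups (- {i}) z. F3 I j R) = (\<Sum>a\<in>I - {j}. \<Sum>R\<in>ups (- {i}) z.
        of_bool (a \<in> v) * D3' (I - {a}) j R + of_bool (j \<in> v) * D3' (I - {a}) a R)"
      unfolding F3_def by (rule sum.swap)
    also have "\<dots> = (\<Sum>a\<in>I - {j}. qv v z a j * U3 (I - {a}) z)"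
    proof (rule sum.cong[OF refl])
      fix a
      have "(\<Sum>R\<in>ups (- {i}) z. of_bool (a \<in> v) * D3' (I - {a}) j R + of_bool (j \<in> v) * D3' (I - {a}) a R)
        = of_bool (a \<in> v) * (of_bool (j \<in> z) * U3 (I - {a}) z) + of_bool (j \<in> v) * (of_bool (a \<in> z) * U3 (I - {a}) z)"
        by (simp only: sum.distrib sum_distrib_left[symmetric] sum_D3'[OF z(2)])
      then show "(\<Sum>R\<in>ups (- {i}) z. of_bool (a \<in> v) * D3' (I - {a}) j R + of_bool (j \<in> v) * D3' (I - {a}) a R)
        = qv v z a j * U3 (I - {a}) z"
        by (simp only: qv_def distrib_right mult.assoc)
    qed
    finally show ?thesis .
  qed
  ultimately show ?thesis by simp
qed

lemma incidence_const_eq_0I: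
  assumes I: "card I = 4" and z: "z \<noteq> {}" "i \<notin> z" and "\<And>a. a \<in> I \<Longrightarrow> a \<noteq> j \<Longrightarrow> qv v z a j = 0"
  shows "F3 I j (- {i}) = 0"
  unfolding incidence_const[OF I z, symmetric] using assms(4) by (intro sum.neutral) auto

lemma card_compl_1: "card (- {m :: 'i}) = 4"
  using five by (simp add: card_compl_finite)

text \<open>Choose \<open>z\<close> so that all minors in question vanish: a point other than
  \<open>j\<close> when \<open>j\<close> is not in \<open>v\<close>; the point \<open>m\<close>,
  which is absent from \<open>- {m}\<close>; or, for \<open>m = i\<close>, the set
  \<open>v - {i}\<close>, which agrees with \<open>v\<close> on all columns left.\<close>

lemma incidence_const_off:
  assumes "j \<notin> v \<or> m \<noteq> j"
  shows "F3 (- {m}) j (- {i}) = 0"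
proof -
  consider "j \<notin> v" | "j \<in> v" "m \<noteq> j" "m \<noteq> i" | "j \<in> v" "m \<noteq> j" "m = i" using assms by blast
  then show ?thesis
  proof cases
    case 1
    obtain x where "x \<notin> {i, j}" using ex_notin[OF five, of "[i, j]"] by auto
    then show ?thesis
      using 1 by (intro incidence_const_eq_0I[OF card_compl_1, of "{x}"]) (auto simp: qv_def)
  next
    case 2
    then show ?thesis
      by (intro incidence_const_eq_0I[OF card_compl_1, of "{m}"]) (auto simp: qv_def)
  next
    case 3
    then show ?thesis
      by (intro incidence_const_eq_0I[OF card_compl_1, of "v - {i}"]) (auto simp: qv_def)
  qed
qed

text \<open>For \<open>z = {x}\<close> the minor is nonzero only at \<open>a = x\<close>. The result
  no longer mentions \<open>j\<close>, which allows comparing different members of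
  \<open>v\<close>.\<close>

lemma incidence_single:
  assumes "x \<noteq> i" "x \<noteq> m" "x \<noteq> j" "j \<in> v"
  shows "F3 (- {m}) j (- {i}) = U3 (- {m} - {x}) {x}"
proof -
  have "F3 (- {m}) j (- {i}) = (\<Sum>a\<in>- {m} - {j}. qv v {x} a j * U3 (- {m} - {a}) {x})"
    using assms by (intro incidence_const[OF card_compl_1, symmetric]) auto
  also have "\<dots> = (\<Sum>a\<in>{x}. qv v {x} a j * U3 (- {m} - {a}) {x})"
    using assms by (intro sum.mono_neutral_right) (auto simp: qv_def)
  finally show ?thesis using assms by (simp add: qv_def)
qed

text \<open>Left over is \<open>m = j\<close> in \<open>v\<close>. If \<open>v\<close> has a second
  member, \<open>incidence_single\<close> switches to it, and then \<open>m\<close> differs from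
  \<open>j\<close>; if \<open>v = {i}\<close>, the relation at a point \<open>x\<close> outside
  \<open>v\<close> reduces to the same single value.\<close>

lemma incidence_const_0: "F3 (- {m}) j (- {i}) = 0"
proof (cases "j \<in> v \<and> m = j")
  case False
  then show ?thesis by (intro incidence_const_off) auto
next
  case True
  then have j: "j \<in> v" and m: "m = j" by auto
  show ?thesis
  proof (cases "j = i")
    case False
    obtain x where x: "x \<notin> {i, j}" using ex_notin[OF five, of "[i, j]"] by auto
    have "F3 (- {j}) j (- {i}) = F3 (- {j}) i (- {i})"
      using incidence_single[of x j j] incidence_single[of x j i] x j i by auto
    also have "\<dots> = 0" using False by (intro incidence_const_off) auto
    finally show ?thesis unfolding m .
  next
    case ji: True
    show ?thesis
    proof (cases "v = {i}")
      case True
      obtain x where x: "x \<notin> {i}" using ex_notin[OF five, of "[i]"] by auto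
      have "F3 (- {x}) x (- {i}) = 0" using True x by (intro incidence_const_off) auto
      moreover have "F3 (- {x}) x (- {i}) = (\<Sum>a\<in>- {x} - {x}. qv v {x} a x * U3 (- {x} - {a}) {x})"
        using x by (intro incidence_const[OF card_compl_1, symmetric]) auto
      moreover have "\<dots> = (\<Sum>a\<in>{i}. qv v {x} a x * U3 (- {x} - {a}) {x})"
        using x True by (intro sum.mono_neutral_right) (auto simp: qv_def)
      moreover have "- {x} - {i} = - {i} - {x}" by auto
      ultimately have "U3 (- {i} - {x}) {x} = 0" using x True by (simp add: qv_def)
      then show ?thesis using incidence_single[of x i i] x i m ji by auto
    next
      case False
      then obtain c where c: "c \<in> v" "c \<noteq> i" using i by auto
      obtain x where x: "x \<notin> {i, c}" using ex_notin[OF five, of "[i, c]"] by auto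
      have "F3 (- {i}) i (- {i}) = F3 (- {i}) c (- {i})"
        using incidence_single[of x i i] incidence_single[of x i c] x c i by auto
      also have "\<dots> = 0" using c by (intro incidence_const_off) auto
      finally show ?thesis unfolding m ji .
    qed
  qed
qed

text \<open>The incidence relation between the plane of \<open>v\<close> and \<open>z\<close> and
  the 3x3 minors of a space containing it.\<close>

lemma incidence_32:
  assumes I: "card I = 4" and z: "z \<noteq> {}" "i \<notin> z"
  shows "(\<Sum>a\<in>I - {j}. qv v z a j * U3 (I - {a}) z) = 0"
proof -
  obtain m where "I = - {m}" using compl_eq_singleton[OF five I] .
  then show ?thesis using incidence_const[OF I z, of j] incidence_const_0[of m j] by simp
qed

text \<open>The minor of \<open>v\<close> and \<open>z\<close> in the columns \<open>i\<close> and
  \<open>i'\<close> is 1, since \<open>z\<close> vanishes at \<open>i\<close>. So the incidence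
  relation expresses a triple that misses a pivot through triples that contain it, first for
  \<open>i'\<close> and then for \<open>i\<close>.\<close>

lemma linear_32:
  assumes z: "i' \<in> z" "i \<notin> z" and star: "\<And>k. k \<notin> {i, i'} \<Longrightarrow> U3 {i, i', k} z = 0"
    and T: "card T = 3"
  shows "U3 T z = 0"
proof -
  have ii: "i \<noteq> i'" using z by auto
  have zne: "z \<noteq> {}" using z by auto
  have both: "U3 T z = 0" if "card T = 3" "i \<in> T" "i' \<in> T" for T
  proof -
    have "card (T - {i, i'}) = 1" using that ii by (simp add: card_Diff_subset)
    then obtain k where "T - {i, i'} = {k}" by (rule card_1_singletonE)
    then have "T = {i, i', k}" "k \<notin> {i, i'}" using that by auto
    then show ?thesis using star by simp
  qed
  have with_i: "U3 T z = 0" if T: "card T = 3" "i \<in> T" for T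
  proof (cases "i' \<in> T")
    case True
    then show ?thesis using both T by simp
  next
    case False
    have "(\<Sum>a\<in>insert i' T - {i}. qv v z a i * U3 (insert i' T - {a}) z) = 0"
      using T False by (intro incidence_32[OF _ zne z(2)]) simp
    moreover have "(\<Sum>a\<in>insert i' T - {i}. qv v z a i * U3 (insert i' T - {a}) z)
      = (\<Sum>a\<in>{i'}. qv v z a i * U3 (insert i' T - {a}) z)"
    proof (rule sum.mono_neutral_right)
      show "\<forall>a\<in>insert i' T - {i} - {i'}. qv v z a i * U3 (insert i' T - {a}) z = 0"
        using T False by (intro ballI, subst both) auto
    qed (use ii in auto)
    moreover have "qv v z i' i = 1" using z i by (simp add: qv_def)
    ultimately show ?thesis using False by simp
  qed
  show ?thesis
  proof (cases "i \<in> T")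
    case True
    then show ?thesis using with_i T by simp
  next
    case False
    have "(\<Sum>a\<in>insert i T - {i'}. qv v z a i' * U3 (insert i T - {a}) z) = 0"
      using T False by (intro incidence_32[OF _ zne z(2)]) simp
    moreover have "(\<Sum>a\<in>insert i T - {i'}. qv v z a i' * U3 (insert i T - {a}) z)
      = (\<Sum>a\<in>{i}. qv v z a i' * U3 (insert i T - {a}) z)"
    proof (rule sum.mono_neutral_right)
      show "\<forall>a\<in>insert i T - {i'} - {i}. qv v z a i' * U3 (insert i T - {a}) z = 0"
        using T False by (intro ballI, subst with_i) auto
    qed (use ii in auto)
    moreover have "qv v z i i' = 1" using z i by (simp add: qv_def)
    ultimately show ?thesis using False by simp
  qed
qed

end

subsection \<open>Separating the three-dimensional space\<close>

lemma good_3d2s1t: "0 < s \<Longrightarrow> 0 < t \<Longrightarrow> good (replicate d 3 @ replicate s 2 @ replicate t 1)"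
  using good_blocks[of s t d] by (simp add: blocks_def)

context
  fixes s t :: nat and i i' :: "'i::finite" and v z :: "'i set"
  assumes five: "card (UNIV :: 'i::finite set) = 5" and s: "4 \<le> s" and t: "4 \<le> t"
    and i: "i \<in> v" and i': "i' \<in> z" and iz: "i \<notin> z"
begin

text \<open>Induction over the number of star letters behind \<open>T\<close>. If \<open>T\<close>
  contains a pivot but not both, an exchange with the next letter leaves only words that begin with
  a star letter, behind which the induction hypothesis applies. If it contains none, the exchange
  leads to first letters containing a pivot.\<close>

lemma star2_words:
  assumes "Ann (wt (replicate (Suc n) 3 @ replicate s 2 @ replicate t 1)) L"
    and "\<And>ks. length ks = Suc n \<Longrightarrow> set ks \<subseteq> - {i, i'} \<Longrightarrow>
      L (wm (map (\<lambda>k. {i, i', k}) ks) (up s t i z v)) = 0"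
    and "card T = 3" "length ks = n" "set ks \<subseteq> - {i, i'}"
  shows "L (wm (T # map (\<lambda>k. {i, i', k}) ks) (up s t i z v)) = 0"
  using assms
proof (induction n arbitrary: L T ks)
  case 0
  have "L (wm [T] (up s t i z v)) = 0"
  proof (rule linear_32[OF five s t _ i i' iz _ 0(3)])
    show "Ann (wt (3 # replicate s 2 @ replicate t 1)) L" using 0 by simp
    show "L (wm [{i, i', k}] (up s t i z v)) = 0" if "k \<notin> {i, i'}" for k
      using 0(2)[of "[k]"] that by simp
  qed
  then show ?case using 0 by simp
next
  case (Suc n)
  let ?f = "\<lambda>k. {i, i', k}" let ?up = "up s t i z v" let ?rest = "replicate s 2 @ replicate t 1"
  have ii: "i \<noteq> i'" using i' iz by auto
  have good: "good (3 # 3 # replicate n 3 @ ?rest)"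
    using good_3d2s1t[of s t "Suc (Suc n)"] s t by simp
  have Ann: "Ann (wt (3 # 3 # replicate n 3 @ ?rest)) L" using Suc.prems(1) by simp
  have down: "Ann (wt (replicate (Suc n) 3 @ ?rest)) (\<lambda>g. L (X A * g\<^sup>2))" if "card A = 3" for A
    using good_Ann_down[OF good Ann that] by simp
  have f3: "card (?f k) = 3" if "k \<notin> {i, i'}" for k using that ii by auto
  have IH: "L (wm (A # T # map ?f ks) ?up) = 0"
    if "card A = 3" "\<And>ks. length ks = Suc n \<Longrightarrow> set ks \<subseteq> - {i, i'} \<Longrightarrow> L (wm (A # map ?f ks) ?up) = 0"
      "card T = 3" "length ks = n" "set ks \<subseteq> - {i, i'}" for A T ks
    using Suc.IH[OF down[OF that(1)], of T ks] that by simp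
  have starIH: "L (wm (?f a # T # map ?f ks) ?up) = 0"
    if "a \<notin> {i, i'}" "card T = 3" "length ks = n" "set ks \<subseteq> - {i, i'}" for a T ks
    using Suc.prems(2)[of "a # _"] that by (intro IH f3) auto
  have level1: "L (wm (T # map ?f ks) ?up) = 0"
    if T: "card T = 3" "p \<in> T" and ks: "length ks = Suc n" "set ks \<subseteq> - {i, i'}"
      and p: "p = i \<and> p' = i' \<or> p = i' \<and> p' = i" for T ks p p'
  proof -
    obtain k ks' where kks: "ks = k # ks'" using ks by (cases ks) auto
    have k: "k \<notin> {i, i'}" and ks': "length ks' = n" "set ks' \<subseteq> - {i, i'}" using ks kks by auto
    have fp: "?f a = {p, p', a}" for a using p by auto
    have pp: "p \<noteq> p'" using p ii by auto
    have e: "exch 3 3 (\<lambda>A B. L (wm [A, B] (wm (map ?f ks') ?up)))"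
      by (rule exch_word[OF good Ann])
    have st: "L (wm ({p, p', a} # T # map ?f ks') ?up) = 0" if "a \<notin> {p, p'}" "card T = 3" for a T
      using starIH[of a T ks'] that ks' p by (auto simp: insert_commute)
    show ?thesis
    proof (cases "p' \<in> T")
      case True
      have "card (T - {p, p'}) = 1" using T True pp by (simp add: card_Diff_subset)
      then obtain a where "T - {p, p'} = {a}" by (rule card_1_singletonE)
      then have "T = ?f a" "a \<notin> {i, i'}" using T True p by auto
      then show ?thesis using Suc.prems(2)[of "a # ks"] ks by auto
    next
      case p'T: False
      have "card (T - {p}) = 2" using T by simp
      then obtain b c where "T - {p} = {b, c}" "b \<noteq> c" by (auto simp: card_2_iff)
      then have Tbc: "T = {p, b, c}" "distinct [p, p', b, c]" using T(2) p'T pp by auto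
      have sw: "L (wm ({p, k, c} # {p, p', k} # map ?f ks') ?up) = 0" if "distinct [p, p', k, c]" for c
      proof -
        have "L (wm ({p, k, c} # {p, p', k} # map ?f ks') ?up) = L (wm ({p, p', k} # {p, k, c} # map ?f ks') ?up)"
          using exch_2[OF e, of "{p, k}" "{p, k}" p' c] that by (auto simp: insert_commute)
        also have "\<dots> = 0" using that by (intro st) auto
        finally show ?thesis .
      qed
      consider "k = b" | "k = c" | "k \<noteq> b" "k \<noteq> c" by blast
      then show ?thesis
      proof cases
        case 1
        then show ?thesis using sw[of c] Tbc kks fp[of k] by auto
      next
        case 2
        then show ?thesis using sw[of b] Tbc kks fp[of k] by (auto simp: insert_commute)
      next
        case 3
        have kp: "k \<noteq> p" "k \<noteq> p'" using k p by auto
        have "L (wm ({b, c, p} # {p', p, k} # map ?f ks') ?up) + L (wm ({p', c, p} # {b, p, k} # map ?f ks') ?up)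
          + L (wm ({p', b, p} # {c, p, k} # map ?f ks') ?up) = 0"
          using exch_3[OF e, of "{p}" "{p, k}" p' b c] Tbc 3 kp by auto
        then have "L (wm ({b, c, p} # {p', p, k} # map ?f ks') ?up) = 0"
        proof (rule bit_three_zero)
          show "L (wm ({p', c, p} # {b, p, k} # map ?f ks') ?up) = 0"
            using st[of c "{b, p, k}"] Tbc 3 kp by (auto simp: insert_commute)
          show "L (wm ({p', b, p} # {c, p, k} # map ?f ks') ?up) = 0"
            using st[of b "{c, p, k}"] Tbc 3 kp by (auto simp: insert_commute)
        qed
        then show ?thesis unfolding kks Tbc list.map fp[of k] by (simp add: insert_commute)
      qed
    qed
  qed
  show ?case
  proof (cases "i \<in> T \<or> i' \<in> T")
    case True
    then show ?thesis using level1[of T i ks i'] level1[of T i' ks i] Suc.prems by blast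
  next
    case False
    obtain k ks' where kks: "ks = k # ks'" using Suc.prems(4) by (cases ks) auto
    have k: "k \<notin> {i, i'}" and ks': "length ks' = n" "set ks' \<subseteq> - {i, i'}" using Suc.prems kks by auto
    have "T \<subseteq> - {i, i'}" using False by auto
    moreover have "card (- {i, i'}) = 3" using five ii by (simp add: card_compl_finite)
    ultimately have TU: "T = - {i, i'}" using Suc.prems(3) by (metis card_subset_eq finite)
    then have "k \<in> T" using k by auto
    then have "card (T - {k}) = 2" using Suc.prems(3) by simp
    then obtain b c where "T - {k} = {b, c}" "b \<noteq> c" by (auto simp: card_2_iff)
    then have Tbc: "T = {b, c, k}" "distinct [b, c, k]" using \<open>k \<in> T\<close> by auto
    have D: "distinct [i, i', k, b, c]" using Tbc False ii by auto
    have e: "exch 3 3 (\<lambda>A B. L (wm [A, B] (wm (map ?f ks') ?up)))"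
      by (rule exch_word[OF good Ann])
    \<comment> \<open>Behind the first letter \<open>{i', x, k}\<close> every star word gives 0 by
      \<open>level1\<close>; the induction hypothesis extends this to a second letter outside the
      star.\<close>
    have z: "L (wm ({i', x, k} # {y, k, i} # map ?f ks') ?up) = 0" if "distinct [i, i', k, x, y]" for x y
    proof (rule IH[OF _ _ _ ks'])
      show "L (wm ({i', x, k} # map ?f ks) ?up) = 0" if "length ks = Suc n" "set ks \<subseteq> - {i, i'}" for ks
        using level1[of "{i', x, k}" i' ks i] that \<open>distinct [i, i', k, x, y]\<close> by auto
    qed (use that in auto)
    have "L (wm ({b, c, k} # {i', k, i} # map ?f ks') ?up) + L (wm ({i', c, k} # {b, k, i} # map ?f ks') ?up)
      + L (wm ({i', b, k} # {c, k, i} # map ?f ks') ?up) = 0"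
      using exch_3[OF e, of "{k}" "{k, i}" i' b c] D by auto
    then have "L (wm ({b, c, k} # {i', k, i} # map ?f ks') ?up) = 0"
      by (rule bit_three_zero) (use z[of c b] z[of b c] D in auto)
    moreover have "{i', k, i} = ?f k" by auto
    ultimately show ?thesis unfolding kks Tbc list.map by simp
  qed
qed

lemma star2_all:
  assumes L: "Ann (wt (replicate d 3 @ replicate s 2 @ replicate t 1)) L"
    and star: "\<And>ks. length ks = d \<Longrightarrow> set ks \<subseteq> - {i, i'} \<Longrightarrow>
      L (wm (map (\<lambda>k. {i, i', k}) ks) (up s t i z v)) = 0"
    and P: "\<forall>A\<in>set P. card A = 3" "length P = d"
  shows "L (wm P (up s t i z v)) = 0"
proof -
  let ?f = "\<lambda>k. {i, i', k}"
  have "L (wm (P @ map ?f ks) (up s t i z v)) = 0"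
    if "\<forall>A\<in>set P. card A = 3" "length P + length ks = d" "set ks \<subseteq> - {i, i'}" for P ks
    using that
  proof (induction P arbitrary: ks rule: rev_induct)
    case Nil
    then show ?case using star by simp
  next
    case (snoc T P)
    have eq: "replicate d 3 @ replicate s 2 @ replicate t 1
      = map card P @ (replicate (Suc (length ks)) 3 @ replicate s 2 @ replicate t (1::nat))"
      using snoc.prems map_card_replicate[of P 3]
      by (simp flip: replicate_add append_assoc replicate_Suc)
    have "Ann (wt (replicate (Suc (length ks)) 3 @ replicate s 2 @ replicate t 1)) (\<lambda>g. L (wm P g))"
      using Ann_wm[of P _ L] L eq good_3d2s1t[of s t d] s t by (metis less_le_trans zero_less_numeral)
    from star2_words[OF this _ _ refl snoc.prems(3), of T]
    show ?case using snoc.IH[of "_ # _"] snoc.IH snoc.prems by (auto simp: wm_append length_Suc_conv)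
  qed
  from this[of P "[]"] P show ?thesis by simp
qed

end

subsection \<open>Flags determine the functional\<close>

definition piv :: "'a set \<Rightarrow> 'a" where
  "piv v = (SOME i. i \<in> v)"

lemma piv: "v \<noteq> {} \<Longrightarrow> piv v \<in> v"
  unfolding piv_def by (rule someI_ex) auto

text \<open>With \<open>v\<close>, \<open>z\<close>, \<open>u\<close> read as vectors over the field of two elements, \<open>(v, z, u)\<close> is the normal form
  of the flag \<open>\<langle>v\<rangle> \<subset> \<langle>v, z\<rangle> \<subset> \<langle>v, z, u\<rangle>\<close>.\<close>
definition flags :: "('i set \<times> 'i set \<times> 'i set) set" where
  "flags = {(v, z, u). v \<noteq> {} \<and> z \<noteq> {} \<and> piv v \<notin> z \<and> u \<noteq> {} \<and> piv v \<notin> u \<and> piv z \<notin> u}"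

definition flagpol :: "nat \<Rightarrow> nat \<Rightarrow> nat \<Rightarrow> 'i::finite set \<times> 'i set \<times> 'i set \<Rightarrow> 'i pol" where
  "flagpol d s t = (\<lambda>(v, z, u). \<Sum>K\<in>ups (- {piv v, piv z}) u.
     wm (map (\<lambda>k. {piv v, piv z, k}) (wd d K)) (up s t (piv v) z v))"

text \<open>The nested superset sums are undone from the outside: \<open>a\<close> frees the first
  block, \<open>b\<close> the second, \<open>c\<close> the third. Each time Moebius inversion gives
  the star words, and the rewriting lemmas give all others.\<close>

lemma flags_determine_min_words:
  assumes five: "card (UNIV :: 'i::finite set) = 5"
    and d: "3 \<le> d" and s: "4 \<le> s" and t: "4 \<le> t"
    and L: "Ann (wt (blocks d s t)) (L :: 'i pol \<Rightarrow> bit)"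
    and F: "\<And>F. F \<in> flags \<Longrightarrow> L (flagpol d s t F) = 0"
    and ws: "map card ws = blocks d s t"
  shows "L (wm ws 1) = 0"
proof -
  have goodL: "good (replicate d 3 @ replicate s 2 @ replicate t 1)"
    using good_3d2s1t[of s t d] s t by simp
  have AL: "Ann (wt (replicate d 3 @ replicate s 2 @ replicate t 1)) L"
    using L by (simp add: blocks_def)
  note addL = AnnD(1)[OF L]
  have a: "L (wm P (up s t (piv v) z v)) = 0"
    if v: "v \<noteq> {}" and z: "z \<noteq> {}" "piv v \<notin> z" and P: "\<forall>A\<in>set P. card A = 3" "length P = d" for v z P
  proof -
    let ?i = "piv v" and ?i' = "piv z"
    let ?f = "\<lambda>k. {?i, ?i', k}"
    have ii: "?i \<noteq> ?i'" using piv[OF z(1)] z(2) by auto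
    have A: "L (wm (map ?f (wd d K)) (up s t ?i z v)) = 0" if "K \<noteq> {}" "K \<subseteq> - {?i, ?i'}" for K
      using _ that
    proof (rule ups_sum_eq_0_imp)
      fix u assume "u \<noteq> {}" "u \<subseteq> - {?i, ?i'}"
      then have "(v, z, u) \<in> flags" using v z by (auto simp: flags_def)
      from F[OF this] show "(\<Sum>K\<in>ups (- {?i, ?i'}) u. L (wm (map ?f (wd d K)) (up s t ?i z v))) = 0"
        by (simp add: flagpol_def additive.sum[OF addL])
    qed
    show ?thesis
    proof (rule star2_all[OF five s t piv[OF v] piv[OF z(1)] z(2) AL _ P])
      fix ks assume ks: "length ks = d" "set ks \<subseteq> - {?i, ?i'}"
      then have "ks \<noteq> []" using d by auto
      then have "L (wm (map ?f ks) (up s t ?i z v)) = L (wm (map ?f (wd d (set ks))) (up s t ?i z v))"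
        using wd_set[OF clique_star2[OF ii], of ks "replicate s 2 @ replicate t 1" L "up s t ?i z v"] goodL AL ks
        by simp
      then show "L (wm (map ?f ks) (up s t ?i z v)) = 0" using A[of "set ks"] ks \<open>ks \<noteq> []\<close> by simp
    qed
  qed
  have b: "L (wm P (tp t w v)) = 0"
    if v: "v \<noteq> {}" and P: "\<forall>A\<in>set P. card A = 3" "length P = d"
      and w: "\<forall>A\<in>set w. card A = 2" "length w = s" for v P w
  proof -
    let ?i = "piv v" and ?f = "\<lambda>a. {piv v, a}"
    have LP: "Ann (wt (replicate s 2 @ replicate t 1)) (\<lambda>g. L (wm P g))"
      using Ann_wm[of P "replicate s 2 @ replicate t 1" L] goodL AL P map_card_replicate[of P 3] by simp
    have A: "L (wm P (tp t (map ?f (wd s S)) v)) = 0" if "S \<noteq> {}" "S \<subseteq> - {?i}" for S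
      using _ that
    proof (rule ups_sum_eq_0_imp)
      fix z assume "z \<noteq> {}" "z \<subseteq> - {?i}"
      then show "(\<Sum>S\<in>ups (- {?i}) z. L (wm P (tp t (map ?f (wd s S)) v))) = 0"
        using a[OF v _ _ P, of z] by (auto simp: up_def additive.sum[OF AnnD(1)[OF LP]])
    qed
    show ?thesis
    proof (rule tp_all[OF five t LP piv[OF v] _ w])
      fix us assume us: "length us = s" "?i \<notin> set us"
      then have ne: "us \<noteq> []" using s by auto
      have wd': "set (wd s (set us)) = set us" "length (wd s (set us)) = s"
        using wd[of "set us" s] ne us card_length[of us] by auto
      have "L (wm P (tp t (map ?f us) v)) = L (wm P (tp t (map ?f (wd s (set us))) v))"
        by (rule tp_star_set[OF five t LP]) (use us wd' ne in auto)
      then show "L (wm P (tp t (map ?f us) v)) = 0" using A[of "set us"] us ne by auto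
    qed
  qed
  let ?sg = "\<lambda>a. {a}"
  have c: "L (wm P (wm w (wm (map ?sg (wd t S)) 1))) = 0"
    if S: "S \<noteq> {}" "S \<noteq> UNIV" and P: "\<forall>A\<in>set P. card A = 3" "length P = d"
      and w: "\<forall>A\<in>set w. card A = 2" "length w = s" for S P w
  proof -
    define M where "M = (\<lambda>g. L (wm P (wm w g)))"
    have addM: "additive M"
      unfolding M_def by (rule additive_wm[OF additive_wm[OF addL]])
    have e: "ups UNIV UNIV - {UNIV :: 'i set} = {}" by (auto simp: ups_def)
    \<comment> \<open>\<open>hp t UNIV\<close> is an empty sum, so the case \<open>v = UNIV\<close>
      isolates the correction term, which is therefore 0 as well.\<close>
    have h0: "M (hp t UNIV) = 0"
      unfolding hp_def e sum.empty by (rule additive.zero[OF addM])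
    have sum0: "M (hp t v) + M (hp t {mm (last w)}) = 0" if "v \<noteq> {}" for v
      using b[OF that P w] additive.add[OF addM, of "hp t v" "hp t {mm (last w)}"] by (simp add: tp_def M_def)
    have "M (hp t {mm (last w)}) = 0" using sum0[of UNIV] h0 by simp
    then have hz: "M (hp t v) = 0" if "v \<noteq> {}" for v using sum0[OF that] by simp
    define A where "A = (\<lambda>S. if S = UNIV then 0 else M (wm (map ?sg (wd t S)) 1))"
    have "A S = 0"
    proof (rule ups_sum_eq_0_imp[OF _ S(1) subset_UNIV])
      fix v :: "'i set" assume "v \<noteq> {}"
      have "(\<Sum>S\<in>ups UNIV v. A S) = (\<Sum>S\<in>ups UNIV v - {UNIV}. A S)"
        by (rule sum.mono_neutral_right) (auto simp: A_def)
      also have "\<dots> = (\<Sum>S\<in>ups UNIV v - {UNIV}. M (wm (map ?sg (wd t S)) 1))"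
        by (rule sum.cong) (auto simp: A_def)
      also have "\<dots> = M (hp t v)" by (simp add: hp_def additive.sum[OF addM])
      finally show "(\<Sum>S\<in>ups UNIV v. A S) = 0" using hz[OF \<open>v \<noteq> {}\<close>] by simp
    qed
    then show ?thesis using S by (simp add: A_def M_def)
  qed
  have dw: "L (wm P (wm w (wm (map ?sg rs) 1))) = 0"
    if rs: "set rs \<noteq> UNIV" "length rs = t" and P: "\<forall>A\<in>set P. card A = 3" "length P = d"
      and w: "\<forall>A\<in>set w. card A = 2" "length w = s" for rs P w
  proof -
    have "map card (P @ w) @ replicate t 1 = replicate d 3 @ replicate s 2 @ replicate t 1"
      using P w map_card_replicate[of P 3] map_card_replicate[of w 2] by simp
    then have M: "Ann (wt (replicate t 1 @ [])) (\<lambda>g. L (wm (P @ w) g))" "good (replicate t 1 @ [])"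
      using Ann_wm[of "P @ w" "replicate t 1" L] goodL AL good_append[of "map card (P @ w)" "replicate t 1"] by auto
    have "rs \<noteq> []" using rs t by auto
    then have "L (wm (P @ w) (wm (map ?sg rs) 1)) = L (wm (P @ w) (wm (map ?sg (wd t (set rs))) 1))"
      using wd_set[OF clique_singletons, of rs "[]"] M rs by simp
    then show ?thesis using c[of "set rs" P w] rs P w \<open>rs \<noteq> []\<close> by (simp add: wm_append)
  qed
  obtain P wr where 1: "ws = P @ wr" "replicate d 3 = map card P" "replicate s 2 @ replicate t 1 = map card wr"
    using ws[unfolded blocks_def map_eq_append_conv] by blast
  obtain w r where 2: "wr = w @ r" "replicate s 2 = map card w" "replicate t 1 = map card r"
    using 1(3)[symmetric, unfolded map_eq_append_conv] by blast
  note PQR = 1(1)[unfolded 2(1)] and cards = 1(2)[symmetric] 2(2,3)[symmetric]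
  have lens: "length P = d" "length w = s" "length r = t"
    using cards[THEN arg_cong[where f = length]] by simp_all
  have "card ` set P \<subseteq> {3}" "card ` set w \<subseteq> {2}" "card ` set r \<subseteq> {1}"
    using cards[THEN arg_cong[where f = set]] by (simp_all add: set_replicate_conv_if)
  then have P: "\<forall>A\<in>set P. card A = 3" and w: "\<forall>A\<in>set w. card A = 2" and r: "\<forall>A\<in>set r. card A = 1"
    by auto
  define rs where "rs = map the_elem r"
  have "map (\<lambda>A. {the_elem A}) r = r"
  proof (rule map_idI)
    fix A assume "A \<in> set r"
    then have "card A = 1" using r by blast
    then show "{the_elem A} = A" by (auto simp: card_1_singleton_iff)
  qed
  then have rmap: "r = map ?sg rs" by (simp add: rs_def comp_def)
  have lrs: "length rs = t" using lens by (simp add: rs_def)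
  show ?thesis
  proof (cases "set rs = UNIV")
    case False
    then show ?thesis using dw[OF False lrs P lens(1) w lens(2)] PQR rmap by (simp add: wm_append)
  next
    case True
    then have t5: "5 \<le> t" using card_length[of rs] five lrs by simp
    obtain w0 J where wJ: "w = w0 @ [J]" using lens(2) s by (cases w rule: rev_cases) auto
    have J: "card J = 2" and w0: "\<forall>A\<in>set w0. card A = 2" "Suc (length w0) = s" using w wJ lens by auto
    have eq0: "map card (P @ w0) @ 2 # replicate t 1 = replicate d 3 @ replicate s 2 @ replicate t 1"
      using P w0 lens map_card_replicate[of P 3] map_card_replicate[of w0 2]
      by (simp flip: w0(2) add: replicate_app_Cons_same)
    have M: "Ann (wt (2 # replicate t 1)) (\<lambda>g. L (wm (P @ w0) g))" "good (2 # replicate t 1)"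
      by (rule Ann_wm[OF goodL[folded eq0] AL[folded eq0]], rule good_append[OF goodL[folded eq0]])
    \<comment> \<open>A word on all five letters is respelled to start with some \<open>i\<close>
      outside the last pair \<open>J\<close>, followed by the other four. In the exchange of
      \<open>J\<close> with this \<open>i\<close>, all other terms omit \<open>i\<close> in the
      third block.\<close>
    obtain i where i: "i \<notin> J" using J five by (metis UNIV_eq_I numeral_eq_iff num.distinct(5) num.distinct(3) semiring_norm(88,89))
    let ?R = "map ?sg (wd (t - 1) (- {i}))"
    have c4: "card (- {i}) = 4" using five by (simp add: card_compl_finite)
    then have "- {i} \<noteq> {}" by auto
    then have R: "set (wd (t - 1) (- {i})) = - {i}" "length (wd (t - 1) (- {i})) = t - 1"
      using wd[of "- {i}" "t - 1"] c4 t5 by auto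
    have eq: "2 # replicate t 1 = 2 # 1 # replicate (t - 1) 1" using t by (cases t) auto
    have "(\<Sum>x\<in>insert i J - {}. L (wm (P @ w0) (wm [insert i J - {x}, insert x {}] (wm ?R 1)))) = 0"
      by (rule word_exchange[OF M(2)[unfolded eq] M(1)[unfolded eq]]) (use J i in auto)
    moreover have "(\<Sum>x\<in>insert i J - {}. L (wm (P @ w0) (wm [insert i J - {x}, insert x {}] (wm ?R 1))))
      = (\<Sum>x\<in>{i}. L (wm (P @ w0) (wm [insert i J - {x}, insert x {}] (wm ?R 1))))"
    proof (rule sum.mono_neutral_right)
      show "\<forall>x\<in>insert i J - {} - {i}. L (wm (P @ w0) (wm [insert i J - {x}, insert x {}] (wm ?R 1))) = 0"
      proof
        fix x assume x: "x \<in> insert i J - {} - {i}"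
        then have "set (x # wd (t - 1) (- {i})) = - {i}" using R by auto
        then have "set (x # wd (t - 1) (- {i})) \<noteq> UNIV" by auto
        moreover have "card (insert i J - {x}) = 2" using x i J by (simp add: card_insert_if)
        ultimately show "L (wm (P @ w0) (wm [insert i J - {x}, insert x {}] (wm ?R 1))) = 0"
          using dw[of "x # wd (t - 1) (- {i})" P "w0 @ [insert i J - {x}]"] P w0 lens R t
          by (auto simp: wm_append)
      qed
    qed auto
    ultimately have "L (wm (P @ w0) (wm [insert i J - {i}, insert i {}] (wm ?R 1))) = 0" by simp
    then have z: "L (wm (P @ w0) (wm (J # map ?sg (i # wd (t - 1) (- {i}))) 1)) = 0" using i by simp
    have "L (wm (P @ w0) (X J * (wm (map ?sg rs) 1)\<^sup>2)) = L (wm (P @ w0) (X J * (wm (map ?sg (i # wd (t - 1) (- {i}))) 1)\<^sup>2))"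
    proof (rule clique_set[OF clique_singletons, of "map ?sg rs" _ "[]"])
      show "set (map ?sg rs) = set (map ?sg (i # wd (t - 1) (- {i})))" using True R by auto
      show "length (map ?sg rs) = length (map ?sg (i # wd (t - 1) (- {i})))" using R lrs t by simp
      show "good (replicate (length (map ?sg rs)) 1 @ [])" using good_tl[OF M(2)] lrs by simp
      show "Ann (wt (replicate (length (map ?sg rs)) 1 @ [])) (\<lambda>g. L (wm (P @ w0) (X J * g\<^sup>2)))"
        using good_Ann_down[OF M(2) M(1) J] lrs by simp
    qed auto
    then show ?thesis using z PQR rmap wJ by (simp add: wm_append)
  qed
qed

subsection \<open>Functionals attached to flags\<close>

lemma even_choose_odd: "even m \<Longrightarrow> odd c \<Longrightarrow> even (m choose c)" for m c :: nat
proof -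
  assume m: "even m" and c: "odd c"
  then obtain c' where c': "c = Suc c'" by (cases c) auto
  show ?thesis
  proof (cases m)
    case (Suc m')
    have "even (Suc m' * (m' choose c'))" using m unfolding Suc even_mult_iff by blast
    then have "even (Suc c' * (Suc m' choose Suc c'))" unfolding Suc_times_binomial .
    then show ?thesis using c unfolding c' Suc even_mult_iff by blast
  qed (use c' in auto)
qed

lemma even_choose_double: "even (2 * m choose 2 * c) = even (m choose c)"
proof (induction m arbitrary: c)
  case 0
  then show ?case by (cases c) auto
next
  case (Suc m)
  show ?case
  proof (cases c)
    case (Suc c')
    have 1: "2 * Suc m choose 2 * c = (2 * m choose 2 * c') + 2 * (2 * m choose Suc (2 * c')) + (2 * m choose 2 * c)"
      using Suc by simp
    have 2: "Suc m choose c = (m choose c') + (m choose c)" using Suc by simp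
    show ?thesis unfolding 1 2 even_add Suc.IH by simp
  qed auto
qed

text \<open>In one variable, no smaller power is carried onto \<open>x^(2^a - 1)\<close> by a
  Steenrod square. This is Lucas's theorem digit by digit: an even \<open>m\<close> meets an odd
  lower index, and an odd \<open>m\<close> reduces to the exponent \<open>a\<close> of one
  less.\<close>

lemma odd_choose_complement:
  assumes "m \<le> 2 ^ a - 1" "odd (m choose (2 ^ a - 1 - m))"
  shows "m = 2 ^ a - 1"
  using assms
proof (induction a arbitrary: m)
  case (Suc a)
  have pos: "(2::nat) ^ a > 0" by simp
  show ?case
  proof (cases "odd m")
    case False
    then obtain k where k: "m = 2 * k" by (auto elim: evenE)
    have "2 * N - 1 - 2 * k = 2 * (N - 1 - k) + 1" if "2 * k \<le> 2 * N - 1" "0 < N" for N :: nat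
      using that by linarith
    from this[of "2 ^ a"] have "2 ^ Suc a - 1 - m = 2 * (2 ^ a - 1 - k) + 1"
      using Suc.prems(1) pos k by simp
    then have "odd (2 ^ Suc a - 1 - m)" by simp
    then show ?thesis using even_choose_odd[of m] False Suc.prems(2) by blast
  next
    case True
    then obtain m' where m: "m = 2 * m' + 1" by (rule oddE)
    define c where "c = 2 ^ a - 1 - m'"
    have le: "m' \<le> 2 ^ a - 1" using Suc.prems(1) m by simp
    have "2 ^ Suc a - 1 - m = 2 * c" using m le pos unfolding c_def by (simp add: algebra_simps)
    then have "odd (Suc (2 * m') choose (2 * c))" using Suc.prems(2) m by simp
    moreover have "even (Suc (2 * m') choose (2 * c)) = even (m' choose c)"
    proof (cases c)
      case (Suc c')
      then have "Suc (2 * m') choose (2 * c) = (2 * m' choose Suc (2 * c')) + (2 * m' choose 2 * c)" by simp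
      then show ?thesis using even_choose_odd[of "2 * m'" "Suc (2 * c')"] even_choose_double[of m' c] by simp
    qed auto
    ultimately have "m' = 2 ^ a - 1" using Suc.IH[of m'] le unfolding c_def by blast
    moreover have "2 * (N - 1) + 1 = 2 * N - 1" if "0 < N" for N :: nat using that by linarith
    ultimately show ?thesis using m pos by simp
  qed
qed simp

section \<open>Homogeneous polynomials and coefficients of spikes\<close>

definition hom :: "nat \<Rightarrow> 'i::finite pol \<Rightarrow> bool" where
  "hom n p \<longleftrightarrow> (\<forall>e\<in>keys p. deg e = n)"

lemma hom_mult: "hom m p \<Longrightarrow> hom n q \<Longrightarrow> hom (m + n) (p * q)"
  unfolding hom_def
proof
  fix e assume "\<forall>e\<in>keys p. deg e = m" "\<forall>e\<in>keys q. deg e = n" "e \<in> keys (p * q)"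
  moreover obtain a b where "e = a + b" "a \<in> keys p" "b \<in> keys q"
    using calculation(3) keys_mult[of p q] by blast
  ultimately show "deg e = m + n" by (simp add: deg_def sum.distrib)
qed

lemma hom_1: "hom 0 (1 :: 'i::finite pol)"
  by (simp add: hom_def deg_def)

lemma hom_power: "hom m p \<Longrightarrow> hom (k * m) (p ^ k)"
  by (induction k) (auto simp: hom_1 intro: hom_mult)

lemma hom_prod: "(\<And>i. i \<in> A \<Longrightarrow> hom (k i) (f i)) \<Longrightarrow> hom (\<Sum>i\<in>A. k i) (\<Prod>i\<in>A. f i)"
  by (induction A rule: infinite_finite_induct) (auto simp: hom_1 intro: hom_mult)

lemma hom_add: "hom n p \<Longrightarrow> hom n q \<Longrightarrow> hom n (p + q)"
  unfolding hom_def using keys_add[of p q] by blast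

definition spike :: "('i \<Rightarrow> nat) \<Rightarrow> 'i \<Rightarrow> nat" where
  "spike e = (\<lambda>i. 2 ^ e i - 1)"

definition ind :: "'i set \<Rightarrow> 'i \<Rightarrow> nat" where
  "ind P = (\<lambda>i. of_bool (i \<in> P))"

text \<open>Spikes do not occur in hit polynomials; variable by variable this is
  \<open>odd_choose_complement\<close>.\<close>

lemma lookup_St_spike: "lookup (St q) (spike e) = lookup q (spike e)"
proof (rule additive_pol_eqI[where p = q])
  show "additive (\<lambda>q. lookup (St q) (spike e))" by standard (simp add: St_add lookup_add)
  show "additive (\<lambda>q. lookup q (spike e))" by standard (simp add: lookup_add)
  fix f :: "'a \<Rightarrow> nat"
  have "(\<forall>i. f i \<le> spike e i \<and> odd (f i choose (spike e i - f i))) \<longleftrightarrow> f = spike e"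
    using odd_choose_complement by (auto simp: spike_def fun_eq_iff)
  then show "lookup (St (mon f)) (spike e) = lookup (mon f) (spike e)"
    by (simp add: lookup_St_mon lookup_single when_def)
qed

text \<open>Where \<open>e\<close> is positive the spike has odd exponents, so \<open>f\<close> is
  at least 1 there, and its degree leaves no room for more.\<close>

lemma spike_split:
  assumes "deg f = card {i. 0 < e i}"
  shows "(\<lambda>i. f i + 2 * h i) = spike e \<longleftrightarrow> f = ind {i. 0 < e i} \<and> h = spike (\<lambda>i. e i - 1)"
proof
  assume eq: "(\<lambda>i. f i + 2 * h i) = spike e"
  let ?P = "{i. 0 < e i}"
  have sp: "f i + 2 * h i = 2 ^ e i - 1" for i using eq by (auto simp: spike_def fun_eq_iff)
  have "ind ?P i \<le> f i" for i
  proof (cases "0 < e i")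
    case True
    then have "odd ((2::nat) ^ e i - 1)" by simp
    then have "odd (f i)" using sp[of i] by (metis even_add even_mult_iff even_numeral)
    then show ?thesis by (auto simp: ind_def elim: oddE)
  qed (simp add: ind_def)
  moreover have "deg (ind ?P) = card ?P" by (simp add: deg_def ind_def of_bool_def sum.If_cases)
  ultimately have f: "f = ind ?P" using deg_strict_mono[of "ind ?P" f] assms by fastforce
  have "h i = 2 ^ (e i - 1) - 1" for i
  proof (cases "e i")
    case 0
    then show ?thesis using sp[of i] by simp
  next
    case (Suc k)
    then have "Suc (2 * h i) = 2 * 2 ^ k - 1" using sp[of i] by (simp add: f ind_def)
    then show ?thesis using Suc by (cases "2 ^ k :: nat") auto
  qed
  then show "f = ind ?P \<and> h = spike (\<lambda>i. e i - 1)" using f by (simp add: spike_def fun_eq_iff)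
next
  assume "f = ind {i. 0 < e i} \<and> h = spike (\<lambda>i. e i - 1)"
  moreover have "of_bool (0 < n) + 2 * (2 ^ (n - 1) - 1) = (2::nat) ^ n - 1" for n
  proof (cases n)
    case (Suc k)
    then show ?thesis by (cases "2 ^ k :: nat") auto
  qed simp
  ultimately show "(\<lambda>i. f i + 2 * h i) = spike e" by (auto simp: ind_def spike_def)
qed

lemma lookup_mult_square_spike:
  assumes "hom (card {i. 0 < e i}) p"
  shows "lookup (p * q\<^sup>2) (spike e) = lookup p (ind {i. 0 < e i}) * lookup q (spike (\<lambda>i. e i - 1))"
proof -
  let ?P = "{i. 0 < e i}"
  have m: "lookup (mon f * q\<^sup>2) (spike e) = lookup (mon f) (ind ?P) * lookup q (spike (\<lambda>i. e i - 1))"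
    if "deg f = card ?P" for f
  proof (rule additive_pol_eqI[where p = q])
    show "additive (\<lambda>q. lookup (mon f * q\<^sup>2) (spike e))"
      by standard (simp add: pol_square_add distrib_left lookup_add)
    show "additive (\<lambda>q. lookup (mon f) (ind ?P) * lookup q (spike (\<lambda>i. e i - 1)))"
      by standard (simp add: lookup_add distrib_left)
    fix h :: "'a \<Rightarrow> nat"
    have "mon f * (mon h)\<^sup>2 = mon (\<lambda>i. f i + 2 * h i)"
      by (auto simp: mon_square mon_mult fun_eq_iff intro!: arg_cong[where f = mon])
    then show "lookup (mon f * (mon h)\<^sup>2) (spike e) = lookup (mon f) (ind ?P) * lookup (mon h) (spike (\<lambda>i. e i - 1))"
      using spike_split[OF that, of h] by (auto simp: lookup_single when_def)
  qed
  have "lookup (p * q\<^sup>2) (spike e) = (\<Sum>f\<in>keys p. lookup (mon f * q\<^sup>2) (spike e))"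
    by (subst (1) pol_eq_sum_mon[of p]) (simp add: sum_distrib_right lookup_sum)
  also have "\<dots> = (\<Sum>f\<in>keys p. lookup (mon f) (ind ?P) * lookup q (spike (\<lambda>i. e i - 1)))"
    using assms by (intro sum.cong refl m) (auto simp: hom_def)
  also have "\<dots> = (\<Sum>f\<in>keys p. lookup (mon f) (ind ?P)) * lookup q (spike (\<lambda>i. e i - 1))"
    by (rule sum_distrib_right[symmetric])
  also have "(\<Sum>f\<in>keys p. lookup (mon f) (ind ?P)) = lookup p (ind ?P)"
    using arg_cong[OF pol_eq_sum_mon[of p], of "\<lambda>q. lookup q (ind ?P)"] by (simp only: lookup_sum)
  finally show ?thesis .
qed

lemma lookup_var_mult_ind: "lookup (X {c} * p) (ind P) = of_bool (c \<in> P) * lookup p (ind (P - {c}))"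
proof (rule additive_pol_eqI[where p = p])
  show "additive (\<lambda>p. lookup (X {c} * p) (ind P))" by standard (simp add: distrib_left lookup_add)
  show "additive (\<lambda>p. of_bool (c \<in> P) * (lookup p (ind (P - {c})) :: bit))"
    by standard (simp add: distrib_left lookup_add)
  fix f
  have "(\<lambda>i. of_bool (i = c)) + f = ind P \<longleftrightarrow> c \<in> P \<and> f = ind (P - {c})"
  proof
    assume eq: "(\<lambda>i. of_bool (i = c)) + f = ind P"
    then have *: "of_bool (i = c) + f i = of_bool (i \<in> P)" for i by (auto simp: ind_def fun_eq_iff)
    have "c \<in> P" using *[of c] by (cases "c \<in> P") auto
    moreover have "f i = ind (P - {c}) i" for i
      using *[of i] \<open>c \<in> P\<close> by (cases "i = c") (auto simp: ind_def)
    ultimately show "c \<in> P \<and> f = ind (P - {c})" by auto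
  qed (auto simp: ind_def fun_eq_iff)
  then show "lookup (X {c} * mon f) (ind P) = of_bool (c \<in> P) * lookup (mon f) (ind (P - {c}))"
    by (auto simp: X_def mon_mult lookup_single when_def)
qed

lemma lookup_of_bool_mult: "lookup (of_bool b * (p :: 'i pol)) e = of_bool b * lookup p e"
  by (cases b) auto

lemma prod_list_of_bool: "prod_list (map (\<lambda>x. of_bool (Q x)) xs) = (of_bool (\<forall>x\<in>set xs. Q x) :: bit)"
  by (induction xs) auto

text \<open>The sum counts the sets between \<open>v\<close> and \<open>w \<inter> \<Omega>\<close>,
  whose number is odd only if the two coincide.\<close>

lemma sum_ups_subset:
  fixes w :: "'i::finite set"
  assumes "v \<subseteq> \<Omega>"
  shows "(\<Sum>S\<in>ups \<Omega> v. of_bool (S \<subseteq> w) :: bit) = of_bool (v = w \<inter> \<Omega>)"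
proof (cases "w \<inter> \<Omega> \<subseteq> v")
  case True
  have "(\<Sum>S\<in>ups \<Omega> v. of_bool (S \<subseteq> w) :: bit) = (\<Sum>S\<in>{v}. of_bool (S \<subseteq> w))"
    using True assms by (intro sum.mono_neutral_right) (auto simp: ups_def)
  also have "\<dots> = of_bool (v \<subseteq> w)" by (rule trans[OF sum.insert]) auto
  also have "\<dots> = of_bool (v = w \<inter> \<Omega>)" using True assms by (intro arg_cong[where f = of_bool]) auto
  finally show ?thesis .
next
  case False
  then obtain x where x: "x \<in> w" "x \<in> \<Omega>" "x \<notin> v" by auto
  have "(\<Sum>S\<in>ups \<Omega> v. of_bool (S \<subseteq> w) :: bit) = (\<Sum>S\<in>ups \<Omega> v. of_bool (insert x S \<subseteq> w))"
    using x by (intro sum.cong) auto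
  also have "\<dots> = 0" using sum_ups_insert[OF x(2), of "\<lambda>S. of_bool (S \<subseteq> w)" v] x by simp
  finally show ?thesis using False by auto
qed

section \<open>Spike coefficients after a linear substitution\<close>

context
  fixes c0 c1 c2 :: "'i::finite" and v z u :: "'i set"
  assumes c: "distinct [c0, c1, c2]"
begin

text \<open>The substitution whose coefficient vectors in the new variables \<open>c0\<close>, \<open>c1\<close>, \<open>c2\<close> are \<open>v\<close>, \<open>z\<close>, \<open>u\<close>.\<close>
definition lf :: "'i \<Rightarrow> 'i pol" where
  "lf i = of_bool (i \<in> v) * X {c0} + of_bool (i \<in> z) * X {c1} + of_bool (i \<in> u) * X {c2}"

definition lam :: "('i \<Rightarrow> nat) \<Rightarrow> 'i pol \<Rightarrow> bit" where
  "lam e p = lookup (subst lf p) (spike e)"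

lemma St_lf: "St (lf i) = lf i + (lf i)\<^sup>2"
  by (cases "i \<in> v"; cases "i \<in> z"; cases "i \<in> u")
    (simp_all add: lf_def St_add St_var pol_square_add ac_simps additive.zero[OF additive_St])

lemma hom_lf: "hom 1 (lf i)"
proof -
  have "hom 1 (X {x})" for x :: 'i by (simp add: hom_def X_def deg_def)
  then have "hom 1 (of_bool b * X {x})" for b and x :: 'i by (cases b) (auto simp: hom_def)
  then show ?thesis unfolding lf_def by (intro hom_add)
qed

text \<open>Linear substitutions commute with \<open>St\<close> because
  \<open>l \<mapsto> l + l^2\<close> is additive in characteristic two, and spike coefficients are
  unchanged by \<open>St\<close>.\<close>

lemma Ann_lam: "Ann (deg (spike e)) (lam e)"
  unfolding Ann_def
proof (intro conjI allI impI)
  show "additive (lam e)" by standard (simp add: lam_def subst_add lookup_add)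
  fix f
  have "subst lf (St f) = St (subst lf f)"
    unfolding St_def subst_subst unfolding St_def[symmetric] St_lf
    by (simp add: subst_add subst_power subst_var)
  then show "lam e (St f) = lam e f" by (simp add: lam_def lookup_St_spike)
next
  fix f :: "'i \<Rightarrow> nat" assume f: "deg f \<noteq> deg (spike e)"
  have "hom (\<Sum>i\<in>UNIV. f i * 1) (subst lf (mon f))"
    unfolding subst_mon by (intro hom_prod hom_power hom_lf)
  then have "spike e \<notin> keys (subst lf (mon f))" using f by (auto simp: hom_def deg_def)
  then show "lam e (mon f) = 0" by (simp add: lam_def in_keys_iff)
qed

text \<open>The minor with rows \<open>P\<close> and columns \<open>T\<close>: the coefficient of
  the product is a permanent, which modulo 2 is the determinant.\<close>

definition dt :: "'i set \<Rightarrow> 'i set \<Rightarrow> bit" where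
  "dt P T = lookup (\<Prod>i\<in>T. lf i) (ind P)"

lemma lam_X_square:
  assumes "card T = card {i. 0 < e i}"
  shows "lam e (X T * g\<^sup>2) = dt {i. 0 < e i} T * lam (\<lambda>i. e i - 1) g"
proof -
  have "hom (\<Sum>i\<in>T. 1) (\<Prod>i\<in>T. lf i)" by (intro hom_prod hom_lf)
  then have "hom (card {i. 0 < e i}) (\<Prod>i\<in>T. lf i)" using assms by simp
  then show ?thesis
    by (simp add: lam_def dt_def subst_mult subst_power subst_X lookup_mult_square_spike)
qed

text \<open>Each letter lowers the positive entries of \<open>e\<close> by one, so the rows in play
  stay \<open>P\<close> for as long as the block lasts.\<close>

lemma lam_wm:
  assumes "\<forall>T\<in>set ws. card T = card P" "\<And>i. i \<in> P \<Longrightarrow> length ws \<le> e i" "\<And>i. i \<notin> P \<Longrightarrow> e i = 0"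
  shows "lam e (wm ws g) = prod_list (map (dt P) ws) * lam (\<lambda>i. e i - length ws) g"
  using assms
proof (induction ws arbitrary: e)
  case (Cons T ws)
  have P: "{i. 0 < e i} = P" using Cons.prems(2,3) by fastforce
  have "lam e (wm (T # ws) g) = dt P T * lam (\<lambda>i. e i - 1) (wm ws g)"
    using lam_X_square[of T e "wm ws g"] Cons.prems(1) P by simp
  also have "lam (\<lambda>i. e i - 1) (wm ws g) = prod_list (map (dt P) ws) * lam (\<lambda>i. e i - 1 - length ws) g"
    using Cons.prems by (intro Cons.IH) (auto, fastforce)
  finally show ?case by (simp add: mult.assoc)
qed simp

lemma lookup_lf_mult:
  "lookup (lf i * p) (ind P) = of_bool (i \<in> v \<and> c0 \<in> P) * lookup p (ind (P - {c0}))
    + of_bool (i \<in> z \<and> c1 \<in> P) * lookup p (ind (P - {c1})) + of_bool (i \<in> u \<and> c2 \<in> P) * lookup p (ind (P - {c2}))"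
  unfolding lf_def
  by (simp add: distrib_right lookup_add mult.assoc lookup_of_bool_mult lookup_var_mult_ind of_bool_conj)

lemma lookup_lf: "lookup (lf i) (ind P) = of_bool (i \<in> v \<and> P = {c0}) + of_bool (i \<in> z \<and> P = {c1}) + of_bool (i \<in> u \<and> P = {c2})"
proof -
  have "lookup (1 :: 'i pol) (ind Q) = of_bool (Q = {})" for Q
    by (auto simp: lookup_one when_def ind_def fun_eq_iff zero_fun_def)
  moreover have "x \<in> P \<and> P - {x} = {} \<longleftrightarrow> P = {x}" for x by auto
  ultimately show ?thesis using lookup_lf_mult[of i 1 P] by (simp add: of_bool_conj[symmetric] conj_assoc)
qed

lemma dt_1: "dt {c0} {a} = of_bool (a \<in> v)"
  using c by (simp add: dt_def lookup_lf)

lemma dt_2: "a \<noteq> b \<Longrightarrow> dt {c0, c1} {a, b} = of_bool (a \<in> v \<and> b \<in> z) + of_bool (a \<in> z \<and> b \<in> v)"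
  using c by (auto simp: dt_def lookup_lf_mult lookup_lf insert_Diff_if doubleton_eq_iff)

text \<open>In the columns \<open>a\<close>, \<open>b\<close>, \<open>k\<close> the normal form
  makes the matrix triangular, and the last diagonal entry is that of \<open>u\<close> at
  \<open>k\<close>.\<close>

lemma dt_3:
  assumes "distinct [a, b, k]" "a \<in> v" "a \<notin> z" "a \<notin> u" "b \<in> z" "b \<notin> u"
  shows "dt {c0, c1, c2} {a, b, k} = of_bool (k \<in> u)"
  using c assms by (auto simp: dt_def lookup_lf_mult lookup_lf insert_Diff_if)

end

text \<open>The first block of letters sees all three rows, the second \<open>c0\<close> and
  \<open>c1\<close>, the third \<open>c0\<close> alone. The values on words are products of minors,
  and each superset sum picks out one vector by \<open>sum_ups_subset\<close>.\<close>

lemma lam_flagpol: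
  fixes v z u v' z' u' :: "'i::finite set"
  assumes five: "card (UNIV :: 'i::finite set) = 5" and c: "distinct [c0, c1, c2]"
    and d: "3 \<le> d" and s: "4 \<le> s" and t: "4 \<le> t"
    and F: "(v, z, u) \<in> flags" and F': "(v', z', u') \<in> flags"
  shows "lam c0 c1 c2 v' z' u' (\<lambda>i. if i = c0 then d + s + t else if i = c1 then d + s else if i = c2 then d else 0)
    (flagpol d s t (v, z, u)) = of_bool ((v, z, u) = (v', z', u'))"
proof -
  let ?lam = "lam c0 c1 c2 v' z' u'" and ?dt = "dt c0 c1 c2 v' z' u'"
  define E where "E = (\<lambda>a b k i. if i = c0 then a else if i = c1 then b else if i = c2 then k else (0::nat))"
  have add: "additive (?lam e)" for e by (rule AnnD(1)[OF Ann_lam[OF c]])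
  let ?sg = "\<lambda>a. {a}"
  have single: "?lam (E t 0 0) (wm (map ?sg (wd t S)) 1) = of_bool (S \<subseteq> v')" if "S \<noteq> {}" "S \<noteq> UNIV" for S
  proof -
    have "card S < 5" using that(2) five psubset_card_mono[of UNIV S] by auto
    then have w: "set (wd t S) = S" "length (wd t S) = t" using wd[of S t] that t by auto
    have "?lam (E t 0 0) (wm (map ?sg (wd t S)) 1)
      = prod_list (map (?dt {c0}) (map ?sg (wd t S))) * ?lam (\<lambda>i. E t 0 0 i - length (map ?sg (wd t S))) 1"
      by (rule lam_wm[OF c]) (use w in \<open>auto simp: E_def\<close>)
    also have "prod_list (map (?dt {c0}) (map ?sg (wd t S))) = of_bool (S \<subseteq> v')"
      using prod_list_of_bool[of "\<lambda>a. a \<in> v'" "wd t S"] w by (auto simp: comp_def dt_1[OF c] subset_iff)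
    also have "(\<lambda>i. E t 0 0 i - length (map ?sg (wd t S))) = (\<lambda>i. 0)" using w by (auto simp: E_def)
    also have "?lam (\<lambda>i. 0) 1 = 1" by (simp add: lam_def[OF c] subst_1 spike_def lookup_one zero_fun_def)
    finally show ?thesis by simp
  qed
  \<comment> \<open>The omitted full set costs \<open>of_bool (v' = UNIV)\<close> whatever
    \<open>w\<close> is, so it cancels between the two terms of \<open>tp\<close>.\<close>
  have hpv: "?lam (E t 0 0) (hp t w) = of_bool (w = v') + of_bool (v' = UNIV)" if "w \<noteq> {}" for w
  proof -
    have "?lam (E t 0 0) (hp t w) = (\<Sum>S\<in>ups UNIV w - {UNIV}. ?lam (E t 0 0) (wm (map ?sg (wd t S)) 1))"
      unfolding hp_def by (rule additive.sum[OF add])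
    also have "\<dots> = (\<Sum>S\<in>ups UNIV w - {UNIV}. of_bool (S \<subseteq> v'))"
      using that by (intro sum.cong refl single) (auto simp: ups_def)
    finally have 1: "?lam (E t 0 0) (hp t w) = (\<Sum>S\<in>ups UNIV w - {UNIV}. of_bool (S \<subseteq> v'))" .
    have U: "UNIV \<subseteq> v' \<longleftrightarrow> v' = UNIV" by auto
    have A: "(\<Sum>S\<in>ups UNIV w. of_bool (S \<subseteq> v') :: bit)
      = of_bool (v' = UNIV) + (\<Sum>S\<in>ups UNIV w - {UNIV}. of_bool (S \<subseteq> v'))"
      unfolding U[symmetric] by (rule sum.remove) (auto simp: ups_def)
    have B: "(\<Sum>S\<in>ups UNIV w. of_bool (S \<subseteq> v') :: bit) = of_bool (w = v')"
      using sum_ups_subset[of w UNIV v'] by (simp only: Int_UNIV_right subset_UNIV)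
    have "y = x + r" if "x = r + y" for x y r :: bit using that by (cases r; cases y) auto
    from this[OF trans[OF B[symmetric] A]] show ?thesis unfolding 1 .
  qed
  have tpv: "?lam (E (s + t) s 0) (tp t w v) = of_bool (v = v') * prod_list (map (?dt {c0, c1}) w)"
    if w: "\<forall>A\<in>set w. card A = 2" "length w = s" for w
  proof -
    have wne: "w \<noteq> []" using w s by auto
    define m where "m = mm (last w)"
    have l2: "card (last w) = 2" using w wne by simp
    then have "last w \<noteq> UNIV" using five by auto
    then have m: "m \<notin> last w" unfolding m_def by (rule mm)
    have vne: "v \<noteq> {}" using F by (auto simp: flags_def)
    have "?lam (E (s + t) s 0) (tp t w v)
      = prod_list (map (?dt {c0, c1}) w) * ?lam (\<lambda>i. E (s + t) s 0 i - length w) (hp t v + hp t {m})"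
      unfolding tp_def m_def[symmetric]
      by (rule lam_wm[OF c]) (use w c in \<open>auto simp: E_def\<close>)
    also have "(\<lambda>i. E (s + t) s 0 i - length w) = E t 0 0" using w by (auto simp: E_def)
    also have "?lam (E t 0 0) (hp t v + hp t {m}) = of_bool (v = v') + of_bool ({m} = v')"
      using hpv[OF vne] hpv[of "{m}"] by (auto simp: additive.add[OF add])
    also have "prod_list (map (?dt {c0, c1}) w) * (of_bool (v = v') + of_bool ({m} = v'))
      = of_bool (v = v') * prod_list (map (?dt {c0, c1}) w)"
    \<comment> \<open>If \<open>v' = {m}\<close>, the last letter avoids \<open>v'\<close> and its
      minor is 0.\<close>
    proof (cases "{m} = v'")
      case True
      obtain a b where ab: "last w = {a, b}" "a \<noteq> b" using l2 by (auto simp: card_2_iff)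
      have "?dt {c0, c1} (last w) = 0" using dt_2[OF c ab(2), of v' z' u'] m ab(1) True by auto
      then have "prod_list (map (?dt {c0, c1}) w) = 0"
        using wne by (auto simp: prod_list_zero_iff image_iff intro!: bexI[of _ "last w"])
      then show ?thesis by simp
    qed (simp add: mult.commute)
    finally show ?thesis .
  qed
  let ?i = "piv v" and ?i' = "piv z"
  have i: "?i \<in> v" "?i \<notin> z" "?i' \<in> z" "?i \<notin> u" "?i' \<notin> u" and i2: "piv v' \<in> v'" "piv v' \<notin> z'" "piv z' \<in> z'" "piv v' \<notin> u'" "piv z' \<notin> u'"
    using F F' piv[of v] piv[of z] piv[of v'] piv[of z'] by (auto simp: flags_def)
  have zne: "z \<noteq> {}" "u \<noteq> {}" using F by (auto simp: flags_def)
  have upv: "?lam (E (s + t) s 0) (up s t ?i z v) = of_bool (v = v' \<and> z = z')"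
  proof -
    have "?lam (E (s + t) s 0) (up s t ?i z v)
      = (\<Sum>S\<in>ups (- {?i}) z. ?lam (E (s + t) s 0) (tp t (map (\<lambda>a. {?i, a}) (wd s S)) v))"
      unfolding up_def by (rule additive.sum[OF add])
    also have "\<dots> = (\<Sum>S\<in>ups (- {?i}) z. of_bool (v = v') * of_bool (S \<subseteq> z'))"
    proof (rule sum.cong[OF refl])
      fix S assume S: "S \<in> ups (- {?i}) z"
      then have "S \<noteq> {}" "S \<subseteq> - {?i}" using zne by (auto simp: ups_def)
      then have w: "set (wd s S) = S" "length (wd s S) = s"
        using wd[of S s] card_compl_le_4(1)[OF five, of S ?i] s by auto
      have "?lam (E (s + t) s 0) (tp t (map (\<lambda>a. {?i, a}) (wd s S)) v)
        = of_bool (v = v') * prod_list (map (?dt {c0, c1}) (map (\<lambda>a. {?i, a}) (wd s S)))"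
        by (rule tpv) (use w \<open>S \<subseteq> - {?i}\<close> in \<open>auto simp: card_insert_if\<close>)
      also have "\<dots> = of_bool (v = v') * of_bool (S \<subseteq> z')"
      proof (cases "v = v'")
        case True
        have "?dt {c0, c1} {?i, a} = of_bool (a \<in> z')" if "a \<in> S" for a
        proof -
          have "?i \<noteq> a" using that \<open>S \<subseteq> - {?i}\<close> by auto
          from dt_2[OF c this, of v' z' u'] show ?thesis using i2 True by simp
        qed
        then have "map (?dt {c0, c1}) (map (\<lambda>a. {?i, a}) (wd s S)) = map (\<lambda>a. of_bool (a \<in> z')) (wd s S)"
          unfolding map_map comp_def by (intro map_cong refl) (use w in blast)
        then have "prod_list (map (?dt {c0, c1}) (map (\<lambda>a. {?i, a}) (wd s S))) = of_bool (S \<subseteq> z')"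
          using prod_list_of_bool[of "\<lambda>a. a \<in> z'" "wd s S"] w by (simp only: subset_iff Ball_def)
        then show ?thesis by simp
      qed simp
      finally show "?lam (E (s + t) s 0) (tp t (map (\<lambda>a. {?i, a}) (wd s S)) v) = of_bool (v = v') * of_bool (S \<subseteq> z')" .
    qed
    also have "\<dots> = of_bool (v = v') * (\<Sum>S\<in>ups (- {?i}) z. of_bool (S \<subseteq> z'))" by (rule sum_distrib_left[symmetric])
    also have "(\<Sum>S\<in>ups (- {?i}) z. of_bool (S \<subseteq> z')) = (of_bool (z = z' \<inter> - {?i}) :: bit)"
      by (rule sum_ups_subset) (use i in auto)
    \<comment> \<open>For \<open>v = v'\<close> the normal form keeps \<open>z'\<close> away from
      the pivot of \<open>v\<close>, so the intersection changes nothing.\<close>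
    also have "of_bool (v = v') * of_bool (z = z' \<inter> - {?i}) = (of_bool (v = v' \<and> z = z') :: bit)"
      using i2 by (auto simp: Int_absorb2)
    finally show ?thesis .
  qed
  have ii: "?i \<noteq> ?i'" using i by auto
  have "?lam (E (d + s + t) (d + s) d) (flagpol d s t (v, z, u))
    = (\<Sum>K\<in>ups (- {?i, ?i'}) u. ?lam (E (d + s + t) (d + s) d) (wm (map (\<lambda>k. {?i, ?i', k}) (wd d K)) (up s t ?i z v)))"
    unfolding flagpol_def split by (rule additive.sum[OF add])
  also have "\<dots> = (\<Sum>K\<in>ups (- {?i, ?i'}) u. of_bool (v = v' \<and> z = z') * of_bool (K \<subseteq> u'))"
  proof (rule sum.cong[OF refl])
    fix K assume K: "K \<in> ups (- {?i, ?i'}) u"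
    then have Kne: "K \<noteq> {}" and KS: "K \<subseteq> - {?i, ?i'}" using zne by (auto simp: ups_def)
    have "card (- {?i, ?i'}) = 3" using five ii by (simp add: card_compl_finite)
    then have "card K \<le> 3" using KS by (metis card_mono finite)
    then have w: "set (wd d K) = K" "length (wd d K) = d" using wd[of K d] d Kne by auto
    have "?lam (E (d + s + t) (d + s) d) (wm (map (\<lambda>k. {?i, ?i', k}) (wd d K)) (up s t ?i z v))
      = prod_list (map (?dt {c0, c1, c2}) (map (\<lambda>k. {?i, ?i', k}) (wd d K)))
        * ?lam (\<lambda>i. E (d + s + t) (d + s) d i - length (map (\<lambda>k. {?i, ?i', k}) (wd d K))) (up s t ?i z v)"
      by (rule lam_wm[OF c]) (use w KS c ii in \<open>auto simp: E_def card_insert_if\<close>)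
    also have "(\<lambda>i. E (d + s + t) (d + s) d i - length (map (\<lambda>k. {?i, ?i', k}) (wd d K))) = E (s + t) s 0"
      using w by (auto simp: E_def)
    also have "prod_list (map (?dt {c0, c1, c2}) (map (\<lambda>k. {?i, ?i', k}) (wd d K))) * ?lam (E (s + t) s 0) (up s t ?i z v)
      = of_bool (v = v' \<and> z = z') * of_bool (K \<subseteq> u')"
    proof (cases "v = v' \<and> z = z'")
      case True
      have "?dt {c0, c1, c2} {?i, ?i', k} = of_bool (k \<in> u')" if "k \<in> K" for k
        by (rule dt_3[OF c]) (use that KS i i2 ii True in auto)
      then have "map (?dt {c0, c1, c2}) (map (\<lambda>k. {?i, ?i', k}) (wd d K)) = map (\<lambda>k. of_bool (k \<in> u')) (wd d K)"
        unfolding map_map comp_def by (intro map_cong refl) (use w in blast)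
      then have "prod_list (map (?dt {c0, c1, c2}) (map (\<lambda>k. {?i, ?i', k}) (wd d K))) = of_bool (K \<subseteq> u')"
        using prod_list_of_bool[of "\<lambda>a. a \<in> u'" "wd d K"] w by (simp only: subset_iff Ball_def)
      then show ?thesis using upv by simp
    next
      case False
      then show ?thesis using upv by auto
    qed
    finally show "?lam (E (d + s + t) (d + s) d) (wm (map (\<lambda>k. {?i, ?i', k}) (wd d K)) (up s t ?i z v))
      = of_bool (v = v' \<and> z = z') * of_bool (K \<subseteq> u')" .
  qed
  also have "\<dots> = of_bool (v = v' \<and> z = z') * (\<Sum>K\<in>ups (- {?i, ?i'}) u. of_bool (K \<subseteq> u'))"
    by (rule sum_distrib_left[symmetric])
  also have "(\<Sum>K\<in>ups (- {?i, ?i'}) u. of_bool (K \<subseteq> u')) = (of_bool (u = u' \<inter> - {?i, ?i'}) :: bit)"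
    by (rule sum_ups_subset) (use i in auto)
  also have "of_bool (v = v' \<and> z = z') * of_bool (u = u' \<inter> - {?i, ?i'}) = (of_bool ((v, z, u) = (v', z', u')) :: bit)"
    using i2 by (auto simp: Int_absorb2)
  finally show ?thesis unfolding E_def .
qed

text \<open>Each pivot removes one coordinate from the next vector: nonempty subsets of 5, 4 and 3
  points.\<close>

lemma card_flags:
  assumes five: "card (UNIV :: 'i::finite set) = 5"
  shows "card (flags :: ('i set \<times> 'i set \<times> 'i set) set) = 31 * 15 * 7"
proof -
  have nonempty: "card {S. S \<noteq> {} \<and> S \<subseteq> A} = 2 ^ card A - 1" for A :: "'i set"
  proof -
    have "{S. S \<noteq> {} \<and> S \<subseteq> A} = Pow A - {{}}" by auto
    then show ?thesis by (simp add: card_Pow)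
  qed
  let ?V = "{v :: 'i set. v \<noteq> {} \<and> v \<subseteq> UNIV}"
  let ?Z = "\<lambda>v :: 'i set. {z. z \<noteq> {} \<and> z \<subseteq> - {piv v}}"
  let ?U = "\<lambda>v z :: 'i set. {u. u \<noteq> {} \<and> u \<subseteq> - {piv v, piv z}}"
  have 1: "flags = (SIGMA v:?V. SIGMA z:?Z v. ?U v z)"
    by (auto simp: flags_def)
  have 2: "card (SIGMA z:?Z v. ?U v z) = 15 * 7" for v
  proof -
    have "card (?U v z) = 7" if "z \<in> ?Z v" for z
    proof -
      have "piv v \<noteq> piv z" using that piv[of z] by auto
      then have "card (- {piv v, piv z}) = 3" by (simp add: card_compl_finite five)
      then show ?thesis unfolding nonempty by simp
    qed
    moreover have "card (?Z v) = 15"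
      unfolding nonempty by (simp add: card_compl_finite five)
    ultimately show ?thesis by (subst card_SigmaI) auto
  qed
  have 3: "card ?V = 31" unfolding nonempty by (simp add: five)
  have "card (flags :: ('i set \<times> 'i set \<times> 'i set) set) = (\<Sum>v\<in>?V. card (SIGMA z:?Z v. ?U v z))"
    unfolding 1 by (rule card_SigmaI) auto
  also have "\<dots> = (\<Sum>v\<in>?V. 15 * 7)" by (rule sum.cong[OF refl 2])
  also have "\<dots> = 31 * 15 * 7" unfolding sum_constant 3 by simp
  finally show ?thesis .
qed

subsection \<open>Exponent lists\<close>

lemma sum_fun_apply: "(\<Sum>e\<in>A. g e) m = (\<Sum>e\<in>A. (g e :: 'b \<Rightarrow> 'c::comm_monoid_add) m)"
  by (induction A rule: infinite_finite_induct) auto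

definition \<delta> :: "nat list \<Rightarrow> nat list \<Rightarrow> bit" where
  "\<delta> l = (\<lambda>m. of_bool (m = l))"

interpretation F2: vector_space scaleF2
  by standard (auto simp: scaleF2_def fun_eq_iff distrib_left distrib_right mult.assoc)

lemma spanF2_eq: "spanF2 = F2.span"
  by (simp add: fun_eq_iff spanF2_def)

lemma dimF2_eq: "dimF2 = F2.dim"
  by (simp add: fun_eq_iff dimF2_def)

lemma finite_lists_sum: "finite {e :: nat list. length e = k \<and> sum_list e + i = N}"
proof (rule finite_subset)
  show "{e :: nat list. length e = k \<and> sum_list e + i = N} \<subseteq> {e. set e \<subseteq> {..N} \<and> length e = k}"
    using member_le_sum_list by fastforce
  show "finite {e :: nat list. set e \<subseteq> {..N} \<and> length e = k}" by (rule finite_lists_length_eq) simp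
qed

lemma finite_mons: "finite (mons k n)"
  using finite_lists_sum[of k 0 n] by (simp add: mons_def)

lemma Sq_eq_sum:
  assumes "f \<in> Pdeg k d"
  shows "Sq i f = (\<lambda>m. \<Sum>l\<in>mons k d. f l * of_bool (m \<in> sqmon i l))"
proof
  fix m
  let ?S = "{e. length e = length m \<and> sum_list e + i = sum_list m}"
  have "Sq i f m = (\<Sum>e\<in>?S. f e * of_bool (m \<in> sqmon i e))"
    unfolding Sq_def by (rule sum.cong) auto
  also have "\<dots> = (\<Sum>e\<in>?S \<inter> mons k d. f e * of_bool (m \<in> sqmon i e))"
    using finite_lists_sum[of "length m" i "sum_list m"] assms
    by (intro sum.mono_neutral_right) (auto simp: Pdeg_def)
  also have "\<dots> = (\<Sum>l\<in>mons k d. f l * of_bool (m \<in> sqmon i l))"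
    using finite_mons[of k d] by (intro sum.mono_neutral_left) (auto simp: sqmon_def)
  finally show "Sq i f m = (\<Sum>l\<in>mons k d. f l * of_bool (m \<in> sqmon i l))" .
qed

context
  fixes xs :: "'i::finite list"
  assumes xs: "distinct xs" "set xs = UNIV" "length xs = 5"
begin

lemma five: "card (UNIV :: 'i set) = 5"
  using distinct_card[OF xs(1)] xs by simp

lemma map_inj: "map e xs = map f xs \<longleftrightarrow> e = f"
  using xs(2) by (auto simp: fun_eq_iff map_eq_conv)

declare map_eq_conv [simp del]

lemma map_surj:
  assumes "length l = 5"
  obtains e where "l = map e xs"
proof -
  have "l = map (\<lambda>i. the (map_of (zip xs l) i)) xs"
    using assms xs by (intro nth_equalityI) (auto simp: map_of_zip_nth)
  then show ?thesis by (rule that)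
qed

lemma sum_list_map: "sum_list (map e xs) = deg e"
  unfolding deg_def xs(2)[symmetric] by (rule sum_list_distinct_conv_sum_set[OF xs(1)])

lemma mons_eq: "mons 5 n = (\<lambda>e. map e xs) ` {e. deg e = n}"
proof (intro equalityI subsetI)
  fix l assume "l \<in> mons 5 n"
  then have l: "length l = 5" "sum_list l = n" by (auto simp: mons_def)
  obtain e where "l = map e xs" using map_surj[OF l(1)] .
  then show "l \<in> (\<lambda>e. map e xs) ` {e. deg e = n}" using l by (auto simp: sum_list_map)
qed (auto simp: mons_def sum_list_map xs)

lemma finite_deg: "finite {e :: 'i \<Rightarrow> nat. deg e = n}"
proof -
  have "inj_on (\<lambda>e. map e xs) {e. deg e = n}" by (auto simp: inj_on_def map_inj)
  then show ?thesis using finite_mons[of 5 n] unfolding mons_eq by (rule finite_imageD[rotated])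
qed

lemma sqmon_eq:
  assumes "deg e + i = n"
  shows "sqmon i (map e xs) = (\<lambda>f. map f xs) ` {f \<in> keys (St (mon e)). deg f = n}"
proof -
  have *: "map f xs \<in> sqmon i (map e xs) \<longleftrightarrow> f \<in> keys (St (mon e)) \<and> deg f = n" for f
  proof -
    have "(\<forall>j<5. e (xs ! j) \<le> f (xs ! j) \<and> odd (e (xs ! j) choose (f (xs ! j) - e (xs ! j))))
      \<longleftrightarrow> (\<forall>i\<in>set xs. e i \<le> f i \<and> odd (e i choose (f i - e i)))"
      unfolding xs(3)[symmetric] all_set_conv_all_nth ..
    then show ?thesis
      using assms by (auto simp: sqmon_def sum_list_map xs in_keys_iff lookup_St_mon)
  qed
  show ?thesis
  proof (intro equalityI subsetI)
    fix m assume m: "m \<in> sqmon i (map e xs)"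
    then have "length m = 5" by (simp add: sqmon_def xs)
    then obtain f where "m = map f xs" by (rule map_surj)
    then show "m \<in> (\<lambda>f. map f xs) ` {f \<in> keys (St (mon e)). deg f = n}" using m * by auto
  qed (use * in auto)
qed

definition ev :: "nat \<Rightarrow> ('i pol \<Rightarrow> bit) \<Rightarrow> (nat list \<Rightarrow> bit) \<Rightarrow> bit" where
  "ev n L f = (\<Sum>e\<in>{e. deg e = n}. f (map e xs) * L (mon e))"

lemma ev_add: "ev n L (f + g) = ev n L f + ev n L g"
  by (simp add: ev_def distrib_right sum.distrib)

lemma ev_scale: "ev n L (scaleF2 c f) = c * ev n L f"
  by (simp add: ev_def scaleF2_def sum_distrib_left mult.assoc)

lemma ev_hit:
  assumes L: "Ann n L" and f: "f \<in> hit 5 n"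
  shows "ev n L f = 0"
proof -
  have "hit 5 n \<subseteq> {f. ev n L f = 0}"
    unfolding hit_def spanF2_eq
  proof (rule F2.span_minimal)
    show "F2.subspace {f. ev n L f = 0}"
      by (rule F2.subspaceI) (auto simp: ev_add ev_scale, simp add: ev_def)
    show "{Sq i f |i f d. 0 < i \<and> d + i = n \<and> f \<in> Pdeg 5 d} \<subseteq> {f. ev n L f = 0}"
    proof (clarify)
      fix i d f assume i: "0 < i" and n: "n = d + i" and f: "f \<in> Pdeg 5 d"
      let ?D = "{e :: 'i \<Rightarrow> nat. deg e = d + i}"
      have z: "(\<Sum>e\<in>?D. of_bool (map e xs \<in> sqmon i (map e' xs)) * L (mon e)) = 0" if e': "deg e' = d" for e'
      proof -
        let ?K = "keys (St (mon e'))"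
        have "(\<Sum>e\<in>?D. of_bool (map e xs \<in> sqmon i (map e' xs)) * L (mon e)) = (\<Sum>e\<in>{e\<in>?K. deg e = d + i}. L (mon e))"
          using finite_deg[of "d + i"] sqmon_eq[of e' i "d + i"] e'
          by (intro sum.mono_neutral_cong_right) (auto simp: map_inj)
        also have "\<dots> = (\<Sum>e\<in>?K. L (mon e))"
          using AnnD(3)[OF L] n by (intro sum.mono_neutral_left) auto
        also have "\<dots> = L (St (mon e'))" by (rule additive_St_mon[OF AnnD(1)[OF L], symmetric])
        also have "\<dots> = 0" using AnnD(2,3)[OF L] e' i n by simp
        finally show ?thesis .
      qed
      have "ev (d + i) L (Sq i f)
        = (\<Sum>e\<in>?D. \<Sum>l\<in>mons 5 d. f l * (of_bool (map e xs \<in> sqmon i l) * L (mon e)))"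
        unfolding ev_def Sq_eq_sum[OF f] by (simp only: sum_distrib_right mult.assoc)
      also have "\<dots> = (\<Sum>l\<in>mons 5 d. f l * (\<Sum>e\<in>?D. of_bool (map e xs \<in> sqmon i l) * L (mon e)))"
        by (subst sum.swap) (simp only: sum_distrib_left)
      also have "\<dots> = 0" using z by (intro sum.neutral) (auto simp: mons_eq)
      finally show "ev (d + i) L (Sq i f) = 0" .
    qed
  qed
  then show ?thesis using f by auto
qed

lemma Pdeg_eq_sum:
  assumes "f \<in> Pdeg 5 n"
  shows "f = (\<Sum>e\<in>{e. deg e = n}. scaleF2 (f (map e xs)) (\<delta> (map e xs)))"
proof
  fix l
  have "(\<Sum>e\<in>{e :: 'i \<Rightarrow> nat. deg e = n}. scaleF2 (f (map e xs)) (\<delta> (map e xs))) l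
    = (\<Sum>e\<in>{e :: 'i \<Rightarrow> nat. deg e = n}. f (map e xs) * of_bool (l = map e xs))"
    unfolding sum_fun_apply by (rule sum.cong) (auto simp: scaleF2_def \<delta>_def)
  also have "\<dots> = f l"
  proof (cases "l \<in> mons 5 n")
    case True
    then obtain e where e: "l = map e xs" "deg e = n" by (auto simp: mons_eq)
    have "(\<Sum>e\<in>{e :: 'i \<Rightarrow> nat. deg e = n}. f (map e xs) * of_bool (l = map e xs))
      = (\<Sum>e\<in>{e}. f (map e xs) * of_bool (l = map e xs))"
      using finite_deg[of n] e by (intro sum.mono_neutral_right) (auto simp: map_inj)
    then show ?thesis using e by simp
  next
    case False
    then have "f l = 0" using assms by (auto simp: Pdeg_def)
    moreover have "l \<noteq> map e xs" if "deg e = n" for e using False that by (auto simp: mons_eq)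
    ultimately show ?thesis by (auto intro!: sum.neutral)
  qed
  finally show "f l = (\<Sum>e\<in>{e. deg e = n}. scaleF2 (f (map e xs)) (\<delta> (map e xs))) l" by simp
qed

definition tol :: "nat \<Rightarrow> 'i pol \<Rightarrow> nat list \<Rightarrow> bit" where
  "tol n p = (\<Sum>e\<in>{e. deg e = n}. scaleF2 (lookup p e) (\<delta> (map e xs)))"

lemma tol_apply:
  assumes "deg e = n"
  shows "tol n p (map e xs) = lookup p e"
proof -
  have "tol n p (map e xs) = (\<Sum>f\<in>{e. deg e = n}. lookup p f * of_bool (f = e))"
    unfolding tol_def
    unfolding sum_fun_apply by (rule sum.cong) (auto simp: scaleF2_def \<delta>_def map_inj)
  also have "\<dots> = (\<Sum>f\<in>{e}. lookup p f * of_bool (f = e))"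
    using finite_deg[of n] assms by (intro sum.mono_neutral_right) auto
  finally show ?thesis by simp
qed

lemma tol_Pdeg: "tol n p \<in> Pdeg 5 n"
proof -
  have "tol n p l = 0" if "l \<notin> mons 5 n" for l
  proof -
    have "tol n p l = (\<Sum>f\<in>{e. deg e = n}. lookup p f * of_bool (l = map f xs))"
      unfolding tol_def
      unfolding sum_fun_apply by (rule sum.cong) (auto simp: scaleF2_def \<delta>_def)
    also have "\<dots> = 0" using that by (intro sum.neutral) (auto simp: mons_eq)
    finally show ?thesis .
  qed
  then show ?thesis unfolding Pdeg_def by blast
qed

lemma Ann_expand:
  assumes "Ann n (L :: 'i pol \<Rightarrow> bit)"
  shows "L p = (\<Sum>e\<in>{e. deg e = n}. lookup p e * L (mon e))"
proof -
  have "L p = (\<Sum>e\<in>keys p. L (mon e))"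
    by (subst (1) pol_eq_sum_mon[of p]) (simp add: additive.sum[OF AnnD(1)[OF assms]])
  also have "\<dots> = (\<Sum>e\<in>keys p \<inter> {e. deg e = n}. L (mon e))"
    using AnnD(3)[OF assms] by (intro sum.mono_neutral_right) auto
  also have "\<dots> = (\<Sum>e\<in>{e. deg e = n}. lookup p e * L (mon e))"
    using finite_deg[of n] by (intro sum.mono_neutral_cong_left) (auto simp: in_keys_iff)
  finally show ?thesis .
qed

lemma ev_tol:
  assumes "Ann n L"
  shows "ev n L (tol n p) = L p"
  unfolding ev_def Ann_expand[OF assms, of p] by (rule sum.cong) (auto simp: tol_apply)

text \<open>Converse of \<open>ev_hit\<close>. For a monomial of degree below \<open>n\<close>,
  invariance of \<open>L\<close> is the vanishing of the linear form on the image under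
  \<open>Sq (n - deg e)\<close>; from degree \<open>n\<close> on, \<open>L\<close> does not see the
  higher terms of \<open>St\<close>.\<close>

lemma Ann_of_linear:
  assumes lin: "Vector_Spaces.linear scaleF2 (*) (\<Lambda> :: (nat list \<Rightarrow> bit) \<Rightarrow> bit)"
    and hit: "\<And>f. f \<in> hit 5 n \<Longrightarrow> \<Lambda> f = 0"
  obtains L where "Ann n L" "\<And>f. f \<in> Pdeg 5 n \<Longrightarrow> \<Lambda> f = ev n L f"
proof -
  interpret \<Lambda>: Vector_Spaces.linear scaleF2 "(*)" \<Lambda> by (rule lin)
  define L where "L = lin (\<lambda>e. if deg e = n then \<Lambda> (\<delta> (map e xs)) else 0)"
  have addL: "additive L" unfolding L_def by (rule additive_lin) simp
  have Lm: "L (mon e) = (if deg e = n then \<Lambda> (\<delta> (map e xs)) else 0)" for e by (simp add: L_def)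
  have "Ann n L"
    unfolding Ann_def
  proof (intro conjI allI impI)
    fix f
    show "L (St f) = L f"
    proof (rule additive_pol_eqI[where p = f, OF _ addL])
      show "additive (\<lambda>f. L (St f))" by standard (simp add: St_add additive.add[OF addL])
      fix e :: "'i \<Rightarrow> nat"
      show "L (St (mon e)) = L (mon e)"
      proof (cases "deg e < n")
        case False
        then show ?thesis by (intro additive_St_mon_lowest[OF addL]) (auto simp: Lm)
      next
        case True
        define i where "i = n - deg e"
        have i: "0 < i" "deg e + i = n" using True by (auto simp: i_def)
        let ?K = "{f \<in> keys (St (mon e)). deg f = n}"
        have finK: "finite ?K" by simp
        have "L (St (mon e)) = (\<Sum>f\<in>keys (St (mon e)). L (mon f))" by (rule additive_St_mon[OF addL])
        also have "\<dots> = (\<Sum>f\<in>?K. \<Lambda> (\<delta> (map f xs)))"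
          by (rule sum.mono_neutral_cong_right) (auto simp: Lm)
        also have "\<dots> = \<Lambda> (\<Sum>f\<in>?K. \<delta> (map f xs))" by (rule \<Lambda>.sum[symmetric])
        also have "(\<Sum>f\<in>?K. \<delta> (map f xs)) = Sq i (\<delta> (map e xs))"
        proof
          fix m
          have de: "\<delta> (map e xs) \<in> Pdeg 5 (deg e)" by (auto simp: Pdeg_def \<delta>_def mons_eq)
          have "(\<Sum>f\<in>?K. \<delta> (map f xs)) m = (\<Sum>f\<in>?K. of_bool (m = map f xs))"
            unfolding sum_fun_apply by (rule sum.cong) (auto simp: \<delta>_def)
          also have "\<dots> = of_bool (m \<in> (\<lambda>f. map f xs) ` ?K)"
          proof (cases "m \<in> (\<lambda>f. map f xs) ` ?K")
            case True
            then obtain f where f: "f \<in> ?K" "m = map f xs" by auto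
            have "(\<Sum>f\<in>?K. of_bool (m = map f xs) :: bit) = (\<Sum>f\<in>{f}. of_bool (m = map f xs))"
              using f by (intro sum.mono_neutral_right[OF finK]) (auto simp: map_inj)
            also have "\<dots> = of_bool (m = map f xs)" by (rule trans[OF sum.insert]) auto
            finally show ?thesis using f by auto
          next
            case False
            then show ?thesis by (intro trans[OF sum.neutral]) auto
          qed
          also have "\<dots> = of_bool (m \<in> sqmon i (map e xs))" by (simp add: sqmon_eq[OF i(2)])
          also have "\<dots> = Sq i (\<delta> (map e xs)) m"
          proof -
            have "Sq i (\<delta> (map e xs)) m = (\<Sum>l\<in>{map e xs}. \<delta> (map e xs) l * of_bool (m \<in> sqmon i l))"
              unfolding Sq_eq_sum[OF de] using finite_mons[of 5 "deg e"]
              by (intro sum.mono_neutral_right) (auto simp: \<delta>_def mons_eq)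
            also have "\<dots> = \<delta> (map e xs) (map e xs) * of_bool (m \<in> sqmon i (map e xs))"
              by (rule trans[OF sum.insert]) auto
            finally show ?thesis by (simp add: \<delta>_def)
          qed
          finally show "(\<Sum>f\<in>?K. \<delta> (map f xs)) m = Sq i (\<delta> (map e xs)) m" .
        qed
        also have "\<Lambda> (Sq i (\<delta> (map e xs))) = 0"
        proof (rule hit)
          have "\<delta> (map e xs) \<in> Pdeg 5 (deg e)" by (auto simp: Pdeg_def \<delta>_def mons_eq)
          then show "Sq i (\<delta> (map e xs)) \<in> hit 5 n"
            unfolding hit_def spanF2_eq using i by (intro F2.span_base) blast
        qed
        finally show ?thesis using True by (simp add: Lm)
      qed
    qed
  qed (auto simp: addL Lm)
  moreover have "\<Lambda> f = ev n L f" if "f \<in> Pdeg 5 n" for f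
  proof -
    have "\<Lambda> f = (\<Sum>e\<in>{e. deg e = n}. f (map e xs) * \<Lambda> (\<delta> (map e xs)))"
      by (subst (1) Pdeg_eq_sum[OF that]) (simp only: \<Lambda>.sum \<Lambda>.scale)
    also have "\<dots> = ev n L f" unfolding ev_def by (rule sum.cong) (auto simp: Lm)
    finally show ?thesis .
  qed
  ultimately show ?thesis by (rule that)
qed

end

section \<open>Linear algebra over the field with two elements\<close>

interpretation bit1: vector_space "(*) :: bit \<Rightarrow> bit \<Rightarrow> bit"
  by standard (auto simp: distrib_left distrib_right mult.assoc)

lemma F2_separate:
  assumes "f \<notin> F2.span S"
  obtains \<Lambda> where "Vector_Spaces.linear scaleF2 (*) (\<Lambda> :: (nat list \<Rightarrow> bit) \<Rightarrow> bit)"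
    "\<And>x. x \<in> F2.span S \<Longrightarrow> \<Lambda> x = 0" "\<Lambda> f = 1"
proof -
  interpret vector_space_pair scaleF2 "(*) :: bit \<Rightarrow> bit \<Rightarrow> bit" ..
  obtain B where B: "B \<subseteq> S" "F2.independent B" "S \<subseteq> F2.span B"
    using F2.maximal_independent_subset[of S] .
  have "F2.span B = F2.span S"
    by (meson B F2.span_minimal F2.span_mono F2.subspace_span subset_antisym)
  then have f: "f \<notin> F2.span B" using assms by simp
  then have "F2.independent (insert f B)" using B(2) by (rule F2.independent_insertI)
  then obtain \<Lambda> where \<Lambda>: "Vector_Spaces.linear scaleF2 (*) \<Lambda>" "\<forall>x\<in>insert f B. \<Lambda> x = (if x = f then 1 else 0 :: bit)"
    using linear_independent_extend[of "insert f B" "\<lambda>x. if x = f then 1 else 0"] by blast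
  interpret \<Lambda>: Vector_Spaces.linear scaleF2 "(*)" \<Lambda> by (rule \<Lambda>(1))
  have "F2.span B \<subseteq> {x. \<Lambda> x = 0}"
  proof (rule F2.span_minimal)
    show "B \<subseteq> {x. \<Lambda> x = 0}" using \<Lambda>(2) f F2.span_base[of f B] by auto
    show "F2.subspace {x. \<Lambda> x = 0}"
      by (rule F2.subspaceI) (simp_all add: \<Lambda>.add \<Lambda>.scale)
  qed
  then show ?thesis
    using that[OF \<Lambda>(1)] \<Lambda>(2) \<open>F2.span B = F2.span S\<close> by auto
qed

text \<open>Vectors are adjoined one at a time: \<open>\<phi> x\<close> kills the span so far but
  not \<open>b x\<close>.\<close>

lemma F2_independent_dual_family:
  assumes C: "F2.independent C" "finite C" and I: "finite I"
    and add: "\<And>i f g. i \<in> I \<Longrightarrow> \<phi> i (f + g) = \<phi> i f + (\<phi> i g :: bit)"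
    and scale: "\<And>i c f. i \<in> I \<Longrightarrow> \<phi> i (scaleF2 c f) = c * \<phi> i f"
    and zero: "\<And>i f. i \<in> I \<Longrightarrow> f \<in> C \<Longrightarrow> \<phi> i f = 0"
    and dual: "\<And>i j. i \<in> I \<Longrightarrow> j \<in> I \<Longrightarrow> \<phi> i (b j) = of_bool (i = j)"
  shows "F2.independent (C \<union> b ` I) \<and> card (C \<union> b ` I) = card C + card I"
  using I add scale zero dual
proof (induction I rule: finite_induct)
  case empty
  then show ?case using C by simp
next
  case (insert x F)
  have IH: "F2.independent (C \<union> b ` F)" "card (C \<union> b ` F) = card C + card F"
    using insert by auto
  have "\<phi> x 0 = 0" using insert.prems(1)[of x 0 0] by (simp add: zero_fun_def)
  then have "F2.subspace {f. \<phi> x f = 0}"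
    by (intro F2.subspaceI) (simp_all add: insert.prems(1,2))
  moreover have "C \<union> b ` F \<subseteq> {f. \<phi> x f = 0}"
    using insert.prems(3,4) insert.hyps(2) by auto
  ultimately have "F2.span (C \<union> b ` F) \<subseteq> {f. \<phi> x f = 0}" by (intro F2.span_minimal)
  moreover have "\<phi> x (b x) = 1" using insert.prems(4)[of x x] by simp
  ultimately have bx: "b x \<notin> F2.span (C \<union> b ` F)" by auto
  then have nin: "b x \<notin> C \<union> b ` F" by (rule contrapos_nn) (rule F2.span_base)
  have "F2.independent (insert (b x) (C \<union> b ` F))" by (rule F2.independent_insertI[OF bx IH(1)])
  moreover have "card (insert (b x) (C \<union> b ` F)) = Suc (card (C \<union> b ` F))"
    using nin C(2) insert.hyps(1) by (intro card_insert_disjoint) auto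
  ultimately show ?case using IH(2) insert.hyps by simp
qed

lemma odd_keys_X_mult_square:
  assumes "e \<in> keys (X T * (q :: 'i::finite pol)\<^sup>2)"
  shows "{i. odd (e i)} = T"
proof -
  have "X T * q\<^sup>2 = (\<Sum>f\<in>keys q. X T * (mon f)\<^sup>2)"
    by (subst (1) pol_eq_sum_mon[of q]) (simp add: pol_square_sum sum_distrib_left)
  then have "e \<in> keys (\<Sum>f\<in>keys q. X T * (mon f)\<^sup>2)" using assms by simp
  then obtain f where "e \<in> keys (X T * (mon f)\<^sup>2)"
    using keys_sum[of "\<lambda>f. X T * (mon f)\<^sup>2" "keys q"] by auto
  then have "e = (\<lambda>i. of_bool (i \<in> T) + 2 * f i)" by (simp add: X_mult_square_mon)
  then show ?thesis by auto
qed

text \<open>Each word begins with a letter of at most three variables, so its monomials have an even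
  exponent and are sent to 0 by \<open>kphi\<close>.\<close>

lemma lookup_flagpol_odd:
  fixes e :: "'i::finite \<Rightarrow> nat"
  assumes five: "card (UNIV :: 'i set) = 5" and d: "3 \<le> d" and F: "F \<in> flags" and odd: "\<And>i. odd (e i)"
  shows "lookup (flagpol d s t F) e = 0"
proof -
  obtain v z u where vzu: "F = (v, z, u)" by (cases F)
  have "lookup (wm (map (\<lambda>k. {piv v, piv z, k}) (wd d K)) g) e = 0" if K: "K \<in> ups (- {piv v, piv z}) u" for K g
  proof -
    have "piv v \<noteq> piv z" "u \<noteq> {}" using F piv[of z] by (auto simp: vzu flags_def)
    then have "card K \<le> d" "K \<noteq> {}"
      using K card_mono[of "- {piv v, piv z}" K] d by (auto simp: ups_def card_compl_finite five)
    then have "length (wd d K) = d" by (intro wd) auto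
    then obtain k w where w: "wd d K = k # w" using d by (cases "wd d K") auto
    have "card {piv v, piv z, k} \<le> 3" by (simp add: card_insert_if)
    then have "{i. odd (e i)} \<noteq> {piv v, piv z, k}" using five odd by force
    then have "e \<notin> keys (X {piv v, piv z, k} * q\<^sup>2)" for q
      using odd_keys_X_mult_square by blast
    then show ?thesis unfolding w by (simp add: in_keys_iff)
  qed
  then show ?thesis unfolding vzu flagpol_def by (simp add: lookup_sum)
qed

section \<open>The dimension of the kernel\<close>

context
  fixes xs :: "'i::finite list"
  assumes xs: "distinct xs" "set xs = UNIV" "length xs = 5"
begin

text \<open>By \<open>low\<close>, \<open>L\<close> sees only monomials with all exponents odd, and
  these are exactly what \<open>kphi\<close> reads; so \<open>L\<close> factors through it.\<close>

lemma ev_kphi: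
  assumes L: "Ann (5 + 2 * M) (L :: 'i pol \<Rightarrow> bit)"
    and low: "\<And>J g. card J < 5 \<Longrightarrow> L (X J * g\<^sup>2) = 0"
  shows "ev xs (5 + 2 * M) L f = ev xs M (\<lambda>g. L (X UNIV * g\<^sup>2)) (kphi 5 f)"
proof -
  note five = five[OF xs]
  let ?h = "\<lambda>(y :: 'i \<Rightarrow> nat) i. of_bool (i \<in> UNIV) + 2 * y i"
  let ?D = "{e :: 'i \<Rightarrow> nat. deg e = 5 + 2 * M}" and ?E = "{e :: 'i \<Rightarrow> nat. deg e = M}"
  have degh: "deg (?h y) = 5 + 2 * deg y" for y
    using deg_X_mult_square[of UNIV y] five by simp
  have z: "L (mon e) = 0" if e: "e \<in> ?D - ?h ` ?E" for e
  proof -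
    define J where "J = {i. odd (e i)}"
    have eq: "e = (\<lambda>i. of_bool (i \<in> J) + 2 * (e i div 2))"
      by (auto simp: J_def fun_eq_iff)
    have "J \<noteq> UNIV"
    proof
      assume "J = UNIV"
      then have "e = ?h (\<lambda>i. e i div 2)" using eq by simp
      moreover from this have "deg (\<lambda>i. e i div 2) = M" using degh[of "\<lambda>i. e i div 2"] e by simp
      ultimately have "e \<in> ?h ` ?E" by (intro image_eqI) auto
      then show False using e by simp
    qed
    then have "card J < 5" using psubset_card_mono[of UNIV J] five by auto
    then have "L (X J * (mon (\<lambda>i. e i div 2))\<^sup>2) = 0" by (rule low)
    then show ?thesis unfolding X_mult_square_mon eq[symmetric] .
  qed
  have "ev xs (5 + 2 * M) L f = (\<Sum>e\<in>?h ` ?E. f (map e xs) * L (mon e))"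
    unfolding ev_def[OF xs]
    by (rule sum.mono_neutral_right[OF finite_deg[OF xs]]) (use z degh in auto)
  also have "\<dots> = (\<Sum>y\<in>?E. f (map (?h y) xs) * L (mon (?h y)))"
    by (subst sum.reindex) (auto simp: inj_on_def fun_eq_iff)
  also have "\<dots> = (\<Sum>y\<in>?E. kphi 5 f (map y xs) * L (X UNIV * (mon y)\<^sup>2))"
    by (rule sum.cong) (auto simp: kphi_def xs X_mult_square_mon comp_def)
  finally show ?thesis unfolding ev_def[OF xs] .
qed

lemma kphi_tol:
  assumes "\<And>e. (\<And>i. odd (e i)) \<Longrightarrow> lookup p e = 0"
  shows "kphi 5 (tol xs n p) = 0"
proof
  fix l
  show "kphi 5 (tol xs n p) l = 0 l"
  proof (cases "length l = 5")
    case True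
    then obtain y where y: "l = map y xs" by (rule map_surj[OF xs])
    let ?e = "\<lambda>i. 2 * y i + 1"
    have "tol xs n p (map ?e xs) = 0"
    proof (cases "deg ?e = n")
      case True
      then show ?thesis using assms[of ?e] by (simp add: tol_apply[OF xs])
    next
      case False
      then have "map ?e xs \<notin> mons 5 n" by (simp add: mons_def sum_list_map[OF xs])
      then show ?thesis using tol_Pdeg[OF xs, of n p] by (auto simp: Pdeg_def)
    qed
    then show ?thesis using True by (simp add: kphi_def y comp_def)
  qed (simp add: kphi_def)
qed

text \<open>The flag polynomials are a basis modulo hit polynomials. They span, since a form killing
  them and all hits factors through \<open>kphi\<close> by a form that kills hits, and so vanishes
  on \<open>K\<close>. They are independent because of the dual forms \<open>lam\<close>.\<close>

theorem kameko_ker_dim_eq: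
  assumes n: "n + 3 = 2 ^ (d + s + t) + 2 ^ (d + s) + 2 ^ d"
    and d: "3 \<le> d" and s: "4 \<le> s" and t: "4 \<le> t"
  shows "kameko_ker_dim 5 n = 31 * 15 * 7"
proof -
  note five = five[OF xs]
  have nw: "n = wt (blocks d s t)" using n wt_blocks[of d s t] by simp
  obtain d' where d': "d = Suc d'" using d by (cases d) auto
  have blocks: "blocks d s t = 3 # blocks d' s t" by (simp add: blocks_def d')
  have good: "good (blocks d s t)" using s t by (intro good_blocks) auto
  define M where "M = (n - 5) div 2"
  \<comment> \<open>As \<open>n = 3 + 2 * wt (blocks d' s t)\<close>, this makes
    \<open>n - 5\<close> even and not truncated.\<close>
  have "wt (blocks d' s t) \<noteq> 0"
    using wt_blocks[of d' s t] less_exp[of "d' + s + t"] s t by linarith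
  then have M: "n = 5 + 2 * M" unfolding M_def nw blocks by simp
  define b where "b = (\<lambda>F :: 'i set \<times> 'i set \<times> 'i set. tol xs n (flagpol d s t F))"
  define K where "K = {f \<in> Pdeg 5 n. kphi 5 f \<in> hit 5 ((n - 5) div 2)}"
  have finflags: "finite (flags :: ('i set \<times> 'i set \<times> 'i set) set)" by simp

  have upper: "K \<subseteq> F2.span (b ` flags \<union> hit 5 n)"
  proof
    fix f assume f: "f \<in> K"
    show "f \<in> F2.span (b ` flags \<union> hit 5 n)"
    proof (rule ccontr)
      assume "f \<notin> F2.span (b ` flags \<union> hit 5 n)"
      then obtain \<Lambda> where lin: "Vector_Spaces.linear scaleF2 (*) (\<Lambda> :: (nat list \<Rightarrow> bit) \<Rightarrow> bit)"
        and \<Lambda>0: "\<And>x. x \<in> F2.span (b ` flags \<union> hit 5 n) \<Longrightarrow> \<Lambda> x = 0" and \<Lambda>1: "\<Lambda> f = 1"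
        by (rule F2_separate) blast
      have "\<Lambda> g = 0" if "g \<in> hit 5 n" for g using that by (intro \<Lambda>0 F2.span_base) auto
      then have "\<exists>L :: 'i pol \<Rightarrow> bit. Ann n L \<and> (\<forall>g\<in>Pdeg 5 n. \<Lambda> g = ev xs n L g)"
        by (rule Ann_of_linear[OF xs lin, of n]) auto
      then obtain L :: "'i pol \<Rightarrow> bit" where L: "Ann n L" and \<Lambda>L: "\<And>g. g \<in> Pdeg 5 n \<Longrightarrow> \<Lambda> g = ev xs n L g"
        by blast
      have Lw: "Ann (wt (blocks d s t)) L" using L nw by simp
      have LF: "L (flagpol d s t F) = 0" if "F \<in> flags" for F
      proof -
        have "L (flagpol d s t F) = \<Lambda> (b F)"
          unfolding b_def by (simp add: \<Lambda>L tol_Pdeg[OF xs] ev_tol[OF xs L])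
        also have "\<dots> = 0" using that by (intro \<Lambda>0 F2.span_base) auto
        finally show ?thesis .
      qed
      have min: "L (wm ws 1) = 0" if "map card ws = blocks d s t" for ws
        using flags_determine_min_words[OF five d s t Lw LF that] .
      have low: "L (X J * g\<^sup>2) = 0" if J: "card J < 5" for J g
      proof -
        consider "card J < 3" | "card J = 3" | "card J = 4" using J by linarith
        then show ?thesis
        proof cases
          case 1
          then show ?thesis using good_low[OF good[unfolded blocks] Lw[unfolded blocks]] by blast
        next
          case 2
          have "L (wm [J] g) = 0"
            by (rule min_words_determine[OF five _ _ _ Lw min, where j = 1]) (use d s t 2 in \<open>auto simp: blocks\<close>)
          then show ?thesis by simp
        next
          case 3
          then show ?thesis by (intro Ann_parity[OF L]) (simp add: M)
        qed
      qed
      have L5: "Ann (card (UNIV :: 'i set) + 2 * M) L" using L M five by simp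
      have "Ann M (\<lambda>g. L (X UNIV * g\<^sup>2))"
        by (rule Ann_down[OF L5]) (simp add: low five)
      moreover have "kphi 5 f \<in> hit 5 M" using f by (simp add: K_def M_def)
      ultimately have "ev xs M (\<lambda>g. L (X UNIV * g\<^sup>2)) (kphi 5 f) = 0" by (rule ev_hit[OF xs])
      then have "ev xs n L f = 0" using ev_kphi[of M L f] L low by (simp add: M)
      then show False using \<Lambda>1 \<Lambda>L[of f] f by (simp add: K_def)
    qed
  qed

  have b_K: "b ` flags \<subseteq> K"
  proof clarify
    fix v z u :: "'i set" assume F: "(v, z, u) \<in> flags"
    have "kphi 5 (b (v, z, u)) = 0"
      unfolding b_def by (rule kphi_tol) (rule lookup_flagpol_odd[OF five d F])
    then show "b (v, z, u) \<in> K"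
      by (simp add: K_def b_def tol_Pdeg[OF xs] hit_def spanF2_eq F2.span_zero)
  qed

  obtain C where C: "C \<subseteq> hit 5 n" "F2.independent C" "hit 5 n \<subseteq> F2.span C" "card C = F2.dim (hit 5 n)"
    using F2.basis_exists[of "hit 5 n"] .
  have spC: "F2.span C = F2.span (hit 5 n)"
    by (meson C(1,3) F2.span_minimal F2.span_mono F2.subspace_span subset_antisym)
  have Pdeg_sum: "g \<in> F2.span (\<delta> ` mons 5 n)" if "g \<in> Pdeg 5 n" for g
    by (subst Pdeg_eq_sum[OF xs that])
      (rule F2.span_sum, rule F2.span_scale, rule F2.span_base, auto simp: mons_eq[OF xs])
  have "hit 5 n \<subseteq> F2.span (\<delta> ` mons 5 n)"
    unfolding hit_def spanF2_eq
  proof (rule F2.span_minimal[OF _ F2.subspace_span], clarify)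
    fix i g k assume g: "g \<in> Pdeg 5 k" and n: "n = k + i"
    have "Sq i g \<in> Pdeg 5 (k + i)"
      unfolding Pdeg_def
    proof (intro CollectI allI impI)
      fix m assume "Sq i g m \<noteq> 0"
      then have "(\<Sum>l\<in>mons 5 k. g l * of_bool (m \<in> sqmon i l)) \<noteq> 0" by (simp only: Sq_eq_sum[OF g] not_False_eq_True)
      then obtain l where l: "l \<in> mons 5 k" "g l * of_bool (m \<in> sqmon i l) \<noteq> 0"
        by (rule sum.not_neutral_contains_not_neutral)
      then have "m \<in> sqmon i l" by (cases "m \<in> sqmon i l") auto
      then show "m \<in> mons 5 (k + i)" using l(1) by (auto simp: mons_def sqmon_def)
    qed
    then show "Sq i g \<in> F2.span (\<delta> ` mons 5 (k + i))" using Pdeg_sum n by simp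
  qed
  then have finC: "finite C"
    using F2.independent_span_bound[of "\<delta> ` mons 5 n" C] C(1,2) finite_mons[of 5 n] by auto

  obtain c0 c1 c2 :: 'i where c: "distinct [c0, c1, c2]"
  proof (rule that[of "xs ! 0" "xs ! 1" "xs ! 2"])
    show "distinct [xs ! 0, xs ! 1, xs ! 2]" using xs by (simp add: nth_eq_iff_index_eq)
  qed
  define E where "E = (\<lambda>i. if i = c0 then d + s + t else if i = c1 then d + s else if i = c2 then d else 0)"
  have pos: "0 < (2 :: nat) ^ k" for k by simp
  have "deg (spike E) = (\<Sum>i\<in>{c0, c1, c2}. spike E i)"
    unfolding deg_def by (rule sum.mono_neutral_right) (auto simp: spike_def E_def)
  also have "\<dots> = (2 ^ (d + s + t) - 1) + ((2 ^ (d + s) - 1) + (2 ^ d - 1))"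
    using c by (auto simp: spike_def E_def)
  finally have degE: "deg (spike E) = n"
    using n pos[of "d + s + t"] pos[of "d + s"] pos[of d] by linarith
  define \<phi> where "\<phi> = (\<lambda>(v, z, u). ev xs n (lam c0 c1 c2 v z u E))"
  have Al: "Ann n (lam c0 c1 c2 v z u E)" for v z u using Ann_lam[OF c, where v = v and z = z and u = u and e = E] degE by simp
  have ind: "F2.independent (C \<union> b ` flags) \<and> card (C \<union> b ` flags) = card C + card (flags :: ('i set \<times> 'i set \<times> 'i set) set)"
  proof (rule F2_independent_dual_family[OF C(2) finC finflags, where \<phi> = \<phi>])
    show "\<phi> F (f + g) = \<phi> F f + \<phi> F g" for F f g by (cases F) (simp add: \<phi>_def ev_add[OF xs])
    show "\<phi> F (scaleF2 c f) = c * \<phi> F f" for F c f by (cases F) (simp add: \<phi>_def ev_scale[OF xs])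
    show "\<phi> F f = 0" if "f \<in> C" for F f
      using ev_hit[OF xs Al] C(1) that by (cases F) (auto simp: \<phi>_def)
    show "\<phi> F (b F') = of_bool (F = F')" if "F \<in> flags" "F' \<in> flags" for F F'
    proof -
      obtain v z u v' z' u' where F: "F = (v, z, u)" "F' = (v', z', u')" by (cases F; cases F')
      have "\<phi> F (b F') = lam c0 c1 c2 v z u E (flagpol d s t (v', z', u'))"
        unfolding F \<phi>_def b_def by (simp add: ev_tol[OF xs Al])
      also have "\<dots> = of_bool ((v', z', u') = (v, z, u))"
        unfolding E_def by (rule lam_flagpol[OF five c d s t]) (use that F in auto)
      finally show ?thesis unfolding F by (simp only: eq_commute)
    qed
  qed
  have "F2.span (C \<union> b ` flags) = F2.span (K \<union> hit 5 n)"
  proof (rule subset_antisym; rule F2.span_minimal[OF _ F2.subspace_span])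
    show "C \<union> b ` flags \<subseteq> F2.span (K \<union> hit 5 n)"
      using C(1) b_K F2.span_superset[of "K \<union> hit 5 n"] by blast
    have h: "hit 5 n \<subseteq> F2.span (C \<union> b ` flags)"
      using C(3) F2.span_mono[of C "C \<union> b ` flags"] by auto
    then have "F2.span (b ` flags \<union> hit 5 n) \<subseteq> F2.span (C \<union> b ` flags)"
      using F2.span_superset[of "C \<union> b ` flags"] by (intro F2.span_minimal[OF _ F2.subspace_span]) auto
    then show "K \<union> hit 5 n \<subseteq> F2.span (C \<union> b ` flags)" using upper h by auto
  qed
  then have "F2.dim (K \<union> hit 5 n) = card C + 31 * 15 * 7"
    using F2.dim_eq_card ind card_flags[OF five] by simp
  then show ?thesis
    unfolding kameko_ker_dim_def K_def[symmetric] spanF2_eq dimF2_eq F2.dim_span using C(4) by simp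
qed

end

theorem theorem1p2:
  fixes d s t n :: nat
  assumes "n = 2 ^ (d + s + t) + 2 ^ (d + s) + 2 ^ d - 3"
    and "d \<ge> 6" and "s \<ge> 4" and "t \<ge> 4"
  shows "kameko_ker_dim 5 n = (2 ^ 3 - 1) * (2 ^ 4 - 1) * (2 ^ 5 - 1)
         \<and> (2 ^ 3 - 1) * (2 ^ 4 - 1) * (2 ^ 5 - 1) = (3255::nat)"
proof -
  \<comment> \<open>A five-element type of variables, whose enumeration fixes the order in which
    exponents are listed.\<close>
  let ?xs = "enum_class.enum :: Enum.finite_5 list"
  have xs: "distinct ?xs" "set ?xs = UNIV" "length ?xs = 5"
    by (rule enum_distinct, rule enum_UNIV) (simp add: enum_finite_5_def)
  \<comment> \<open>By \<open>wt_blocks\<close> the sum of powers is at least 3, so the subtraction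
    is not truncated.\<close>
  have "n + 3 = 2 ^ (d + s + t) + 2 ^ (d + s) + 2 ^ d"
    using assms(1) wt_blocks[of d s t] by linarith
  then have "kameko_ker_dim 5 n = 31 * 15 * 7"
    by (rule kameko_ker_dim_eq[OF xs]) (use assms in auto)
  then show ?thesis by simp
qed

end
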